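(* Let $R\in\{0,1,2,\dots\}$ and let $a$ be a complex parameter. Then $$U_{R}^{(0,2)}(a,z)=U_{R}^{(0,1)}(a,z)+\Lambda_{R}(a)\,U(a,z),$$ where for $a+\tfrac12\neq 0,-1,-2,\dots$ $$\Lambda_{R}(a)=2^{-\frac12 a+\frac32 R+\frac14}\sqrt{\pi}\,e^{\left(\frac12 a+\frac12 R-\frac34\right)\pi i}\,\Gamma\left(a+\tfrac12\right)\mathbf{F}\left(\tfrac12-\tfrac12R,-\tfrac12R;\tfrac12a-\tfrac12R+\tfrac34;\tfrac12\right).$$ Moreover $$\Lambda_{R}(-a)=-\left\{\tan(\pi a)+(-1)^{R}\sec(\pi a)+i\right\}2^{-\frac12 a+\frac32R-\frac14}\,\pi\,\mathbf{F}\left(\tfrac12-\tfrac12R,-\tfrac12R;\tfrac12a-\tfrac12R+\tfrac34;\tfrac12\right),$$ provided $a\neq N+\tfrac12$ for integer $N$ with $N-R$ even.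
   Context: $U(a,z)$ is the parabolic cylinder function: the entire (in $z$) solution of $y''-(\tfrac14z^2+a)y=0$ uniquely determined by $U(a,z)\sim z^{-a-1/2}e^{-z^2/4}$ as $z\to\infty$ with $|\arg z|\le\tfrac34\pi-\delta$ (any $\delta>0$). For $R=0,1,2,\dots$ the following are particular solutions of $y''-(\tfrac14z^2+a)y=z^R$: $$U_{R}^{(0,2)}(a,z)=-\frac{\Gamma(a+\frac12)}{\sqrt{2\pi}}\left[U(a,z)\int_{-\infty}^{z}t^{R}U(a,-t)\,dt+U(a,-z)\int_{z}^{\infty}t^{R}U(a,t)\,dt\right],$$ $$U_{R}^{(0,1)}(a,z)=e^{i\pi(\frac12a-\frac14)}\left[U(-a,-iz)\int_{\infty}^{z}t^{R}U(a,t)\,dt-U(a,z)\int_{i\infty}^{z}t^{R}U(-a,-it)\,dt\right].$$ Where the first has a removable singularity in the parameter $a$ (this happens at $a=-N-\tfrac12$, $N=0,1,2,\dots$, $N-R$ odd), and likewise for the removable singularities of $\tan(\pi a)+(-1)^R\sec(\pi a)$, values are understood as limits. $\mathbf F$ is Olver's scaled hypergeometric function $\mathbf{F}(a,b;c;z)=F(a,b;c;z)/\Gamma(c)=\sum_{s=0}^{\infty}\frac{(a)_s(b)_s z^s}{\Gamma(c+s)\,s!}$. *)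

theory Defs
  imports
    "HOL-Complex_Analysis.Complex_Analysis"
    "HOL-Library.Landau_Symbols"
begin

(* The sector stays inside the open slit plane, so powr and Arg (principal branches) give
   the usual meaning of z^(-a-1/2) and arg z there. *)
definition is_parcyl_U :: "complex \<Rightarrow> (complex \<Rightarrow> complex) \<Rightarrow> bool" where
  "is_parcyl_U a f \<longleftrightarrow>
     f holomorphic_on UNIV \<and>
     (\<forall>z. deriv (deriv f) z - (z\<^sup>2 / 4 + a) * f z = 0) \<and>
     (\<forall>\<delta>::real. \<delta> > 0 \<longrightarrow>
        f \<sim>[inf at_infinity (principal {z. \<bar>Arg z\<bar> \<le> 3 / 4 * pi - \<delta>})]
          (\<lambda>z. z powr (- a - 1/2) * exp (- z\<^sup>2 / 4)))"

definition parcyl_U :: "complex \<Rightarrow> complex \<Rightarrow> complex" where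
  "parcyl_U a = (THE f. is_parcyl_U a f)"

(* Integrals between z and the point at infinity in direction d (d = 1, -1, \<i> for
   +oo, -oo, i oo). The integrands below are entire, so the finite end points determine the
   contour integrals and straight segments may be used. *)
definition integral_from_inf :: "complex \<Rightarrow> complex \<Rightarrow> (complex \<Rightarrow> complex) \<Rightarrow> complex" where
  "integral_from_inf d z f =
     Lim at_top (\<lambda>X::real. contour_integral (linepath (complex_of_real X * d) z) f)"

definition integral_to_inf :: "complex \<Rightarrow> complex \<Rightarrow> (complex \<Rightarrow> complex) \<Rightarrow> complex" where
  "integral_to_inf z d f =
     Lim at_top (\<lambda>X::real. contour_integral (linepath z (complex_of_real X * d)) f)"

(* f, with its values on the set S of removable singularities understood as limits *)
definition limits_on :: "complex set \<Rightarrow> (complex \<Rightarrow> complex) \<Rightarrow> complex \<Rightarrow> complex" where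
  "limits_on S f a = (if a \<in> S then Lim (at a) f else f a)"

(* At a = -N - 1/2 with N - R even (N a natural number) U02 has a genuine pole in a; its value
   there carries no meaning. *)
definition U02 :: "nat \<Rightarrow> complex \<Rightarrow> complex \<Rightarrow> complex" where
  "U02 R a z =
     limits_on {a. \<exists>N::nat. a = - of_nat N - 1/2 \<and> odd (int N - int R)}
       (\<lambda>a. - Gamma (a + 1/2) / of_real (sqrt (2 * pi)) *
          (parcyl_U a z * integral_from_inf (-1) z (\<lambda>t. t ^ R * parcyl_U a (- t)) +
           parcyl_U a (- z) * integral_to_inf z 1 (\<lambda>t. t ^ R * parcyl_U a t)))
       a"

definition U01 :: "nat \<Rightarrow> complex \<Rightarrow> complex \<Rightarrow> complex" where
  "U01 R a z =
     exp (\<i> * of_real pi * (a / 2 - 1/4)) *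
       (parcyl_U (- a) (- \<i> * z) * integral_from_inf 1 z (\<lambda>t. t ^ R * parcyl_U a t) -
        parcyl_U a z * integral_from_inf \<i> z (\<lambda>t. t ^ R * parcyl_U (- a) (- \<i> * t)))"

(* Olver's scaled hypergeometric function; rGamma = 1 / Gamma, with value 0 at the poles *)
definition olver_F :: "complex \<Rightarrow> complex \<Rightarrow> complex \<Rightarrow> complex \<Rightarrow> complex" where
  "olver_F a b c z =
     (\<Sum>s. pochhammer a s * pochhammer b s * z ^ s * rGamma (c + of_nat s) / fact s)"

(* tan (pi a) + (-1)^R sec (pi a) *)
definition tan_sec :: "nat \<Rightarrow> complex \<Rightarrow> complex" where
  "tan_sec R a =
     limits_on {a. \<exists>N::int. a = of_int N + 1/2 \<and> odd (N - int R)}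
       (\<lambda>a. tan (of_real pi * a) + (-1) ^ R * (1 / cos (of_real pi * a))) a"

end

theory Submission
  imports
    Defs
    "HOL-Real_Asymp.Real_Asymp"
    "HOL-Probability.Distributions"
begin

text \<open>
  Writing \<open>U(a,z) = exp(-z\<^sup>2/4) G(z)\<close>, the power series of \<open>G\<close> sums to Laplace integrals along
  rotated rays, which give the asymptotics of \<open>U\<close> for \<open>Re a > -1/2\<close>; a three-term recurrence
  in \<open>a\<close> carries them to all \<open>a\<close>. A Wronskian argument shows that a solution of Weber's equation
  that is bounded on the positive axis is a multiple of \<open>U\<close>, hence \<open>U\<close> is well defined.

  By the connection formula for \<open>U(a,-z)\<close>, the difference of the two particular solutions is
  \<open>\<Lambda>\<^sub>R(a) U(a,z)\<close>, where \<open>\<Lambda>\<^sub>R(a)\<close> is a combination of the moments \<open>\<integral> t\<^sup>R U(\<plusminus>a,t) dt\<close> over \<open>[0,\<infinity>)\<close>.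
  As a function of \<open>w\<close>, the generating function \<open>\<Sum>\<^sub>R \<Lambda>\<^sub>R(a) (iw/2)\<^sup>R / R!\<close> again solves Weber's equation and is
  bounded on \<open>[0,\<infinity>)\<close>, so it is a multiple of \<open>U(a,w)\<close>; Laplace asymptotics yield the factor.
  Thus \<open>\<Lambda>\<^sub>R(a)\<close> is, up to elementary factors, the \<open>R\<close>-th Taylor coefficient of \<open>U(a,w)\<close> at 0. Expanding
  \<open>exp(z\<^sup>2/4) U\<close> and \<open>exp(-z\<^sup>2/4) U\<close> gives two finite sums for this coefficient: one shows that \<open>\<Lambda>\<^sub>R\<close> is regular
  at the removable singularities, the other is the hypergeometric function.
\<close>

section \<open>Integrals over the half line\<close>

text \<open>The shaping obstacle is that \<open>U02\<close> is a limit in \<open>a\<close> at its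
  removable singularities. Both sides of the identity must therefore be continuous in
  \<open>a\<close>, and this forces decay bounds for U that are locally uniform in \<open>a\<close>.
  Weber's equation for the generating function comes from integrating t^n U'' by parts: the boundary
  terms at 0 from U(a,.) and U(-a,.) cancel because of the connection formula at 0. The scaling i w
  / 2 serves twice. For w >= 0 every Laplace kernel oscillates or decays, whence boundedness. Along
  w = -2 i x with x tending to +infinity exactly one kernel grows, and the ray arg w = -pi/2 lies
  within the sector where U has its normalised asymptotics. In the Taylor coefficients
  \<open>Gamma (a + 1/2)\<close> cancels against its reciprocal, and the Gamma values left over have
  poles for one parity of N - R only. At -a the reflection formula turns them into reciprocals times
  sines that agree up to sign; this common sine, combined with the exponential phase, yields the
  tangent and secant.\<close>

abbreviation half_line :: "real measure" where "half_line \<equiv> lebesgue_on {0<..}"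

lemma borel_measurable_half_line:
  "continuous_on {0<..} f \<Longrightarrow> f \<in> borel_measurable half_line"
  by (rule continuous_imp_measurable_on_sets_lebesgue) auto

lemma integrable_half_line_bound:
  fixes f :: "real \<Rightarrow> 'b::{banach, second_countable_topology}" and g :: "real \<Rightarrow> real"
  assumes "integrable half_line g" "continuous_on {0<..} f" "\<And>t. t > 0 \<Longrightarrow> norm (f t) \<le> g t"
  shows "integrable half_line f"
  by (rule Bochner_Integration.integrable_bound[OF assms(1) borel_measurable_half_line[OF assms(2)]])
     (auto intro!: AE_I2 order_trans[OF assms(3)])

lemma power_le_fact_exp:
  fixes t :: real
  assumes "t \<ge> 0"
  shows "t ^ n \<le> fact n * exp t"
proof -
  have "t ^ n / fact n \<le> exp t"
    using sum_le_suminf[OF summable_exp[of t], of "{n}"] assms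
    by (simp add: exp_def field_simps scaleR_conv_of_real)
  then show ?thesis by (simp add: field_simps)
qed

text \<open>Dominated convergence: the partial sums of the exponential series are bounded by
  \<open>exp (r * t)\<close>. It is applied to the Gamma integral with complex rate, to the Laplace
  integral for \<open>pcG\<close>, and to the generating function of the moments of
  \<open>pcU\<close>.\<close>

lemma exp_moment_sums:
  fixes g :: "real \<Rightarrow> complex" and x :: complex
  assumes g: "continuous_on {0<..} g"
    and int: "integrable half_line (\<lambda>t. exp (r * t) * norm (g t))" and r: "norm x \<le> r"
  shows "(\<lambda>n. x ^ n / fact n * (\<integral>t. of_real t ^ n * g t \<partial>half_line)) sums
           (\<integral>t. exp (x * of_real t) * g t \<partial>half_line)"
proof -
  have bd: "norm ((x * of_real t) ^ n / fact n) \<le> exp (r * t)" if "t > 0" for t n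
  proof -
    have "norm ((x * of_real t) ^ n / fact n) = (norm x * t) ^ n / fact n"
      using that by (simp add: norm_divide norm_mult norm_power)
    also have "\<dots> \<le> exp (norm x * t)"
      using power_le_fact_exp[of "norm x * t" n] that by (simp add: field_simps)
    also have "\<dots> \<le> exp (r * t)" using that r by simp
    finally show ?thesis .
  qed
  have bds: "norm (\<Sum>k<n. (x * of_real t) ^ k / fact k) \<le> exp (r * t)" if "t > 0" for t n
  proof -
    have "norm (\<Sum>k<n. (x * of_real t) ^ k / fact k) \<le> (\<Sum>k<n. norm ((x * of_real t) ^ k / fact k))"
      by (rule norm_sum)
    also have "\<dots> = (\<Sum>k<n. (norm x * t) ^ k / fact k)"
      using that by (simp add: norm_divide norm_mult norm_power)
    also have "\<dots> \<le> exp (norm x * t)"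
      using that sum_le_suminf[OF summable_exp[of "norm x*t"], of "{..<n}"] 
      by (simp add: exp_def field_simps scaleR_conv_of_real)
    also have "\<dots> \<le> exp (r * t)" using that r by simp
    finally show ?thesis .
  qed
  have I: "integrable half_line (\<lambda>t. (x * of_real t) ^ n / fact n * g t)" for n
    by (rule integrable_half_line_bound[OF int])
       (use bd in \<open>auto intro!: continuous_intros g mult_right_mono simp: norm_mult simp del: times_divide_eq_left\<close>)
  have "(\<lambda>n. \<integral>t. (\<Sum>k<n. (x * of_real t) ^ k / fact k * g t) \<partial>half_line) \<longlonglongrightarrow>
          (\<integral>t. exp (x * of_real t) * g t \<partial>half_line)"
  proof (rule integral_dominated_convergence[where w="\<lambda>t. exp (r * t) * norm (g t)"])
    show "(\<lambda>t. exp (x * of_real t) * g t) \<in> borel_measurable half_line"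
      by (intro borel_measurable_half_line continuous_intros g)
    show "(\<lambda>t. \<Sum>k<n. (x * of_real t) ^ k / fact k * g t) \<in> borel_measurable half_line" for n
      by (intro borel_measurable_half_line continuous_intros g) auto
    show "AE t in half_line. (\<lambda>n. \<Sum>k<n. (x * of_real t) ^ k / fact k * g t)
             \<longlonglongrightarrow> exp (x * of_real t) * g t"
    proof (rule AE_I2)
      fix t
      have "(\<lambda>n. (x * of_real t) ^ n / fact n * g t) sums (exp (x * of_real t) * g t)"
        using exp_converges[of "x * of_real t"] 
        by (intro sums_mult2) (simp add: scaleR_conv_of_real field_simps)
      then show "(\<lambda>n. \<Sum>k<n. (x * of_real t) ^ k / fact k * g t)
             \<longlonglongrightarrow> exp (x * of_real t) * g t" by (simp add: sums_def)
    qed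
    show "AE t in half_line. norm (\<Sum>k<n. (x * of_real t) ^ k / fact k * g t) \<le> exp (r * t) * norm (g t)" for n
      using bds by (auto intro!: AE_I2 mult_right_mono simp: norm_mult simp del: times_divide_eq_left simp flip: sum_distrib_right)
  qed (fact int)
  also have "(\<lambda>n. \<integral>t. (\<Sum>k<n. (x * of_real t) ^ k / fact k * g t) \<partial>half_line) =
     (\<lambda>n. \<Sum>k<n. x ^ k / fact k * (\<integral>t. of_real t ^ k * g t \<partial>half_line))"
    using I by (simp add: Bochner_Integration.integral_sum power_mult_distrib mult.assoc
         flip: integral_mult_right_zero)
  finally show ?thesis by (simp add: sums_def)
qed

lemma half_line_substitution:
  fixes f :: "real \<Rightarrow> complex" and g g' :: "real \<Rightarrow> real"
  assumes f: "integrable half_line f"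
    and der: "\<And>x. x > 0 \<Longrightarrow> (g has_real_derivative g' x) (at x)"
    and pos: "\<And>x. x > 0 \<Longrightarrow> g' x > 0"
    and im: "g ` {0<..} = {0<..}" and inj: "inj_on g {0<..}"
  shows "integrable half_line (\<lambda>x. of_real (g' x) * f (g x))"
    and "(\<integral>x. of_real (g' x) * f (g x) \<partial>half_line) = (\<integral>x. f x \<partial>half_line)"
proof -
  have d: "\<And>x. x \<in> {0<..} \<Longrightarrow> (g has_field_derivative g' x) (at x within {0<..})"
    using der by (auto intro: has_field_derivative_at_within)
  have real: "integrable half_line (\<lambda>x. g' x * h (g x)) \<and> (\<integral>x. g' x * h (g x) \<partial>half_line) = (\<integral>x. h x \<partial>half_line)"
    if h: "integrable half_line h" for h :: "real \<Rightarrow> real"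
  proof -
    have "h absolutely_integrable_on {0<..}"
      using h by (simp add: set_integrable_def integrable_restrict_space)
    then have *: "(\<lambda>x. \<bar>g' x\<bar> * h (g x)) absolutely_integrable_on {0<..}"
        "integral {0<..} (\<lambda>x. \<bar>g' x\<bar> * h (g x)) = integral {0<..} h"
      using has_absolute_integral_change_of_variables_1'[OF _ d inj, of h "integral {0<..} h"] im by auto
    have i: "integrable half_line (\<lambda>x. \<bar>g' x\<bar> * h (g x))"
      by (rule absolutely_integrable_imp_integrable[OF *(1)]) simp
    have c: "\<bar>g' x\<bar> * h (g x) = g' x * h (g x)" if "x \<in> space half_line" for x
      using pos[of x] that by simp
    have "(\<integral>x. \<bar>g' x\<bar> * h (g x) \<partial>half_line) = (\<integral>x. h x \<partial>half_line)"
      using *(2) i h by (simp add: lebesgue_integral_eq_integral)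
    moreover have "(\<integral>x. \<bar>g' x\<bar> * h (g x) \<partial>half_line) = (\<integral>x. g' x * h (g x) \<partial>half_line)"
      by (rule Bochner_Integration.integral_cong[OF refl c])
    moreover have "integrable half_line (\<lambda>x. g' x * h (g x))"
      by (rule Bochner_Integration.integrable_cong[THEN iffD1, OF refl c i])
    ultimately show ?thesis by simp
  qed
  note R = real[OF integrable_Re[OF f]] and I = real[OF integrable_Im[OF f]]
  have eq: "of_real (g' x) * f (g x) = of_real (g' x * Re (f (g x))) + \<i> * of_real (g' x * Im (f (g x)))" for x
    by (simp add: complex_eq_iff)
  show "integrable half_line (\<lambda>x. of_real (g' x) * f (g x))"
    unfolding eq using R I
    by (intro Bochner_Integration.integrable_add integrable_mult_right integrable_of_real) auto
  have "(\<integral>x. of_real (g' x) * f (g x) \<partial>half_line) =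
      of_real (\<integral>x. g' x * Re (f (g x)) \<partial>half_line) + \<i> * of_real (\<integral>x. g' x * Im (f (g x)) \<partial>half_line)"
    unfolding eq using R I
    by (subst Bochner_Integration.integral_add) (auto simp del: of_real_mult intro!: integrable_of_real)
  also have "\<dots> = (\<integral>x. f x \<partial>half_line)"
    using f R I by (simp add: complex_eq_iff)
  finally show "(\<integral>x. of_real (g' x) * f (g x) \<partial>half_line) = (\<integral>x. f x \<partial>half_line)" .
qed

lemma has_Gamma_integral_scaled_real:
  fixes s :: complex and K :: real
  assumes s: "Re s > 0" and K: "K > 0"
  shows "integrable half_line (\<lambda>t. of_real t powr (s - 1) * exp (- of_real (K * t)))"
    and "(\<integral>t. of_real t powr (s - 1) * exp (- of_real (K * t)) \<partial>half_line) = Gamma s * of_real K powr (- s)"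
proof -
  let ?f = "\<lambda>t::real. of_real t powr (s - 1) / of_real (exp t) :: complex"
  have f: "integrable half_line ?f"
    using absolutely_integrable_Gamma_integral'[OF s] by (rule absolutely_integrable_imp_integrable) auto
  have fi: "(\<integral>t. ?f t \<partial>half_line) = Gamma s"
    using f by (subst lebesgue_integral_eq_integral) (auto intro!: integral_unique Gamma_integral_complex' s)
  have im: "(\<lambda>t. K * t) ` {0<..} = {0<..}"
    using K by (auto simp: image_iff intro!: bexI[of _ "_ / K"])
  have inj: "inj_on (\<lambda>t. K * t) {0<..}" using K by (auto simp: inj_on_def)
  note sub = half_line_substitution[OF f, of "\<lambda>t. K * t" "\<lambda>_. K", OF _ _ im inj]
  have sub1: "integrable half_line (\<lambda>x. of_real K * ?f (K * x))"
    by (rule sub(1)) (use K in \<open>auto intro!: derivative_eq_intros\<close>)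
  have sub2: "(\<integral>x. of_real K * ?f (K * x) \<partial>half_line) = Gamma s"
    unfolding fi[symmetric] by (rule sub(2)) (use K in \<open>auto intro!: derivative_eq_intros\<close>)
  have eq: "of_real K * ?f (K * t) = of_real K powr s * (of_real t powr (s - 1) * exp (- of_real (K * t)))" if "t > 0" for t
  proof -
    have "of_real (K * t) powr (s - 1) = (of_real K powr (s - 1) * of_real t powr (s - 1) :: complex)"
      using K that by (simp add: powr_times_real)
    moreover have "of_real K * of_real K powr (s - 1) = (of_real K powr s :: complex)"
      using K by (simp add: powr_diff)
    ultimately show ?thesis
      by (simp add: exp_minus divide_inverse mult.assoc[symmetric] flip: exp_of_real)
  qed
  have nz: "of_real K powr s \<noteq> (0::complex)" using K by simp
  have i: "integrable half_line (\<lambda>t. of_real K powr s * (of_real t powr (s - 1) * exp (- of_real (K * t))))"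
    by (rule Bochner_Integration.integrable_cong[THEN iffD1, OF refl _ sub1]) (use eq in auto)
  have "integrable half_line (\<lambda>t. inverse (of_real K powr s) * (of_real K powr s * (of_real t powr (s - 1) * exp (- of_real (K * t)))))"
    by (intro integrable_mult_right i)
  then show "integrable half_line (\<lambda>t. of_real t powr (s - 1) * exp (- of_real (K * t)))"
    using nz by (simp add: mult.assoc[symmetric] del: of_real_mult)
  have "(\<integral>t. of_real K powr s * (of_real t powr (s - 1) * exp (- of_real (K * t))) \<partial>half_line) = Gamma s"
    unfolding sub2[symmetric] by (rule Bochner_Integration.integral_cong) (use eq in auto)
  then show "(\<integral>t. of_real t powr (s - 1) * exp (- of_real (K * t)) \<partial>half_line) = Gamma s * of_real K powr (- s)"
    using nz by (simp add: powr_minus field_simps)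
qed


lemma integrable_powr_exp:
  fixes \<sigma> K :: real
  assumes "\<sigma> > 0" "K > 0"
  shows "integrable half_line (\<lambda>t. t powr (\<sigma> - 1) * exp (- (K * t)))"
    and "(\<integral>t. t powr (\<sigma> - 1) * exp (- (K * t)) \<partial>half_line) = Gamma \<sigma> * K powr (- \<sigma>)"
proof -
  note h = has_Gamma_integral_scaled_real[of "of_real \<sigma>" K]
  have eq: "of_real t powr (of_real \<sigma> - 1) * exp (- of_real (K * t)) = complex_of_real (t powr (\<sigma> - 1) * exp (- (K * t)))" if "t > 0" for t
    using powr_of_real[of t "\<sigma> - 1"] that by (simp flip: exp_of_real)
  have i: "integrable half_line (\<lambda>t. norm (complex_of_real t powr (of_real \<sigma> - 1) * exp (- of_real (K * t))))"
    by (intro integrable_norm h(1)) (use assms in auto)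
  show i': "integrable half_line (\<lambda>t. t powr (\<sigma> - 1) * exp (- (K * t)))"
    by (rule Bochner_Integration.integrable_cong[THEN iffD1, OF refl _ i]) (use eq in \<open>auto simp del: of_real_mult\<close>)
  have "complex_of_real (\<integral>t. t powr (\<sigma> - 1) * exp (- (K * t)) \<partial>half_line) = 
       (\<integral>t. complex_of_real (t powr (\<sigma> - 1) * exp (- (K * t))) \<partial>half_line)"
    by (rule integral_of_real[OF i', symmetric])
  also have "\<dots> = (\<integral>t. of_real t powr (of_real \<sigma> - 1) * exp (- of_real (K * t)) \<partial>half_line)"
    by (rule Bochner_Integration.integral_cong) (use eq in auto)
  also have "\<dots> = Gamma (of_real \<sigma>) * of_real K powr (- of_real \<sigma>)"
    using h(2) assms by simp
  also have "\<dots> = of_real (Gamma \<sigma> * K powr (- \<sigma>))"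
    using assms powr_of_real[of K "-\<sigma>"] by (simp add: Gamma_complex_of_real)
  finally show "(\<integral>t. t powr (\<sigma> - 1) * exp (- (K * t)) \<partial>half_line) = Gamma \<sigma> * K powr (- \<sigma>)"
    using of_real_eq_iff by blast
qed

lemma norm_powr_of_real: "t > 0 \<Longrightarrow> norm (complex_of_real t powr s) = t powr Re s"
  by (simp add: norm_powr_real_powr)

lemma continuous_on_powr_half_line [continuous_intros]:
  "continuous_on {0<..} (\<lambda>t. complex_of_real t powr s)"
  by (intro continuous_intros) (auto simp: complex_nonpos_Reals_iff)

text \<open>No contour is rotated. With
  \<open>exp (- w * t) = exp (- K * t) * exp ((K - w) * t)\<close> for a real rate \<open>K\<close>,
  the moments of the first factor are known, and summing them gives the binomial series of
  \<open>w powr (- s)\<close> about \<open>K\<close>.\<close>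

lemma has_Gamma_integral_scaled:
  fixes s w :: complex
  assumes s: "Re s > 0" and w: "Re w > 0"
  shows "integrable half_line (\<lambda>t. of_real t powr (s - 1) * exp (- w * of_real t))"
    and "(\<integral>t. of_real t powr (s - 1) * exp (- w * of_real t) \<partial>half_line) = Gamma s * w powr (- s)"
proof -
  show "integrable half_line (\<lambda>t. of_real t powr (s - 1) * exp (- w * of_real t))"
    by (rule integrable_half_line_bound[OF integrable_powr_exp(1)[OF s w]])
       (auto intro!: continuous_intros simp: norm_mult norm_powr_of_real)
  obtain K :: real where K: "K > 0" "norm (of_real K - w) < K"
  proof
    \<comment> \<open>The discs of radius \<open>K\<close> about \<open>K\<close> exhaust the right
      half plane; \<open>w\<close> lies inside as soon as
      \<open>(norm w)\<^sup>2 < 2 * Re w * K\<close>.\<close>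
    define K where "K = 1 + (norm w)\<^sup>2 / (2 * Re w)"
    have Kpos: "K > 0" using w by (simp add: K_def add_pos_nonneg)
    then show "K > 0" .
    have "(norm w)\<^sup>2 < 2 * Re w * K" using w by (simp add: K_def field_simps)
    then have "(norm (of_real K - w))\<^sup>2 < K\<^sup>2"
      unfolding cmod_power2 by (simp add: power2_eq_square algebra_simps)
    then show "norm (of_real K - w) < K" using Kpos power_less_imp_less_base by fastforce
  qed
  define g where "g = (\<lambda>t::real. of_real t powr (s - 1) * exp (- of_real (K * t)) :: complex)"
  have g: "continuous_on {0<..} g" unfolding g_def by (intro continuous_intros)
  have ng: "exp (r * t) * norm (g t) = t powr (Re s - 1) * exp (- ((K - r) * t))" if "t > 0" for t r
    using that unfolding g_def norm_mult norm_exp_eq_Re norm_powr_of_real[OF that] by (simp add: algebra_simps flip: exp_add)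
  have int: "integrable half_line (\<lambda>t. exp (norm (of_real K - w) * t) * norm (g t))"
    by (rule Bochner_Integration.integrable_cong[THEN iffD1, OF refl _ integrable_powr_exp(1)[of "Re s" "K - norm (of_real K - w)"]])
       (use ng K s in auto)
  have mom: "(\<integral>t. of_real t ^ n * g t \<partial>half_line) = Gamma s * of_real K powr (- s) * (pochhammer s n / of_real K ^ n)" for n
  proof -
    have "(\<integral>t. of_real t ^ n * g t \<partial>half_line) = (\<integral>t. of_real t powr ((s + of_nat n) - 1) * exp (- of_real (K * t)) \<partial>half_line)"
      by (rule Bochner_Integration.integral_cong)
         (auto simp: g_def powr_nat' powr_add powr_diff)
    also have "\<dots> = Gamma (s + of_nat n) * of_real K powr (- (s + of_nat n))"
      using s K by (intro has_Gamma_integral_scaled_real(2)) auto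
    also have "Gamma (s + of_nat n) = pochhammer s n * Gamma s"
    proof -
      have "s \<notin> \<int>\<^sub>\<le>\<^sub>0" using s by (auto elim!: nonpos_Ints_cases)
      then show ?thesis by (simp add: pochhammer_Gamma Gamma_eq_zero_iff)
    qed
    also have "of_real K powr (- (s + of_nat n)) = of_real K powr (-s) / of_real K ^ n"
      using K by (simp add: powr_diff powr_nat')
    finally show ?thesis by simp
  qed
  have "(\<lambda>n. (of_real K - w) ^ n / fact n * (\<integral>t. of_real t ^ n * g t \<partial>half_line)) sums
           (\<integral>t. exp ((of_real K - w) * of_real t) * g t \<partial>half_line)"
    by (rule exp_moment_sums[OF g int]) auto
  moreover have "(\<integral>t. exp ((of_real K - w) * of_real t) * g t \<partial>half_line) = (\<integral>t. of_real t powr (s - 1) * exp (- w * of_real t) \<partial>half_line)"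
    by (rule Bochner_Integration.integral_cong) (auto simp: g_def algebra_simps simp flip: exp_add)
  moreover have "(\<lambda>n. (of_real K - w) ^ n / fact n * (\<integral>t. of_real t ^ n * g t \<partial>half_line)) sums (Gamma s * w powr (- s))"
  proof -
    define q where "q = (w - of_real K) / of_real K"
    have q: "norm q < 1" using K by (simp add: q_def norm_divide norm_minus_commute)
    have "(\<lambda>n. (- s gchoose n) * q ^ n) sums (1 + q) powr (- s)" by (rule gen_binomial_complex[OF q])
    then have "(\<lambda>n. Gamma s * of_real K powr (- s) * ((- s gchoose n) * q ^ n)) sums (Gamma s * of_real K powr (- s) * (1 + q) powr (- s))"
      by (rule sums_mult)
    moreover have "of_real K powr (- s) * (1 + q) powr (- s) = w powr (- s)"
    proof -
      have "1 + q = of_real (1 / K) * w" using K by (simp add: q_def field_simps)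
      then have "w = of_real K * (1 + q)" using K by simp
      then show ?thesis using K powr_times_real_left[of "of_real K" "1 + q" "- s"] by simp
    qed
    moreover have "(of_real K - w) ^ n / fact n * (\<integral>t. of_real t ^ n * g t \<partial>half_line)
        = Gamma s * of_real K powr (- s) * ((- s gchoose n) * q ^ n)" for n
    proof -
      have "(- s gchoose n) * q ^ n = (of_real K - w) ^ n / fact n * (pochhammer s n / of_real K ^ n)"
        by (simp add: gbinomial_pochhammer q_def power_divide power_minus[of "w - of_real K"] flip: power_mult_distrib)
      then show ?thesis unfolding mom by simp
    qed
    ultimately show ?thesis by (simp only: mult.assoc)
  qed
  ultimately show "(\<integral>t. of_real t powr (s - 1) * exp (- w * of_real t) \<partial>half_line) = Gamma s * w powr (- s)"
    by (metis (no_types) sums_unique2)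
qed

lemma gaussian_moment_half_line:
  fixes s w :: complex
  assumes s: "Re s > 0" and w: "Re w > 0"
  shows "integrable half_line (\<lambda>t. of_real t powr (s - 1) * exp (- w * (of_real t)\<^sup>2 / 2))"
    and "(\<integral>t. of_real t powr (s - 1) * exp (- w * (of_real t)\<^sup>2 / 2) \<partial>half_line) =
           2 powr (s / 2 - 1) * Gamma (s / 2) * w powr (- (s / 2))"
proof -
  let ?f = "\<lambda>t::real. of_real t powr (s / 2 - 1) * exp (- w * of_real t)"
  have f: "integrable half_line ?f" and fi: "(\<integral>t. ?f t \<partial>half_line) = Gamma (s / 2) * w powr (- (s / 2))"
    using has_Gamma_integral_scaled[of "s / 2" w] s w by auto
  have im: "(\<lambda>t. t\<^sup>2 / 2) ` {0<..} = {0::real<..}"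
  proof -
    have "t \<in> (\<lambda>t. t\<^sup>2 / 2) ` {0::real<..}" if "t > 0" for t
      using that by (intro image_eqI[of _ _ "sqrt (2 * t)"]) auto
    then show ?thesis by auto
  qed
  have inj: "inj_on (\<lambda>t::real. t\<^sup>2 / 2) {0<..}"
    by (auto simp: inj_on_def power2_eq_iff)
  note sub = half_line_substitution[OF f, of "\<lambda>t. t\<^sup>2 / 2" "\<lambda>t. t", OF _ _ im inj]
  have sub1: "integrable half_line (\<lambda>x. of_real x * ?f (x\<^sup>2 / 2))"
    by (rule sub(1)) (auto intro!: derivative_eq_intros)
  have sub2: "(\<integral>x. of_real x * ?f (x\<^sup>2 / 2) \<partial>half_line) = Gamma (s / 2) * w powr (- (s / 2))"
    unfolding fi[symmetric] by (rule sub(2)) (auto intro!: derivative_eq_intros)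
  have eq: "2 powr (s / 2 - 1) * (of_real t * ?f (t\<^sup>2 / 2)) = of_real t powr (s - 1) * exp (- w * (of_real t)\<^sup>2 / 2)" if t: "t > 0" for t
  proof -
    have "of_real (t\<^sup>2 / 2) = complex_of_real t * of_real t * of_real (1/2)" by (simp add: power2_eq_square)
    also have "\<dots> powr (s / 2 - 1) = of_real t powr (s / 2 - 1) * of_real t powr (s / 2 - 1) * of_real (1/2) powr (s / 2 - 1)"
      using t by (simp only: mult.assoc powr_times_real_left Reals_of_real Re_complex_of_real less_imp_le)
    also have "of_real (1/2) powr (s / 2 - 1) = (1 / 2 powr (s / 2 - 1) :: complex)"
      using powr_times_real_left[of "of_real (1/2)" 2 "s / 2 - 1"] by (simp add: eq_divide_eq)
    also have "of_real t powr (s / 2 - 1) * of_real t powr (s / 2 - 1) = complex_of_real t powr (s - 2)"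
      by (simp flip: powr_add)
    finally have "2 powr (s / 2 - 1) * (of_real t * of_real (t\<^sup>2 / 2) powr (s / 2 - 1)) = of_real t * complex_of_real t powr (s - 2)"
      by simp
    also have "\<dots> = complex_of_real t powr (1 + (s - 2))"
      using t by (subst powr_add) simp
    finally show ?thesis by (simp add: mult.assoc[symmetric])
  qed
  have i: "integrable half_line (\<lambda>t. 2 powr (s / 2 - 1) * (of_real t * ?f (t\<^sup>2 / 2)))"
    by (intro integrable_mult_right sub1)
  show "integrable half_line (\<lambda>t. of_real t powr (s - 1) * exp (- w * (of_real t)\<^sup>2 / 2))"
    by (rule Bochner_Integration.integrable_cong[THEN iffD1, OF refl _ i]) (use eq in auto)
  have "(\<integral>t. of_real t powr (s - 1) * exp (- w * (of_real t)\<^sup>2 / 2) \<partial>half_line) = 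
     (\<integral>t. 2 powr (s / 2 - 1) * (of_real t * ?f (t\<^sup>2 / 2)) \<partial>half_line)"
    by (rule Bochner_Integration.integral_cong) (use eq in auto)
  also have "\<dots> = 2 powr (s / 2 - 1) * (\<integral>t. of_real t * ?f (t\<^sup>2 / 2) \<partial>half_line)"
    by (rule integral_mult_right_zero)
  finally show "(\<integral>t. of_real t powr (s - 1) * exp (- w * (of_real t)\<^sup>2 / 2) \<partial>half_line) =
           2 powr (s / 2 - 1) * Gamma (s / 2) * w powr (- (s / 2))" unfolding sub2 by (simp only: mult.assoc)
qed

lemma integrable_gaussian_powr:
  fixes \<sigma> k r :: real
  assumes "\<sigma> > 0" "k > 0"
  shows "integrable half_line (\<lambda>t. t powr (\<sigma> - 1) * exp (r * t - k * t\<^sup>2))"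
proof -
  \<comment> \<open>Completing the square: \<open>(r + 1) * t - k * t\<^sup>2\<close> is at most
    \<open>(r + 1)\<^sup>2 / (4 * k)\<close>, so the Gaussian absorbs the linear exponent and still
    leaves \<open>exp (- t)\<close>.\<close>
  define C where "C = exp ((r + 1)\<^sup>2 / (4 * k))"
  have i: "integrable half_line (\<lambda>t. C * (t powr (\<sigma> - 1) * exp (- (1 * t))))"
    by (intro integrable_mult_right integrable_powr_exp assms) auto
  have "t powr (\<sigma> - 1) * exp (r * t - k * t\<^sup>2) \<le> C * (t powr (\<sigma> - 1) * exp (- (1 * t)))" for t
  proof -
    have "0 \<le> (r + 1 - 2 * k * t)\<^sup>2 / (4 * k)" using assms by simp
    also have "\<dots> = (r + 1)\<^sup>2 / (4 * k) - (r + 1) * t + k * t\<^sup>2"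
      using assms by (simp add: power2_eq_square field_simps)
    finally have "r * t - k * t\<^sup>2 \<le> (r + 1)\<^sup>2 / (4 * k) + - (1 * t)" by (simp add: algebra_simps)
    then have "exp (r * t - k * t\<^sup>2) \<le> C * exp (- (1 * t))"
      unfolding C_def exp_add[symmetric] by simp
    then have "t powr (\<sigma> - 1) * exp (r * t - k * t\<^sup>2) \<le> t powr (\<sigma> - 1) * (C * exp (- (1 * t)))"
      by (rule mult_left_mono) simp
    then show ?thesis by (simp only: mult_ac)
  qed
  then have b: "norm (t powr (\<sigma> - 1) * exp (r * t - k * t\<^sup>2)) \<le> C * (t powr (\<sigma> - 1) * exp (- (1 * t)))" for t
    by simp
  have "continuous_on {0<..} (\<lambda>t. t powr (\<sigma> - 1) * exp (r * t - k * t\<^sup>2))"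
    by (intro continuous_intros) auto
  then show ?thesis
    using b by (rule integrable_half_line_bound[OF i])
qed

section \<open>Series solutions of Weber's equation\<close>

definition gauss_fps :: "complex \<Rightarrow> complex fps" where
  "gauss_fps c = Abs_fps (\<lambda>n. if even n then c ^ (n div 2) / fact (n div 2) else 0)"

lemma gauss_fps_sums: "(\<lambda>n. fps_nth (gauss_fps c) n * z ^ n) sums exp (c * z\<^sup>2)"
proof -
  have "(\<lambda>n. fps_nth (gauss_fps c) (2 * n) * z ^ (2 * n)) sums exp (c * z\<^sup>2)"
    using exp_converges[of "c * z\<^sup>2"]
    by (simp add: gauss_fps_def power_mult_distrib scaleR_conv_of_real field_simps flip: power_mult)
  then show ?thesis
    by (subst (asm) sums_mono_reindex) (auto simp: strict_mono_def gauss_fps_def elim!: evenE)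
qed

lemma gauss_fps_conv_radius [simp]: "fps_conv_radius (gauss_fps c) = \<infinity>"
  unfolding fps_conv_radius_def by (rule conv_radius_inftyI'') (use gauss_fps_sums in \<open>blast intro: sums_summable\<close>)

lemma eval_gauss_fps: "eval_fps (gauss_fps c) z = exp (c * z\<^sup>2)"
  unfolding eval_fps_def using gauss_fps_sums sums_unique by metis

lemma fps_deriv_gauss_fps: "fps_deriv (gauss_fps c) = fps_const (2 * c) * (fps_X * gauss_fps c)"
proof (rule fps_ext)
  fix n show "fps_nth (fps_deriv (gauss_fps c)) n = fps_nth (fps_const (2 * c) * (fps_X * gauss_fps c)) n"
  proof (cases n)
    case (Suc m)
    show ?thesis
    proof (cases "even m")
      case True
      then obtain k where k: "m = 2 * k" by blast
      have "of_nat (Suc (Suc m)) * (c ^ Suc k / fact (Suc k)) = 2 * c * (c ^ k / fact k)"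
      proof -
        have "of_nat (Suc (Suc m)) = (2 * of_nat (Suc k) :: complex)" by (simp add: k)
        moreover have "of_nat (Suc k) \<noteq> (0 :: complex)" by (simp only: of_nat_eq_0_iff)
        ultimately show ?thesis unfolding fact_Suc of_nat_mult by (simp del: of_nat_Suc)
      qed
      then show ?thesis by (simp add: Suc k gauss_fps_def del: fact_Suc)
    qed (auto simp: Suc gauss_fps_def)
  qed (auto simp: gauss_fps_def)
qed

text \<open>The Taylor coefficients at 0 of \<open>exp(z\<^sup>2/4) y(z)\<close>, for the solution \<open>y\<close> of Weber's equation
  with \<open>y(0) = p\<close> and \<open>y'(0) = q\<close>.\<close>

fun wco :: "complex \<Rightarrow> complex \<Rightarrow> complex \<Rightarrow> nat \<Rightarrow> complex" where
  "wco a p q 0 = p"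
| "wco a p q (Suc 0) = q"
| "wco a p q (Suc (Suc n)) = (of_nat n + a + 1/2) / ((of_nat n + 1) * (of_nat n + 2)) * wco a p q n"

text \<open>Two steps of the recurrence gain a factor of order \<open>1 / n\<close>, hence the
  factorial of \<open>n div 2\<close>. Since the bound depends on \<open>a\<close>, \<open>p\<close>
  and \<open>q\<close> only through their norms, it also drives the uniform convergence in the
  parameter in \<open>isCont_pcG\<close>.\<close>

lemma norm_wco_le:
  "norm (wco a p q n) \<le> (norm p + norm q) * (norm a + 2) ^ n / fact (n div 2)"
proof (induction a p q n rule: wco.induct)
  case (2 a p q)
  have "norm q * 1 \<le> (norm p + norm q) * (norm a + 2)" by (rule mult_mono) auto
  then show ?case by simp
next
  case (3 a p q n)
  have e: "norm (of_nat n + 1 :: complex) = real n + 1" "norm (of_nat n + 2 :: complex) = real n + 2"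
    using norm_of_nat[of "n + 1", where 'a = complex] norm_of_nat[of "n + 2", where 'a = complex] by (simp_all add: add.commute del: norm_of_nat)
  have "norm (of_nat n + a + 1/2) \<le> real n + norm a + 1/2"
    using norm_triangle_ineq[of "of_nat n + a" "1/2"] norm_triangle_ineq[of "of_nat n" a] by simp
  also have "\<dots> \<le> (real n + 1) * (norm a + 1)" by (simp add: algebra_simps)
  finally have "norm ((of_nat n + a + 1/2) / ((of_nat n + 1) * (of_nat n + 2))) \<le> (real n + 1) * (norm a + 1) / ((real n + 1) * (real n + 2))"
    unfolding norm_divide norm_mult e by (intro divide_right_mono) auto
  also have "\<dots> = (norm a + 1) / (real n + 2)" by simp
  also have "\<dots> \<le> (norm a + 2)\<^sup>2 / (real (n div 2) + 1)"
    by (intro frac_le) (auto simp: power2_eq_square algebra_simps)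
  finally have "norm (wco a p q (Suc (Suc n))) \<le> (norm a + 2)\<^sup>2 / (real (n div 2) + 1) * ((norm p + norm q) * (norm a + 2) ^ n / fact (n div 2))"
    unfolding wco.simps norm_mult by (intro mult_mono 3) auto
  also have "\<dots> = (norm p + norm q) * (norm a + 2) ^ Suc (Suc n) / fact (Suc (Suc n) div 2)"
    by (simp add: power2_eq_square field_simps)
  finally show ?case .
qed auto

lemma summable_power_fact_half:
  fixes r :: real
  shows "summable (\<lambda>n. r ^ n / fact (n div 2))"
proof -
  have e: "(\<lambda>n. (r\<^sup>2) ^ n / fact n) sums exp (r\<^sup>2)"
    using exp_converges[of "r\<^sup>2"] by (simp add: field_simps)
  have "(\<lambda>n. if even n then (r\<^sup>2) ^ (n div 2) / fact (n div 2) else r * ((r\<^sup>2) ^ ((n - 1) div 2) / fact ((n - 1) div 2))) sums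
     (r * exp (r\<^sup>2) + exp (r\<^sup>2))"
    by (rule sums_if[OF sums_mult[OF e] e])
  also have "(\<lambda>n. if even n then (r\<^sup>2) ^ (n div 2) / fact (n div 2) else r * ((r\<^sup>2) ^ ((n - 1) div 2) / fact ((n - 1) div 2))) =
     (\<lambda>n. r ^ n / fact (n div 2))"
    by (rule ext) (auto elim!: oddE evenE simp flip: power_mult)
  finally show ?thesis by (rule sums_summable)
qed

definition wfps :: "complex \<Rightarrow> complex \<Rightarrow> complex \<Rightarrow> complex fps" where
  "wfps a p q = Abs_fps (wco a p q)"

lemma wfps_conv_radius [simp]: "fps_conv_radius (wfps a p q) = \<infinity>"
  unfolding fps_conv_radius_def
proof (rule conv_radius_inftyI'')
  fix z
  show "summable (\<lambda>n. fps_nth (wfps a p q) n * z ^ n)"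
  proof (rule summable_comparison_test')
    show "summable (\<lambda>n. (norm p + norm q) * (((norm a + 2) * norm z) ^ n / fact (n div 2)))"
      by (intro summable_mult summable_power_fact_half)
    show "norm (fps_nth (wfps a p q) n * z ^ n) \<le> (norm p + norm q) * (((norm a + 2) * norm z) ^ n / fact (n div 2))" for n
      using mult_right_mono[OF norm_wco_le[of a p q n], of "norm z ^ n"]
      by (simp add: wfps_def norm_mult norm_power power_mult_distrib mult_ac)
  qed
qed

text \<open>Weber's equation for exp(-z^2/4) G becomes G'' = z G' + (a + 1/2) G; the recurrence of
  \<open>wco\<close> is its coefficient form.\<close>

lemma fps_deriv2_wfps:
  "fps_deriv (fps_deriv (wfps a p q)) = fps_X * fps_deriv (wfps a p q) + fps_const (a + 1/2) * wfps a p q"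
proof (rule fps_ext)
  fix n
  have n0: "1 + of_nat n \<noteq> (0::complex)" "2 + of_nat n \<noteq> (0::complex)"
    by (metis of_nat_Suc of_nat_eq_0_iff nat.distinct(1)) (metis of_nat_add of_nat_numeral of_nat_eq_0_iff add_is_0 zero_neq_numeral)
  have "fps_nth (fps_deriv (fps_deriv (wfps a p q))) n = (of_nat n + a + 1/2) * wco a p q n"
  proof -
    have "fps_nth (fps_deriv (fps_deriv (wfps a p q))) n = (1 + of_nat n) * (2 + of_nat n) * wco a p q (Suc (Suc n))"
      by (simp add: wfps_def)
    also have "wco a p q (Suc (Suc n)) = (of_nat n + a + 1/2) * wco a p q n / ((1 + of_nat n) * (2 + of_nat n))"
      by (simp add: add.commute)
    finally show ?thesis using n0 by simp
  qed
  also have "\<dots> = fps_nth (fps_X * fps_deriv (wfps a p q) + fps_const (a + 1/2) * wfps a p q) n"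
    by (cases n) (auto simp: wfps_def algebra_simps)
  finally show "fps_nth (fps_deriv (fps_deriv (wfps a p q))) n = fps_nth (fps_X * fps_deriv (wfps a p q) + fps_const (a + 1/2) * wfps a p q) n" .
qed

section \<open>Weber's equation for power series and for functions; Wronskians\<close>

definition is_weber_sol :: "complex \<Rightarrow> (complex \<Rightarrow> complex) \<Rightarrow> (complex \<Rightarrow> complex) \<Rightarrow> bool" where
  "is_weber_sol a f f' \<longleftrightarrow> (\<forall>z. (f has_field_derivative f' z) (at z) \<and>
      (f' has_field_derivative (z\<^sup>2 / 4 + a) * f z) (at z))"

abbreviation weber_ode :: "complex \<Rightarrow> complex fps \<Rightarrow> bool" where
  "weber_ode a F \<equiv> fps_deriv (fps_deriv F) = (fps_const (1/4) * fps_X\<^sup>2 + fps_const a) * F"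

lemma eval_fps_weber:
  assumes R: "fps_conv_radius F = \<infinity>" 
    and F: "weber_ode a F"
  shows "is_weber_sol a (eval_fps F) (eval_fps (fps_deriv F))"
proof -
  have R': "fps_conv_radius (fps_deriv F) = \<infinity>" 
    using fps_conv_radius_deriv[of F] R by auto
  have P: "fps_conv_radius (fps_const (1/4) * fps_X\<^sup>2 :: complex fps) = \<infinity>"
    using fps_conv_radius_mult[of "fps_const (1/4)" "fps_X\<^sup>2 :: complex fps"] by simp
  have Q: "fps_conv_radius (fps_const (1/4) * fps_X\<^sup>2 + fps_const a) = \<infinity>"
    using fps_conv_radius_add[of "fps_const (1/4) * fps_X\<^sup>2" "fps_const a"] P by simp
  have "eval_fps (fps_deriv (fps_deriv F)) z = (z\<^sup>2 / 4 + a) * eval_fps F z" for z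
    unfolding F using P Q R by (simp add: eval_fps_mult eval_fps_add)
  then show ?thesis unfolding is_weber_sol_def
    using has_field_derivative_eval_fps[of _ F UNIV] has_field_derivative_eval_fps[of _ "fps_deriv F" UNIV] R R' by auto
qed

definition weber_fps :: "complex \<Rightarrow> complex \<Rightarrow> complex \<Rightarrow> complex fps" where
  "weber_fps a p q = gauss_fps (- 1/4) * wfps a p q"

lemma weber_fps_conv_radius [simp]: "fps_conv_radius (weber_fps a p q) = \<infinity>"
  using fps_conv_radius_mult[of "gauss_fps (- 1/4)" "wfps a p q"] by (simp add: weber_fps_def)

text \<open>The condition on \<open>c\<close> turns the quadratic term 4 c^2 z^2 into z^2/4. Both
  roots occur: \<open>- 1/4\<close> factors out the decaying Gaussian (\<open>wfps\<close>),
  \<open>1/4\<close> the growing one (\<open>hco\<close>).\<close>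

lemma gauss_mult_weber:
  assumes "fps_deriv (fps_deriv H) = - fps_const (4 * c) * fps_X * fps_deriv H + fps_const (a - 2 * c) * H" "c\<^sup>2 = 1/16"
  shows "weber_ode a (gauss_fps c * H)"
proof -
  define C where "C = fps_const c"
  have num: "fps_const 2 = (2 :: complex fps)" "fps_const 4 = (4 :: complex fps)"
    by (simp_all add: fps_numeral_fps_const)
  have c: "fps_const (2 * c) = 2 * C" "fps_const (4 * c) = 4 * C" "fps_const (a - 2 * c) = fps_const a - 2 * C"
    by (simp_all add: C_def num flip: fps_const_mult fps_const_sub)
  have q: "fps_const (1/4) = 4 * C * C"
    using assms(2) by (simp add: C_def power2_eq_square mult.assoc mult.commute mult.left_commute flip: num)
  have d: "fps_deriv (gauss_fps c) = 2 * C * (fps_X * gauss_fps c)" "fps_deriv C = 0"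
    unfolding fps_deriv_gauss_fps c(1) by (simp_all add: C_def)
  have "fps_deriv (fps_deriv (gauss_fps c * H)) =
      gauss_fps c * (fps_deriv (fps_deriv H) + 4 * C * fps_X * fps_deriv H + (4 * C * C * fps_X\<^sup>2 + 2 * C) * H)"
    by (simp add: d algebra_simps power2_eq_square)
  also have "\<dots> = (4 * C * C * fps_X\<^sup>2 + fps_const a) * (gauss_fps c * H)"
    unfolding assms(1) c by (simp add: algebra_simps)
  finally show ?thesis unfolding q .
qed

lemma weber_fps_ode:
  "weber_ode a (weber_fps a p q)"
  unfolding weber_fps_def
  by (rule gauss_mult_weber) (simp_all add: fps_deriv2_wfps power2_eq_square)

definition weber :: "complex \<Rightarrow> complex \<Rightarrow> complex \<Rightarrow> complex \<Rightarrow> complex" where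
  "weber a p q z = exp (- z\<^sup>2 / 4) * eval_fps (wfps a p q) z"

definition weber' :: "complex \<Rightarrow> complex \<Rightarrow> complex \<Rightarrow> complex \<Rightarrow> complex" where
  "weber' a p q z = exp (- z\<^sup>2 / 4) * (eval_fps (fps_deriv (wfps a p q)) z - z / 2 * eval_fps (wfps a p q) z)"

lemma eval_weber_fps: "eval_fps (weber_fps a p q) = weber a p q"
  by (rule ext) (simp add: weber_fps_def weber_def eval_fps_mult eval_gauss_fps)

lemma weber_deriv: "(weber a p q has_field_derivative weber' a p q z) (at z)"
  unfolding weber_def weber'_def
  by (auto intro!: derivative_eq_intros has_field_derivative_eval_fps[THEN DERIV_chain2] simp: algebra_simps)

lemma is_weber_sol_weber: "is_weber_sol a (weber a p q) (weber' a p q)"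
proof -
  have "is_weber_sol a (weber a p q) (eval_fps (fps_deriv (weber_fps a p q)))"
    using eval_fps_weber[OF weber_fps_conv_radius weber_fps_ode, of a p q] by (simp add: eval_weber_fps)
  moreover from this have "eval_fps (fps_deriv (weber_fps a p q)) = weber' a p q"
    unfolding is_weber_sol_def using weber_deriv DERIV_unique by blast
  ultimately show ?thesis by simp
qed

lemma weber_0 [simp]: "weber a p q 0 = p" "weber' a p q 0 = q"
  by (simp_all add: weber_def weber'_def eval_fps_at_0 wfps_def)

lemma wronskian_const:
  assumes "is_weber_sol a f f'" "is_weber_sol a g g'"
  shows "f z * g' z - f' z * g z = f w * g' w - f' w * g w"
proof -
  have "((\<lambda>z. f z * g' z - f' z * g z) has_field_derivative 0) (at z)" for z
    using assms unfolding is_weber_sol_def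
    by (auto intro!: derivative_eq_intros simp: algebra_simps)
  then obtain c where "\<And>z. f z * g' z - f' z * g z = c"
    using has_field_derivative_zero_constant[of UNIV "\<lambda>z. f z * g' z - f' z * g z"] by auto
  then show ?thesis by metis
qed

lemma is_weber_sol_lincomb:
  assumes "is_weber_sol a f f'" "is_weber_sol a g g'"
  shows "is_weber_sol a (\<lambda>z. c * f z + d * g z) (\<lambda>z. c * f' z + d * g' z)"
  using assms unfolding is_weber_sol_def by (auto intro!: derivative_eq_intros simp: algebra_simps)

text \<open>The Wronskians of \<open>h\<close> with the two solutions normalised at 0 vanish
  everywhere, while those two have Wronskian 1 with each other. Cramer's rule then gives
  \<open>h z = 0\<close>.\<close>

lemma weber_sol_zero:
  assumes h: "is_weber_sol a h h'" and 0: "h w = 0" "h' w = 0"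
  shows "h z = 0"
proof -
  have w: "h z * weber' a p q z = h' z * weber a p q z" for p q
    using wronskian_const[OF h is_weber_sol_weber, of z p q w] 0 by simp
  have W: "weber a 1 0 z * weber' a 0 1 z - weber' a 1 0 z * weber a 0 1 z = 1"
    using wronskian_const[OF is_weber_sol_weber is_weber_sol_weber, of a 1 0 z 0 1 0] by simp
  have "h z = h z * (weber a 1 0 z * weber' a 0 1 z - weber' a 1 0 z * weber a 0 1 z)" by (simp add: W)
  also have "\<dots> = weber a 1 0 z * (h z * weber' a 0 1 z) - weber a 0 1 z * (h z * weber' a 1 0 z)"
    by (simp add: algebra_simps)
  also have "\<dots> = 0" unfolding w by (simp add: algebra_simps)
  finally show ?thesis .
qed

lemma weber_sol_unique:
  assumes f: "is_weber_sol a f f'" and g: "is_weber_sol a g g'" and 0: "f w = g w" "f' w = g' w"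
  shows "f = g"
proof (rule ext)
  fix z
  show "f z = g z"
    using weber_sol_zero[OF is_weber_sol_lincomb[OF f g, of 1 "-1"], of w z] 0 by simp
qed

section \<open>The parabolic cylinder function\<close>

text \<open>\<open>pcf0\<close> and \<open>pcf1\<close> are the classical values of \<open>U(a,0)\<close> and \<open>U'(a,0)\<close>.\<close>

definition pcf0 :: "complex \<Rightarrow> complex" where
  "pcf0 a = 2 powr (- a / 2 - 1/4) * of_real (sqrt pi) * rGamma (a / 2 + 3/4)"

definition pcf1 :: "complex \<Rightarrow> complex" where
  "pcf1 a = - (2 powr (- a / 2 + 1/4) * of_real (sqrt pi) * rGamma (a / 2 + 1/4))"

definition pcc :: "complex \<Rightarrow> nat \<Rightarrow> complex" where
  "pcc a = wco a (pcf0 a) (pcf1 a)"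

definition pcG :: "complex \<Rightarrow> complex \<Rightarrow> complex" where
  "pcG a = eval_fps (wfps a (pcf0 a) (pcf1 a))"

definition pcU :: "complex \<Rightarrow> complex \<Rightarrow> complex" where
  "pcU a = weber a (pcf0 a) (pcf1 a)"

definition pcU' :: "complex \<Rightarrow> complex \<Rightarrow> complex" where
  "pcU' a = weber' a (pcf0 a) (pcf1 a)"

lemma wfps_nth: "fps_nth (wfps a p q) n = wco a p q n"
  by (simp add: wfps_def)

lemma pcG_sums: "(\<lambda>n. pcc a n * z ^ n) sums pcG a z"
  using sums_eval_fps[of z "wfps a (pcf0 a) (pcf1 a)"] by (simp add: pcc_def pcG_def wfps_nth)

lemma pcU_eq: "pcU a z = exp (- z\<^sup>2 / 4) * pcG a z"
  by (simp add: pcU_def pcG_def weber_def)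

lemma pcU_0: "pcU a 0 = pcf0 a" "pcU' a 0 = pcf1 a"
  by (simp_all add: pcU_def pcU'_def)

section \<open>Recurrences and closed form of the Taylor coefficients\<close>

lemma of_nat_add_neq_0: "of_nat n + 1 \<noteq> (0 :: complex)" "of_nat n + numeral k \<noteq> (0 :: complex)"
  using of_nat_eq_0_iff[of "n + 1", where 'a = complex] of_nat_eq_0_iff[of "n + numeral k", where 'a = complex]
  by (simp_all add: add.commute del: of_nat_eq_0_iff)

lemma two_powr_plus1: "2 powr (x + 1) = 2 * 2 powr (x :: complex)"
  by (simp add: powr_add)

lemma pcf0_minus1: "pcf0 (a - 1) = - pcf1 a"
proof -
  have "- (a - 1) / 2 - 1/4 = - a / 2 + 1/4" "(a - 1) / 2 + 3/4 = a / 2 + 1/4"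
    by (simp_all add: field_simps)
  then show ?thesis by (simp only: pcf0_def pcf1_def minus_minus)
qed

lemma pcf1_minus1: "pcf1 (a - 1) = (1/2 - a) * pcf0 a"
proof -
  have e: "- (a - 1) / 2 + 1/4 = (- a / 2 - 1/4) + 1" "(a - 1) / 2 + 1/4 = a / 2 - 1/4" "(a / 2 - 1/4) + 1 = a / 2 + 3/4"
    by (simp_all add: field_simps)
  have r: "rGamma (a / 2 - 1/4) = (a / 2 - 1/4) * rGamma (a / 2 + 3/4)"
    using rGamma_plus1[of "a / 2 - 1/4"] unfolding e by simp
  then show ?thesis unfolding pcf0_def pcf1_def e two_powr_plus1 r by (simp add: algebra_simps)
qed

lemma pcf0_rec: "pcf1 a = - (a + 1/2) * pcf0 (a + 1)"
  using pcf1_minus1[of "a + 1"] by (simp add: algebra_simps)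

text \<open>Coefficient form of G' = -(a + 1/2) G with parameter a + 1 on the right. The recurrence
  of \<open>wco\<close> moves by two indices, so the induction does as well.\<close>

lemma pcc_deriv: "of_nat (Suc n) * pcc a (Suc n) = - (a + 1/2) * pcc (a + 1) n"
proof (induction n rule: induct_nat_012)
  case 0
  then show ?case by (simp add: pcc_def pcf0_rec)
next
  case 1
  have "pcf1 (a + 1) = - pcf0 a" using pcf0_minus1[of "a + 1"] by simp
  then show ?case by (simp add: pcc_def algebra_simps)
next
  case (ge2 n)
  define N where "N = complex_of_nat n"
  have nz: "N + 1 \<noteq> 0" "N + 2 \<noteq> 0" "N + 3 \<noteq> 0"
    unfolding N_def by (rule of_nat_add_neq_0)+
  have IH: "(N + 1) * pcc a (Suc n) = - (a + 1/2) * pcc (a + 1) n"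
    using ge2(1) by (simp add: N_def add.commute)
  have s: "pcc a (Suc (Suc (Suc n))) = (N + a + 3/2) / ((N + 2) * (N + 3)) * pcc a (Suc n)"
    by (simp add: pcc_def N_def algebra_simps)
  have s': "pcc (a + 1) (Suc (Suc n)) = (N + a + 3/2) / ((N + 1) * (N + 2)) * pcc (a + 1) n"
    by (simp add: pcc_def N_def algebra_simps)
  have "(N + 3) * pcc a (Suc (Suc (Suc n))) = (N + a + 3/2) / (N + 2) * pcc a (Suc n)"
    using nz unfolding s by simp
  also have "\<dots> = (N + a + 3/2) / ((N + 1) * (N + 2)) * ((N + 1) * pcc a (Suc n))"
    using nz by simp
  also have "\<dots> = - (a + 1/2) * pcc (a + 1) (Suc (Suc n))" unfolding IH s' by simp
  finally show ?case by (simp add: N_def algebra_simps)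
qed

text \<open>Coefficient form of the three-term recurrence \<open>pcG_rec\<close>, which lets
  estimates proved for large \<open>Re a\<close> descend to every \<open>a\<close>.\<close>

lemma pcc_rec: "pcc (a - 1) n = (if n = 0 then 0 else pcc a (n - 1)) + (a + 1/2) * pcc (a + 1) n"
proof (induction n rule: induct_nat_012)
  case 0
  then show ?case by (simp add: pcc_def pcf0_minus1 pcf0_rec[of a] algebra_simps)
next
  case 1
  have "pcf1 (a + 1) = - pcf0 a" using pcf0_minus1[of "a + 1"] by simp
  then show ?case by (simp add: pcc_def pcf1_minus1 algebra_simps)
next
  case (ge2 n)
  define N where "N = complex_of_nat n"
  have nz: "N + 1 \<noteq> 0" "N + 2 \<noteq> 0"
    unfolding N_def by (rule of_nat_add_neq_0)+
  \<comment> \<open>This and the next fact express both terms on the right through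
    \<open>pcc a (Suc n)\<close>, so the inductive step reduces to an identity between polynomials
    in \<open>N\<close> and \<open>a\<close>.\<close>
  have d: "(a + 1/2) * pcc (a + 1) n = - (N + 1) * pcc a (Suc n)"
  proof -
    have "(a + 1/2) * pcc (a + 1) n = - (of_nat (Suc n) * pcc a (Suc n))" unfolding pcc_deriv by (simp add: algebra_simps)
    then show ?thesis by (simp add: N_def algebra_simps)
  qed
  have m: "(N + a - 1/2) * (if n = 0 then 0 else pcc a (n - 1)) = N * (N + 1) * pcc a (Suc n)"
  proof (cases n)
    case (Suc m)
    have "N = of_nat m + 1" by (simp add: N_def Suc)
    moreover from this have "N \<noteq> 0" by (simp only: of_nat_add_neq_0 not_False_eq_True)
    ultimately have "N \<noteq> 0" and Nm: "N = of_nat m + 1" by auto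
    have e: "of_nat m + a + 1/2 = N + a - 1/2" "of_nat m + 1 = N" "of_nat m + 2 = N + 1"
      by (simp_all add: Nm)
    have "pcc a (Suc n) = (N + a - 1/2) / (N * (N + 1)) * pcc a m"
      unfolding Suc pcc_def wco.simps e ..
    then show ?thesis using nz \<open>N \<noteq> 0\<close> by (simp add: Suc)
  qed (simp add: N_def)
  have "(N + 1) * (N + 2) * pcc (a - 1) (Suc (Suc n)) = (N + a - 1/2) * pcc (a - 1) n"
    using nz by (simp add: pcc_def N_def)
  also have "\<dots> = (N + a - 1/2) * (if n = 0 then 0 else pcc a (n - 1)) + (N + a - 1/2) * ((a + 1/2) * pcc (a + 1) n)"
    by (subst ge2(1)) (simp add: distrib_left)
  also have "\<dots> = (N + 1) * (1/2 - a) * pcc a (Suc n)" unfolding d m by (simp add: algebra_simps)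
  also have "\<dots> = (N + 1) * (N + 2) * pcc a (Suc n) + (N + a + 3/2) * (- (N + 1) * pcc a (Suc n))"
    by (simp add: algebra_simps)
  also have "\<dots> = (N + 1) * (N + 2) * pcc a (Suc n) + (N + a + 3/2) * ((a + 1/2) * pcc (a + 1) n)"
    by (simp only: d)
  also have "(N + a + 3/2) * ((a + 1/2) * pcc (a + 1) n) = (N + 1) * (N + 2) * ((a + 1/2) * pcc (a + 1) (Suc (Suc n)))"
  proof -
    have e: "of_nat n + (a + 1) + 1/2 = N + a + 3/2" by (simp add: N_def)
    have "pcc (a + 1) (Suc (Suc n)) = (N + a + 3/2) / ((N + 1) * (N + 2)) * pcc (a + 1) n"
      unfolding pcc_def wco.simps e by (simp add: N_def)
    then show ?thesis using nz by simp
  qed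
  finally have "(N + 1) * (N + 2) * pcc (a - 1) (Suc (Suc n)) = (N + 1) * (N + 2) * (pcc a (Suc n) + (a + 1/2) * pcc (a + 1) (Suc (Suc n)))"
    by (simp only: distrib_left)
  then show ?case using nz by simp
qed

lemma pcG_rec: "pcG (a - 1) z = z * pcG a z + (a + 1/2) * pcG (a + 1) z"
proof -
  have "(\<lambda>n. (if n = 0 then 0 else pcc a (n - 1) * z ^ n)) sums (z * pcG a z)"
    using sums_mult[OF pcG_sums[of a z], of z] sums_Suc[of "\<lambda>n. if n = 0 then 0 else pcc a (n - 1) * z ^ n" "z * pcG a z"]
    by (simp add: mult_ac)
  from sums_add[OF this sums_mult[OF pcG_sums[of "a + 1" z], of "a + 1/2"]]
  have "(\<lambda>n. pcc (a - 1) n * z ^ n) sums (z * pcG a z + (a + 1/2) * pcG (a + 1) z)"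
    by (rule back_subst[of "\<lambda>f. f sums _"]) (auto simp: pcc_rec[of a] algebra_simps)
  then show ?thesis using pcG_sums[of "a - 1" z] sums_unique2 by blast
qed

lemma pcG_deriv: "eval_fps (fps_deriv (wfps a (pcf0 a) (pcf1 a))) z = - (a + 1/2) * pcG (a + 1) z"
proof -
  have "fps_deriv (wfps a (pcf0 a) (pcf1 a)) = fps_const (- (a + 1/2)) * wfps (a + 1) (pcf0 (a + 1)) (pcf1 (a + 1))"
    using pcc_deriv[of _ a] by (intro fps_ext) (simp add: wfps_def flip: pcc_def)
  then show ?thesis by (simp add: eval_fps_mult pcG_def del: fps_const_neg fps_const_add)
qed

lemma pcU'_eq: "pcU' a z = exp (- z\<^sup>2 / 4) * (- (a + 1/2) * pcG (a + 1) z - z / 2 * pcG a z)"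
  unfolding pcU'_def weber'_def pcG_deriv by (simp add: pcG_def)

lemma Gamma_duplication_quarter:
  fixes a :: complex
  assumes "a + 1/2 \<notin> \<int>\<^sub>\<le>\<^sub>0"
  shows "a / 2 + 1/4 \<notin> \<int>\<^sub>\<le>\<^sub>0" "a / 2 + 3/4 \<notin> \<int>\<^sub>\<le>\<^sub>0"
    "Gamma (a / 2 + 1/4) * Gamma (a / 2 + 3/4) = 2 powr (1/2 - a) * of_real (sqrt pi) * Gamma (a + 1/2)"
proof -
  show n1: "a / 2 + 1/4 \<notin> \<int>\<^sub>\<le>\<^sub>0"
  proof
    assume "a / 2 + 1/4 \<in> \<int>\<^sub>\<le>\<^sub>0"
    then obtain n where "a / 2 + 1/4 = - of_nat n" by (rule nonpos_Ints_cases')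
    then have "a + 1/2 = - of_nat (2 * n)" by (simp add: field_simps)
    then show False using assms by (metis minus_of_nat_in_nonpos_Ints)
  qed
  show n2: "a / 2 + 3/4 \<notin> \<int>\<^sub>\<le>\<^sub>0"
  proof
    assume "a / 2 + 3/4 \<in> \<int>\<^sub>\<le>\<^sub>0"
    then obtain n where "a / 2 + 3/4 = - of_nat n" by (rule nonpos_Ints_cases')
    moreover have "a + 1/2 = 2 * (a / 2 + 3/4) - 1" by (simp add: field_simps)
    ultimately have "a + 1/2 = - of_nat (2 * n + 1)" by simp
    then show False using assms by (metis minus_of_nat_in_nonpos_Ints)
  qed
  have e: "a / 2 + 1/4 + 1/2 = a / 2 + 3/4" "2 * (a / 2 + 1/4) = a + 1/2" "1 - 2 * (a / 2 + 1/4) = 1/2 - a"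
    by (simp_all add: field_simps)
  show "Gamma (a / 2 + 1/4) * Gamma (a / 2 + 3/4) = 2 powr (1/2 - a) * of_real (sqrt pi) * Gamma (a + 1/2)"
    using Gamma_legendre_duplication[of "a / 2 + 1/4"] n1 n2 unfolding e
    using Ln_of_real[of 2] by (simp add: powr_def)
qed

text \<open>The recurrence multiplies by 2 x / ((n + 1)(n + 2)) with x the argument of the Gamma
  factor, which is the functional equation of Gamma; the two initial values are the duplication
  formula. In this form the coefficients are recognisable as Gaussian moments.\<close>

lemma pcc_closed:
  assumes p: "a + 1/2 \<notin> \<int>\<^sub>\<le>\<^sub>0"
  shows "pcc a n = (-1) ^ n / fact n * 2 powr ((a + of_nat n) / 2 - 3/4) * Gamma ((a + of_nat n) / 2 + 1/4) * rGamma (a + 1/2)"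
proof (induction n rule: induct_nat_012)
  note D = Gamma_duplication_quarter[OF p]
  have nz: "Gamma (a + 1/2) \<noteq> 0" "Gamma (a / 2 + 3/4) \<noteq> 0" "Gamma (a / 2 + 1/4) \<noteq> 0"
    using p D by (auto simp: Gamma_eq_zero_iff)
  have "2 powr (1/2 - a) * 2 powr (a / 2 - 3/4) = (2 powr (- a / 2 - 1/4) :: complex)"
    unfolding powr_add[symmetric] by (rule arg_cong) (simp add: field_simps)
  then have sq: "2 powr (1/2 - a) = 2 powr (- a / 2 - 1/4) / 2 powr (a / 2 - 3/4 :: complex)"
    by (simp add: eq_divide_eq)
  have "2 powr (1/2 - a) * 2 powr ((a + 1) / 2 - 3/4) = (2 powr (- a / 2 + 1/4) :: complex)"
    unfolding powr_add[symmetric] by (rule arg_cong) (simp add: field_simps)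
  then have sq': "2 powr (1/2 - a) = 2 powr (- a / 2 + 1/4) / 2 powr ((a + 1) / 2 - 3/4 :: complex)"
    by (simp add: eq_divide_eq)
  {
    case 0
    have "2 powr (a / 2 - 3/4) * (Gamma (a / 2 + 1/4) * Gamma (a / 2 + 3/4)) = 2 powr (- a / 2 - 1/4) * of_real (sqrt pi) * Gamma (a + 1/2)"
      unfolding D(3) sq by simp
    then show ?case using nz by (simp add: pcc_def pcf0_def rGamma_inverse_Gamma field_simps)
  next
    case 1
    have "2 powr ((a + 1) / 2 - 3/4) * (Gamma (a / 2 + 1/4) * Gamma (a / 2 + 3/4)) = 2 powr (- a / 2 + 1/4) * of_real (sqrt pi) * Gamma (a + 1/2)"
      unfolding D(3) sq' by simp
    moreover have "(a + 1) / 2 + 1/4 = a / 2 + 3/4" by (simp add: field_simps)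
    ultimately show ?case using nz by (simp add: pcc_def pcf1_def rGamma_inverse_Gamma) (simp add: field_simps)
  next
    case (ge2 n)
    define N where "N = complex_of_nat n"
    define x where "x = (a + N) / 2 + 1/4"
    have x: "x \<notin> \<int>\<^sub>\<le>\<^sub>0"
    proof
      assume "x \<in> \<int>\<^sub>\<le>\<^sub>0"
      then obtain m where "x = - of_nat m" by (rule nonpos_Ints_cases')
      moreover have "a + 1/2 = 2 * x - N" by (simp add: x_def field_simps)
      ultimately have "a + 1/2 = - of_nat (2 * m + n)" by (simp add: N_def)
      then show False using p by (metis minus_of_nat_in_nonpos_Ints)
    qed
    have nz: "N + 1 \<noteq> 0" "N + 2 \<noteq> 0"
      unfolding N_def by (rule of_nat_add_neq_0)+
    have e: "(a + of_nat (Suc (Suc n))) / 2 + 1/4 = x + 1" "(a + of_nat (Suc (Suc n))) / 2 - 3/4 = ((a + N) / 2 - 3/4) + 1"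
      by (simp_all add: x_def N_def field_simps)
    have f: "(fact (Suc (Suc n)) :: complex) = (N + 1) * (N + 2) * fact n"
      by (simp add: N_def algebra_simps)
    have "pcc a (Suc (Suc n)) = (2 * x) / ((N + 1) * (N + 2)) * pcc a n"
    proof -
      have "of_nat n + a + 1/2 = 2 * x" by (simp add: x_def N_def field_simps)
      then show ?thesis by (simp add: pcc_def N_def)
    qed
    also have "\<dots> = (-1) ^ n / ((N + 1) * (N + 2) * fact n) * (2 * 2 powr ((a + N) / 2 - 3/4)) * (x * Gamma x) * rGamma (a + 1/2)"
      unfolding ge2(1) by (simp add: x_def N_def)
    also have "x * Gamma x = Gamma (x + 1)" using x by (simp add: Gamma_plus1)
    finally show ?case unfolding e f two_powr_plus1 by simp
  }
qed

section \<open>Integral representation and asymptotics\<close>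

lemma Re_exp_i: "Re (exp (\<i> * of_real x)) = cos x"
  by (simp add: Re_exp)

lemma exp_i_powr:
  assumes "\<bar>x\<bar> < pi"
  shows "exp (\<i> * of_real x) powr s = exp (\<i> * of_real x * s)"
proof -
  have "Ln (exp (\<i> * of_real x)) = \<i> * of_real x"
    using assms by (intro Ln_exp) auto
  then show ?thesis by (simp add: powr_def mult.commute)
qed

lemma Re_pos_not_nonpos_Ints:
  fixes z :: complex
  assumes "Re z > 0"
  shows "z \<notin> \<int>\<^sub>\<le>\<^sub>0"
proof
  assume "z \<in> \<int>\<^sub>\<le>\<^sub>0"
  then obtain n where "z = - of_nat n" by (rule nonpos_Ints_cases')
  then show False using assms by simp
qed

text \<open>Rotating the ray by \<open>\<theta>\<close> extends the asymptotics from \<open>|arg z| < \<pi>/2\<close> to \<open>|arg z| < 3\<pi>/4\<close>.\<close>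

lemma pcG_integral:
  assumes a: "Re a > - 1/2" and th: "\<bar>\<theta>\<bar> < pi / 4"
  shows "pcG a z = rGamma (a + 1/2) * exp (\<i> * of_real \<theta> * (a + 1/2)) *
     (\<integral>t. exp (- z * exp (\<i> * of_real \<theta>) * of_real t) *
        (of_real t powr (a + 1/2 - 1) * exp (- exp (\<i> * of_real (2 * \<theta>)) * (of_real t)\<^sup>2 / 2)) \<partial>half_line)"
proof -
  define w where "w = exp (\<i> * of_real (2 * \<theta>))"
  define \<omega> where "\<omega> = exp (\<i> * of_real \<theta>)"
  define g where "g = (\<lambda>t::real. of_real t powr (a + 1/2 - 1) * exp (- w * (of_real t)\<^sup>2 / 2))"
  have c: "cos (2 * \<theta>) > 0" using th by (intro cos_gt_zero_pi) auto
  have Rw: "Re w = cos (2 * \<theta>)" unfolding w_def by (rule Re_exp_i)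
  have cont: "continuous_on {0<..} g" unfolding g_def by (intro continuous_intros) auto
  have ng: "exp (r * t) * norm (g t) = t powr (Re a + 1/2 - 1) * exp (r * t - cos (2 * \<theta>) / 2 * t\<^sup>2)" if "t > 0" for t r
  proof -
    have n: "norm (exp (- w * (complex_of_real t)\<^sup>2 / 2)) = exp (- (cos (2 * \<theta>) / 2 * t\<^sup>2))"
      unfolding norm_exp_eq_Re by (simp add: Rw power2_eq_square)
    show ?thesis unfolding g_def norm_mult n norm_powr_of_real[OF that]
      by (simp add: algebra_simps flip: exp_add)
  qed
  have int: "integrable half_line (\<lambda>t. exp (norm z * t) * norm (g t))"
    by (rule Bochner_Integration.integrable_cong[THEN iffD1, OF refl _ integrable_gaussian_powr[of "Re a + 1/2" "cos (2 * \<theta>) / 2" "norm z"]])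
       (use ng c a in auto)
  have p: "a + 1/2 \<notin> \<int>\<^sub>\<le>\<^sub>0"
    using a by (intro Re_pos_not_nonpos_Ints) simp
  \<comment> \<open>The factors \<open>exp (- \<i> * of_real \<theta>) ^ n\<close> of the moments
    undo the rotation in \<open>(- z * \<omega>) ^ n\<close>, so every ray sums to the same
    series.\<close>
  have mom: "(\<integral>t. of_real t ^ n * g t \<partial>half_line) =
      2 powr ((a + 1/2 + of_nat n) / 2 - 1) * Gamma ((a + 1/2 + of_nat n) / 2) * exp (- \<i> * of_real \<theta> * (a + 1/2)) * exp (- \<i> * of_real \<theta>) ^ n" for n
  proof -
    have "(\<integral>t. of_real t ^ n * g t \<partial>half_line) = (\<integral>t. of_real t powr ((a + 1/2 + of_nat n) - 1) * exp (- w * (of_real t)\<^sup>2 / 2) \<partial>half_line)"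
      by (rule Bochner_Integration.integral_cong) (auto simp: g_def powr_nat' powr_add powr_diff)
    also have "\<dots> = 2 powr ((a + 1/2 + of_nat n) / 2 - 1) * Gamma ((a + 1/2 + of_nat n) / 2) * w powr (- ((a + 1/2 + of_nat n) / 2))"
      by (rule gaussian_moment_half_line(2)) (use a c in \<open>auto simp: Rw\<close>)
    also have "w powr (- ((a + 1/2 + of_nat n) / 2)) = exp (\<i> * of_real (2 * \<theta>) * (- ((a + 1/2 + of_nat n) / 2)))"
      unfolding w_def by (rule exp_i_powr) (use th pi_gt_zero in linarith)
    also have "\<i> * of_real (2 * \<theta>) * (- ((a + 1/2 + of_nat n) / 2)) = - \<i> * of_real \<theta> * (a + 1/2) + of_nat n * (- \<i> * of_real \<theta>)"
      by (simp add: field_simps)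
    also have "exp \<dots> = exp (- \<i> * of_real \<theta> * (a + 1/2)) * exp (- \<i> * of_real \<theta>) ^ n"
      by (simp only: exp_add exp_of_nat_mult)
    finally show ?thesis by (simp only: mult.assoc)
  qed
  have "(\<lambda>n. (- z * \<omega>) ^ n / fact n * (\<integral>t. of_real t ^ n * g t \<partial>half_line)) sums (\<integral>t. exp (- z * \<omega> * of_real t) * g t \<partial>half_line)"
    by (rule exp_moment_sums[OF cont int]) (simp add: \<omega>_def norm_mult)
  then have "(\<lambda>n. rGamma (a + 1/2) * exp (\<i> * of_real \<theta> * (a + 1/2)) * ((- z * \<omega>) ^ n / fact n * (\<integral>t. of_real t ^ n * g t \<partial>half_line))) sums
     (rGamma (a + 1/2) * exp (\<i> * of_real \<theta> * (a + 1/2)) * (\<integral>t. exp (- z * \<omega> * of_real t) * g t \<partial>half_line))"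
    by (rule sums_mult)
  moreover have "rGamma (a + 1/2) * exp (\<i> * of_real \<theta> * (a + 1/2)) * ((- z * \<omega>) ^ n / fact n * (\<integral>t. of_real t ^ n * g t \<partial>half_line)) = pcc a n * z ^ n" for n
  proof -
    have e1: "exp (\<i> * of_real \<theta> * (a + 1/2)) * exp (- \<i> * of_real \<theta> * (a + 1/2)) = 1"
      by (simp flip: exp_add)
    have "\<omega> * exp (- \<i> * of_real \<theta>) = 1" unfolding \<omega>_def by (simp flip: exp_add)
    then have e2: "(- z * \<omega>) ^ n * exp (- \<i> * of_real \<theta>) ^ n = (-1) ^ n * z ^ n"
      by (simp only: power_mult_distrib[symmetric]) (simp add: mult.assoc flip: power_mult_distrib)
    have e3: "(a + 1/2 + of_nat n) / 2 - 1 = (a + of_nat n) / 2 - 3/4" "(a + 1/2 + of_nat n) / 2 = (a + of_nat n) / 2 + 1/4"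
      by (simp_all add: field_simps)
    have "rGamma (a + 1/2) * exp (\<i> * of_real \<theta> * (a + 1/2)) * ((- z * \<omega>) ^ n / fact n * (\<integral>t. of_real t ^ n * g t \<partial>half_line)) =
      rGamma (a + 1/2) * (exp (\<i> * of_real \<theta> * (a + 1/2)) * exp (- \<i> * of_real \<theta> * (a + 1/2))) * ((- z * \<omega>) ^ n * exp (- \<i> * of_real \<theta>) ^ n) / fact n *
        (2 powr ((a + 1/2 + of_nat n) / 2 - 1) * Gamma ((a + 1/2 + of_nat n) / 2))"
      unfolding mom by simp
    also have "\<dots> = pcc a n * z ^ n"
      unfolding e1 e2 pcc_closed[OF p] e3 by simp
    finally show ?thesis .
  qed
  ultimately have "(\<lambda>n. pcc a n * z ^ n) sums (rGamma (a + 1/2) * exp (\<i> * of_real \<theta> * (a + 1/2)) * (\<integral>t. exp (- z * \<omega> * of_real t) * g t \<partial>half_line))"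
    by simp
  then show ?thesis
    using pcG_sums[of a z] sums_unique2 unfolding g_def w_def \<omega>_def by blast
qed

section \<open>The leading asymptotic term and its relative error\<close>

lemma norm_one_minus_exp_le:
  fixes w :: complex
  assumes "Re w \<le> 0"
  shows "norm (exp w - 1) \<le> norm w"
proof -
  have "norm (exp w - exp 0) \<le> 1 * norm (w - 0)"
  proof (rule field_differentiable_bound[where S="closed_segment 0 w" and f'=exp])
    show "norm (exp z) \<le> 1" if "z \<in> closed_segment 0 w" for z
    proof -
      obtain u where "z = of_real u * w" "0 \<le> u" 
        using \<open>z \<in> _\<close> by (auto simp: in_segment scaleR_conv_of_real)
      then have "Re z \<le> 0" using assms by (simp add: mult_nonneg_nonpos)
      then show ?thesis by simp
    qed
  qed (auto intro!: derivative_eq_intros)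
  then show ?thesis by simp
qed

abbreviation pc_err :: "complex \<Rightarrow> complex \<Rightarrow> real" where
  "pc_err a z \<equiv> norm (pcG a z * z powr (a + 1/2) - 1)"

text \<open>Watson's lemma on the rotated ray: replacing the Gaussian factor by 1 leaves a Gamma
  integral, which is the main term, at a cost of at most t^2/2. On the sector the kernel decays at
  rate \<open>norm z * sin \<epsilon>\<close>, so the two extra powers of t become the factor
  \<open>1 / (norm z)\<^sup>2\<close>.\<close>

lemma pcG_asymp_aux:
  assumes a: "Re a > - 1/2" and th: "\<bar>\<theta>\<bar> < pi / 4" and e: "\<epsilon> > 0"
  shows "\<exists>C. \<forall>z. z \<noteq> 0 \<longrightarrow> \<bar>Arg z + \<theta>\<bar> \<le> pi / 2 - \<epsilon> \<longrightarrow>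
      pc_err a z \<le> C / (norm z)\<^sup>2"
proof -
  define p where "p = a + 1/2"
  have p: "Re p > 0" using a by (simp add: p_def)
  define w where "w = exp (\<i> * of_real (2 * \<theta>))"
  define \<omega> where "\<omega> = exp (\<i> * of_real \<theta>)"
  define K where "K = rGamma p * exp (\<i> * of_real \<theta> * p)"
  have c: "cos (2 * \<theta>) > 0" using th by (intro cos_gt_zero_pi) auto
  have Rw: "Re w = cos (2 * \<theta>)" "norm w = 1" unfolding w_def by (rule Re_exp_i) simp
  \<comment> \<open>The Gamma factor and the power of \<open>sin \<epsilon>\<close> come from
    integrating the error bound; the exponential bounds the contribution of the argument of
    \<open>z\<close> to \<open>norm (z powr p)\<close>.\<close>
  define C where "C = norm K / 2 * Gamma (Re p + 2) * sin \<epsilon> powr (- (Re p + 2)) * exp (\<bar>Im p\<bar> * pi)"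
  show ?thesis
  proof (intro exI[of _ C] allI impI)
    fix z :: complex assume z: "z \<noteq> 0" and Az: "\<bar>Arg z + \<theta>\<bar> \<le> pi / 2 - \<epsilon>"
    have e2: "\<epsilon> \<le> pi / 2" using Az by linarith
    have se: "sin \<epsilon> > 0" using e e2 by (intro sin_gt_zero) auto
    have zw: "z * \<omega> = of_real (norm z) * exp (\<i> * of_real (Arg z + \<theta>))"
      using z by (subst Arg_eq[of z]) (simp_all add: \<omega>_def exp_add distrib_left)
    have "cos (pi / 2 - \<epsilon>) \<le> cos \<bar>Arg z + \<theta>\<bar>"
      using Az e pi_gt_zero by (intro cos_monotone_0_pi_le) auto
    then have "sin \<epsilon> \<le> cos (Arg z + \<theta>)" by (simp add: sin_cos_eq[of \<epsilon>])
    then have Rzw: "norm z * sin \<epsilon> \<le> Re (z * \<omega>)"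
      unfolding zw using Re_exp_i[of "Arg z + \<theta>"] by (simp add: mult_left_mono del: of_real_add)
    have k0: "norm z * sin \<epsilon> > 0" using z se by simp
    have Rzw0: "Re (z * \<omega>) > 0" using Rzw k0 by linarith
    \<comment> \<open>\<open>Arg z + \<theta>\<close> stays inside the range of the principal
      branch, so \<open>Ln (z * \<omega>) = Ln z + \<i> * \<theta>\<close> without a multiple of 2
      pi i, and the prefactor removes the rotation exactly.\<close>
    have powr1: "(z * \<omega>) powr (- p) * exp (\<i> * of_real \<theta> * p) = z powr (- p)"
    proof -
      have "Ln (z * \<omega>) = of_real (ln (norm z)) + \<i> * of_real (Arg z + \<theta>)"
        unfolding zw using z Az e pi_gt_zero by (subst Ln_times_of_real) (auto simp: Ln_exp Ln_of_real)
      moreover have "Ln z = of_real (ln (norm z)) + \<i> * of_real (Arg z)"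
        using z by (simp add: Ln_Arg)
      ultimately have "Ln (z * \<omega>) = Ln z + \<i> * of_real \<theta>" by (simp add: algebra_simps)
      then show ?thesis using z by (simp add: powr_def \<omega>_def algebra_simps flip: exp_add)
    qed
    let ?h = "\<lambda>t::real. of_real t powr (p - 1) * exp (- (z * \<omega>) * of_real t)"
    let ?f = "\<lambda>t::real. exp (- z * \<omega> * of_real t) * (of_real t powr (p - 1) * exp (- w * (of_real t)\<^sup>2 / 2))"
    have h: "integrable half_line ?h" "(\<integral>t. ?h t \<partial>half_line) = Gamma p * (z * \<omega>) powr (- p)"
      by (rule has_Gamma_integral_scaled[OF p Rzw0])+
    have p2: "Re p + 2 > 0" using p by simp
    have dom: "integrable half_line (\<lambda>t. 1/2 * (t powr (Re p + 2 - 1) * exp (- (norm z * sin \<epsilon> * t))))"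
      using p k0 by (intro integrable_mult_right integrable_powr_exp) auto
    have bd: "norm (?f t - ?h t) \<le> 1/2 * (t powr (Re p + 2 - 1) * exp (- (norm z * sin \<epsilon> * t)))" if t: "t > 0" for t
    proof -
      have "?f t - ?h t = ?h t * (exp (- w * (of_real t)\<^sup>2 / 2) - 1)"
        by (simp add: algebra_simps)
      moreover have "norm (?h t) \<le> t powr (Re p - 1) * exp (- (norm z * sin \<epsilon> * t))"
      proof -
        have "norm z * sin \<epsilon> * t \<le> Re (z * \<omega>) * t" using Rzw t by (intro mult_right_mono) auto
        then have "norm (exp (- (z * \<omega>) * of_real t)) \<le> exp (- (norm z * sin \<epsilon> * t))" by simp
        then show ?thesis unfolding norm_mult norm_powr_of_real[OF t] by (auto intro!: mult_left_mono)
      qed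
      moreover have "norm (exp (- w * (of_real t)\<^sup>2 / 2) - 1) \<le> t\<^sup>2 / 2"
      proof -
        have "norm (exp (- w * (of_real t)\<^sup>2 / 2) - 1) \<le> norm (- w * (of_real t)\<^sup>2 / 2)"
          by (rule norm_one_minus_exp_le) (use Rw c in \<open>auto simp: power2_eq_square\<close>)
        also have "\<dots> = t\<^sup>2 / 2" by (simp add: norm_mult norm_divide norm_power Rw)
        finally show ?thesis .
      qed
      ultimately have "norm (?f t - ?h t) \<le> (t powr (Re p - 1) * exp (- (norm z * sin \<epsilon> * t))) * (t\<^sup>2 / 2)"
        unfolding norm_mult by (metis (no_types) mult_mono norm_ge_zero norm_mult order_trans)
      also have "\<dots> = 1/2 * (t powr (Re p + 2 - 1) * exp (- (norm z * sin \<epsilon> * t)))"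
      proof -
        have "t powr (Re p + 2 - 1) = t powr (Re p - 1) * t\<^sup>2"
          using t powr_add[of t "Re p - 1" 2] by (simp add: algebra_simps)
        then show ?thesis by simp
      qed
      finally show ?thesis .
    qed
    have fh: "integrable half_line (\<lambda>t. ?f t - ?h t)"
      by (rule integrable_half_line_bound[OF dom _ bd]) (auto intro!: continuous_intros)
    have f: "integrable half_line ?f"
      using Bochner_Integration.integrable_add[OF fh h(1)] by simp
    have "pcG a z - z powr (- p) = K * (\<integral>t. ?f t \<partial>half_line) - rGamma p * Gamma p * ((z * \<omega>) powr (- p) * exp (\<i> * of_real \<theta> * p))"
    proof -
      have "rGamma p * Gamma p = 1"
        using Re_pos_not_nonpos_Ints[OF p] by (simp add: rGamma_inverse_Gamma Gamma_eq_zero_iff)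
      then show ?thesis
        unfolding powr1 pcG_integral[OF a th, of z] by (simp add: p_def K_def w_def \<omega>_def)
    qed
    also have "\<dots> = K * ((\<integral>t. ?f t \<partial>half_line) - (\<integral>t. ?h t \<partial>half_line))"
      unfolding h(2) K_def by (simp add: algebra_simps)
    also have "\<dots> = K * (\<integral>t. ?f t - ?h t \<partial>half_line)"
      using f h(1) by simp
    finally have n1: "norm (pcG a z - z powr (- p)) = norm K * norm (\<integral>t. ?f t - ?h t \<partial>half_line)"
      by (simp only: norm_mult)
    have "norm (\<integral>t. ?f t - ?h t \<partial>half_line) \<le> (\<integral>t. 1/2 * (t powr (Re p + 2 - 1) * exp (- (norm z * sin \<epsilon> * t))) \<partial>half_line)"
      by (rule Bochner_Integration.integral_norm_bound_integral[OF fh dom]) (use bd in auto)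
    then have n2: "norm (\<integral>t. ?f t - ?h t \<partial>half_line) \<le> 1/2 * (Gamma (Re p + 2) * (norm z * sin \<epsilon>) powr (- (Re p + 2)))"
      by (simp only: integral_mult_right_zero integrable_powr_exp(2)[OF p2 k0])
    have b1: "norm (pcG a z - z powr (- p)) \<le> norm K * (1/2 * (Gamma (Re p + 2) * (norm z * sin \<epsilon>) powr (- (Re p + 2))))"
      unfolding n1 by (rule mult_left_mono[OF n2 norm_ge_zero])
    have zp: "norm (z powr p) \<le> norm z powr Re p * exp (\<bar>Im p\<bar> * pi)"
    proof -
      have "- Im p * Arg z \<le> \<bar>Im p\<bar> * \<bar>Arg z\<bar>" by (metis abs_ge_self abs_minus_cancel abs_mult)
      also have "\<dots> \<le> \<bar>Im p\<bar> * pi" using Arg_bounded[of z] by (intro mult_left_mono) auto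
      finally show ?thesis unfolding norm_powr_complex by (intro mult_left_mono) auto
    qed
    have e0: "pcG a z * z powr p - 1 = (pcG a z - z powr (- p)) * z powr p"
      using z by (simp add: algebra_simps powr_minus)
    have "norm (pcG a z * z powr p - 1) \<le> norm K * (1/2 * (Gamma (Re p + 2) * (norm z * sin \<epsilon>) powr (- (Re p + 2)))) * (norm z powr Re p * exp (\<bar>Im p\<bar> * pi))"
      unfolding e0 norm_mult[of "pcG a z - z powr (- p)"]
      by (rule mult_mono[OF b1 zp order_trans[OF norm_ge_zero b1] norm_ge_zero])
    also have "(norm z * sin \<epsilon>) powr (- (Re p + 2)) = norm z powr (- (Re p + 2)) * sin \<epsilon> powr (- (Re p + 2))"
      using z se by (simp add: powr_mult)
    also have "norm K * (1/2 * (Gamma (Re p + 2) * (norm z powr (- (Re p + 2)) * sin \<epsilon> powr (- (Re p + 2))))) * (norm z powr Re p * exp (\<bar>Im p\<bar> * pi))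
       = C * (norm z powr (- (Re p + 2)) * norm z powr Re p)"
      by (simp add: C_def)
    also have "norm z powr (- (Re p + 2)) * norm z powr Re p = 1 / (norm z)\<^sup>2"
      using z by (simp flip: powr_add) (simp add: powr_minus divide_inverse)
    finally show "pc_err a z \<le> C / (norm z)\<^sup>2"
      by (simp add: p_def)
  qed
qed

definition pc_asymp :: "complex \<Rightarrow> bool" where
  "pc_asymp a \<longleftrightarrow> (\<forall>\<delta>>0. \<exists>C. \<forall>z. norm z \<ge> 1 \<longrightarrow> \<bar>Arg z\<bar> \<le> 3 / 4 * pi - \<delta> \<longrightarrow>
      pc_err a z \<le> C / (norm z)\<^sup>2)"

text \<open>Rotations by \<open>\<theta>\<close> and \<open>- \<theta>\<close> together cover the
  sector: each is used on the half where it brings \<open>Arg z\<close> towards 0.\<close>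

lemma pc_asymp_base:
  assumes a: "Re a > - 1/2"
  shows "pc_asymp a"
  unfolding pc_asymp_def
proof (intro allI impI)
  fix \<delta>' :: real assume d': "\<delta>' > 0"
  \<comment> \<open>Capping at \<open>pi / 2\<close> keeps \<open>\<theta>\<close> nonnegative and
    only enlarges the sector to be covered.\<close>
  define \<delta> where "\<delta> = min \<delta>' (pi / 2)"
  have d: "\<delta> > 0" "\<delta> \<le> pi / 2" "\<delta> \<le> \<delta>'" using d' by (auto simp: \<delta>_def)
  define \<theta> where "\<theta> = pi / 4 - \<delta> / 2"
  have th: "\<bar>\<theta>\<bar> < pi / 4" "\<bar>- \<theta>\<bar> < pi / 4" "\<delta> / 2 > 0" using d by (auto simp: \<theta>_def)
  obtain C1 where C1: "\<And>z. z \<noteq> 0 \<Longrightarrow> \<bar>Arg z + \<theta>\<bar> \<le> pi / 2 - \<delta> / 2 \<Longrightarrow> pc_err a z \<le> C1 / (norm z)\<^sup>2"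
    using pcG_asymp_aux[OF a th(1,3)] by blast
  obtain C2 where C2: "\<And>z. z \<noteq> 0 \<Longrightarrow> \<bar>Arg z + (- \<theta>)\<bar> \<le> pi / 2 - \<delta> / 2 \<Longrightarrow> pc_err a z \<le> C2 / (norm z)\<^sup>2"
    using pcG_asymp_aux[OF a th(2,3)] by blast
  show "\<exists>C. \<forall>z. norm z \<ge> 1 \<longrightarrow> \<bar>Arg z\<bar> \<le> 3 / 4 * pi - \<delta>' \<longrightarrow> pc_err a z \<le> C / (norm z)\<^sup>2"
  proof (intro exI[of _ "max C1 C2"] allI impI)
    fix z :: complex assume z: "norm z \<ge> 1" "\<bar>Arg z\<bar> \<le> 3 / 4 * pi - \<delta>'"
    have z0: "z \<noteq> 0" using z by auto
    have "pc_err a z \<le> C1 / (norm z)\<^sup>2 \<or> pc_err a z \<le> C2 / (norm z)\<^sup>2"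
    proof (cases "Arg z \<ge> 0")
      case True
      then have "\<bar>Arg z + (- \<theta>)\<bar> \<le> pi / 2 - \<delta> / 2" using z d pi_gt_zero unfolding \<theta>_def by (auto simp: abs_if)
      then show ?thesis using C2[OF z0] by blast
    next
      case False
      then have "\<bar>Arg z + \<theta>\<bar> \<le> pi / 2 - \<delta> / 2" using z d pi_gt_zero unfolding \<theta>_def by (auto simp: abs_if)
      then show ?thesis using C1[OF z0] by blast
    qed
    moreover have "C1 / (norm z)\<^sup>2 \<le> max C1 C2 / (norm z)\<^sup>2" "C2 / (norm z)\<^sup>2 \<le> max C1 C2 / (norm z)\<^sup>2"
      by (auto intro!: divide_right_mono)
    ultimately show "pc_err a z \<le> max C1 C2 / (norm z)\<^sup>2" by linarith
  qed
qed

text \<open>After multiplication by \<open>z powr (a + 1/2)\<close> the recurrence reads u + (a +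
  3/2) v / z^2 with u and v the normalised functions at \<open>a + 1\<close> and
  \<open>a + 2\<close>. The first carries its own error, the second is bounded and already divided
  by z^2.\<close>

lemma pc_asymp_step:
  assumes "pc_asymp (a + 1)" "pc_asymp (a + 2)"
  shows "pc_asymp a"
  unfolding pc_asymp_def
proof (intro allI impI)
  fix \<delta> :: real assume d: "\<delta> > 0"
  obtain C1 where C1: "\<And>z. norm z \<ge> 1 \<Longrightarrow> \<bar>Arg z\<bar> \<le> 3 / 4 * pi - \<delta> \<Longrightarrow> pc_err (a + 1) z \<le> C1 / (norm z)\<^sup>2"
    using assms(1) d unfolding pc_asymp_def by blast
  obtain C2 where C2: "\<And>z. norm z \<ge> 1 \<Longrightarrow> \<bar>Arg z\<bar> \<le> 3 / 4 * pi - \<delta> \<Longrightarrow> pc_err (a + 2) z \<le> C2 / (norm z)\<^sup>2"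
    using assms(2) d unfolding pc_asymp_def by blast
  define C where "C = C1 + norm (a + 3/2) * (1 + \<bar>C2\<bar>)"
  show "\<exists>C. \<forall>z. norm z \<ge> 1 \<longrightarrow> \<bar>Arg z\<bar> \<le> 3 / 4 * pi - \<delta> \<longrightarrow> pc_err a z \<le> C / (norm z)\<^sup>2"
  proof (intro exI[of _ C] allI impI)
    fix z :: complex assume z: "norm z \<ge> 1" "\<bar>Arg z\<bar> \<le> 3 / 4 * pi - \<delta>"
    have z0: "z \<noteq> 0" using z by auto
    define u where "u = pcG (a + 1) z * z powr (a + 1 + 1/2)"
    define v where "v = pcG (a + 2) z * z powr (a + 2 + 1/2)"
    have p: "z powr (a + 1 + 1/2) = z * z powr (a + 1/2)" "z powr (a + 2 + 1/2) = z\<^sup>2 * z powr (a + 1/2)"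
      using z0 powr_add[of z "a + 1/2" 1] powr_add[of z "a + 1/2" 2] by (simp_all add: add_ac powr_numeral mult_ac)
    have "pcG a z = z * pcG (a + 1) z + (a + 3/2) * pcG (a + 2) z"
      using pcG_rec[of "a + 1" z] by (simp add: add_ac)
    have "pcG a z * z powr (a + 1/2) - 1 = (u - 1) + (a + 3/2) * v / z\<^sup>2"
    proof -
      have "(a + 3/2) * v / z\<^sup>2 = (a + 3/2) * pcG (a + 2) z * z powr (a + 1/2)"
        using z0 unfolding v_def p by simp
      then show ?thesis unfolding \<open>pcG a z = _\<close> u_def p by (simp add: algebra_simps)
    qed
    then have "pc_err a z \<le> norm (u - 1) + norm (a + 3/2) * norm v / (norm z)\<^sup>2"
      using norm_triangle_ineq[of "u - 1" "(a + 3/2) * v / z\<^sup>2"] by (simp only: norm_mult norm_divide norm_power)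
    also have "norm (u - 1) \<le> C1 / (norm z)\<^sup>2" unfolding u_def by (rule C1[OF z])
    also have "norm v \<le> 1 + \<bar>C2\<bar>"
    proof -
      have "norm v \<le> 1 + norm (v - 1)" using norm_triangle_ineq[of 1 "v - 1"] by simp
      also have "norm (v - 1) \<le> C2 / (norm z)\<^sup>2" unfolding v_def by (rule C2[OF z])
      also have "\<dots> \<le> \<bar>C2\<bar> / 1" using z(1) by (intro frac_le) auto
      finally show ?thesis by simp
    qed
    finally have "pc_err a z \<le> C1 / (norm z)\<^sup>2 + norm (a + 3/2) * (1 + \<bar>C2\<bar>) / (norm z)\<^sup>2"
      by (simp add: mult_left_mono divide_right_mono)
    then show "pc_err a z \<le> C / (norm z)\<^sup>2" by (simp add: C_def add_divide_distrib)
  qed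
qed

text \<open>Carries a property from the half plane where the integral representation converges to
  all parameters; two premises in the step match a three-term recurrence.\<close>

lemma backward_induct_complex:
  fixes P :: "complex \<Rightarrow> bool"
  assumes base: "\<And>a. Re a > - 1/2 \<Longrightarrow> P a" and step: "\<And>a. P (a + 1) \<Longrightarrow> P (a + 2) \<Longrightarrow> P a"
  shows "P a"
proof -
  have "Re a > - 1/2 - real n \<Longrightarrow> P a" for n a
  proof (induction n arbitrary: a)
    case (Suc n)
    show ?case by (rule step; rule Suc.IH) (use Suc.prems in auto)
  qed (simp add: base)
  moreover obtain n where "- 1/2 - Re a < real n" using reals_Archimedean2 by blast
  ultimately show ?thesis by (metis diff_less_eq add.commute)
qed

lemma pc_asymp: "pc_asymp a"
  by (rule backward_induct_complex[of pc_asymp, OF pc_asymp_base pc_asymp_step])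

section \<open>Bounds on the positive axis, locally uniform in the parameter\<close>

lemma continuous_on_pcf:
  assumes "continuous_on S f"
  shows "continuous_on S (\<lambda>x. pcf0 (f x))" "continuous_on S (\<lambda>x. pcf1 (f x))"
proof -
  have r: "continuous_on S (\<lambda>x. rGamma (f x / 2 + c))" for c
    by (rule continuous_on_compose2[OF holomorphic_on_imp_continuous_on[OF holomorphic_rGamma[of UNIV]]])
       (auto intro!: continuous_intros assms)
  show "continuous_on S (\<lambda>x. pcf0 (f x))" "continuous_on S (\<lambda>x. pcf1 (f x))"
    unfolding pcf0_def pcf1_def powr_def by (auto intro!: continuous_intros assms r)
qed

lemma continuous_at_pcf0: "isCont f a \<Longrightarrow> isCont (\<lambda>x. pcf0 (f x)) a"
  using continuous_on_pcf(1)[of UNIV "\<lambda>x. x"] isCont_o2[of a f pcf0] by (simp add: continuous_on_eq_continuous_at)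

text \<open>A bound for a single parameter would follow from the asymptotics; uniformity in a
  neighbourhood is what dominated convergence in \<open>isCont_pcM\<close> requires. The power of
  \<open>1 + t\<close> appears because every use of the recurrence multiplies by
  \<open>t\<close>.\<close>

lemma pcG_locally_bounded:
  "\<exists>C k r. r > 0 \<and> (\<forall>b\<in>ball a r. \<forall>t\<ge>0. norm (pcG b (of_real t)) \<le> C * (1 + t) ^ k)"
proof (rule backward_induct_complex[of "\<lambda>a. \<exists>C k r. r > 0 \<and> (\<forall>b\<in>ball a r. \<forall>t\<ge>0. norm (pcG b (of_real t)) \<le> C * (1 + t) ^ k)" a])
  fix a :: complex assume a: "Re a > - 1/2"
  \<comment> \<open>The second factor is the integral of the norm of the Laplace integrand at t = 0,
    rewritten as a value of \<open>pcf0\<close> at \<open>Re b\<close>. In this form continuity in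
    \<open>b\<close> is evident.\<close>
  define h where "h = (\<lambda>b. norm (rGamma (b + 1/2)) * norm (Gamma (of_real (Re b) + 1/2) * pcf0 (of_real (Re b))))"
  have bd: "norm (pcG b (of_real t)) \<le> h b" if b: "Re b > - 1/2" and t: "t \<ge> 0" for b t
  proof -
    define s where "s = complex_of_real (Re b)"
    let ?g = "\<lambda>x::real. of_real x powr (b + 1/2 - 1) * exp (- 1 * (of_real x)\<^sup>2 / 2) :: complex"
    let ?h = "\<lambda>x::real. of_real x powr (s + 1/2 - 1) * exp (- 1 * (of_real x)\<^sup>2 / 2) :: complex"
    have s: "Re s > - 1/2" using b by (simp add: s_def)
    have h: "integrable half_line ?h" using s by (intro gaussian_moment_half_line) auto
    note nh = integrable_norm[OF h]
    have heq: "?h x = of_real (norm (?h x))" if x: "x > 0" for x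
    proof -
      have "exp (- 1 * (complex_of_real x)\<^sup>2 / 2) = of_real (exp (- (x\<^sup>2 / 2)))" by (simp add: exp_of_real[symmetric])
      moreover have "complex_of_real x powr (s + 1/2 - 1) = of_real (x powr (Re b - 1/2))"
        using x powr_of_real[of x "Re b - 1/2"] by (simp add: s_def)
      ultimately show ?thesis by (simp add: norm_mult)
    qed
    have "pcf0 s = rGamma (s + 1/2) * (\<integral>x. ?h x \<partial>half_line)"
      using pcG_integral[OF s, of 0 0] pcU_eq[of s 0] by (simp add: pcU_0)
    moreover have "Gamma (s + 1/2) * rGamma (s + 1/2) = 1"
      using Re_pos_not_nonpos_Ints[of "s + 1/2"] s by (simp add: rGamma_inverse_Gamma Gamma_eq_zero_iff)
    ultimately have "Gamma (s + 1/2) * pcf0 s = (\<integral>x. ?h x \<partial>half_line)" by (simp add: mult.assoc[symmetric])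
    also have "\<dots> = (\<integral>x. complex_of_real (norm (?h x)) \<partial>half_line)"
      by (rule Bochner_Integration.integral_cong[OF refl]) (use heq in auto)
    also have "\<dots> = of_real (\<integral>x. norm (?h x) \<partial>half_line)" by (rule integral_of_real[OF nh])
    finally have Ih: "norm (Gamma (s + 1/2) * pcf0 s) = (\<integral>x. norm (?h x) \<partial>half_line)"
      by (simp only: norm_of_real) (simp add: integral_nonneg_AE)
    have "pcG b (of_real t) = rGamma (b + 1/2) * (\<integral>x. exp (- of_real t * of_real x) * ?g x \<partial>half_line)"
      using pcG_integral[OF b, of 0 "of_real t"] by simp
    then have e: "norm (pcG b (of_real t)) = norm (rGamma (b + 1/2)) * norm (\<integral>x. exp (- of_real t * of_real x) * ?g x \<partial>half_line)"
      by (simp only: norm_mult)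
    have le: "norm (exp (- of_real t * of_real x) * ?g x) \<le> norm (?h x)" if x: "x > 0" for x
    proof -
      have "norm (exp (- of_real t * of_real x :: complex)) * norm (?g x) \<le> 1 * norm (?g x)"
        using t x by (intro mult_right_mono) auto
      moreover have "norm (?g x) = norm (?h x)" using x unfolding norm_mult norm_powr_of_real[OF x] by (simp add: s_def)
      ultimately show ?thesis unfolding norm_mult by simp
    qed
    have "continuous_on {0<..} (\<lambda>x. exp (- of_real t * of_real x) * ?g x)"
      by (intro continuous_intros) auto
    then have "integrable half_line (\<lambda>x. exp (- of_real t * of_real x) * ?g x)"
      using le by (rule integrable_half_line_bound[OF nh])
    then have "norm (\<integral>x. exp (- of_real t * of_real x) * ?g x \<partial>half_line) \<le> (\<integral>x. norm (?h x) \<partial>half_line)"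
      by (rule Bochner_Integration.integral_norm_bound_integral[OF _ nh]) (use le in auto)
    then show ?thesis
      unfolding e h_def s_def[symmetric] Ih by (rule mult_left_mono) simp
  qed
  have "continuous (at a) h"
    using a unfolding h_def
    by (intro continuous_intros isCont_rGamma isCont_Gamma continuous_at_pcf0) (use Re_pos_not_nonpos_Ints in auto)
  then have "eventually (\<lambda>b. h b < h a + 1) (nhds a)"
    unfolding continuous_within by (intro order_tendstoD[of h "h a"]) (auto simp: tendsto_at_iff_tendsto_nhds)
  moreover have "eventually (\<lambda>b. b \<in> {b. Re b > - 1/2}) (nhds a)"
    using a by (intro eventually_nhds_in_open open_halfspace_Re_gt) auto
  ultimately have "eventually (\<lambda>b. h b < h a + 1 \<and> Re b > - 1/2) (nhds a)" by eventually_elim auto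
  then obtain r where r: "r > 0" "\<And>b. dist b a < r \<Longrightarrow> h b < h a + 1 \<and> Re b > - 1/2"
    unfolding eventually_nhds_metric by blast
  show "\<exists>C k r. r > 0 \<and> (\<forall>b\<in>ball a r. \<forall>t\<ge>0. norm (pcG b (of_real t)) \<le> C * (1 + t) ^ k)"
  proof (rule exI[of _ "h a + 1"], rule exI[of _ 0], rule exI[of _ r], intro conjI ballI allI impI)
    fix b and t :: real assume "b \<in> ball a r" "t \<ge> 0"
    then have "norm (pcG b (of_real t)) \<le> h b" "h b < h a + 1" using r(2)[of b] bd[of b t] by (auto simp: dist_commute)
    then show "norm (pcG b (of_real t)) \<le> (h a + 1) * (1 + t) ^ 0" by simp
  qed (fact r)
next
  fix a :: complex
  assume "\<exists>C k r. r > 0 \<and> (\<forall>b\<in>ball (a + 1) r. \<forall>t\<ge>0. norm (pcG b (of_real t)) \<le> C * (1 + t) ^ k)"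
    and "\<exists>C k r. r > 0 \<and> (\<forall>b\<in>ball (a + 2) r. \<forall>t\<ge>0. norm (pcG b (of_real t)) \<le> C * (1 + t) ^ k)"
  then obtain C1 k1 r1 C2 k2 r2 where r: "r1 > 0" "r2 > 0"
    and 1: "\<And>b t. b \<in> ball (a + 1) r1 \<Longrightarrow> t \<ge> 0 \<Longrightarrow> norm (pcG b (of_real t)) \<le> C1 * (1 + t) ^ k1"
    and 2: "\<And>b t. b \<in> ball (a + 2) r2 \<Longrightarrow> t \<ge> 0 \<Longrightarrow> norm (pcG b (of_real t)) \<le> C2 * (1 + t) ^ k2"
    by blast
  define r where "r = min r1 r2"
  define k where "k = Suc (max k1 k2)"
  have C: "C1 \<ge> 0" "C2 \<ge> 0"
    using order_trans[OF norm_ge_zero 1[of "a + 1" 0]] order_trans[OF norm_ge_zero 2[of "a + 2" 0]] r by auto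
  show "\<exists>C k r. r > 0 \<and> (\<forall>b\<in>ball a r. \<forall>t\<ge>0. norm (pcG b (of_real t)) \<le> C * (1 + t) ^ k)"
  proof (rule exI[of _ "C1 + (norm a + r + 3/2) * C2"], rule exI[of _ k], rule exI[of _ r], intro conjI ballI allI impI)
    fix b and t :: real assume b: "b \<in> ball a r" and t: "t \<ge> 0"
    have b1: "b + 1 \<in> ball (a + 1) r1" "b + 2 \<in> ball (a + 2) r2" using b by (auto simp: r_def dist_norm)
    have "norm (b + 3/2) \<le> norm b + 3/2" using norm_triangle_ineq[of b "3/2"] by simp
    also have "norm b \<le> norm a + r" using b norm_triangle_ineq2[of b a] by (simp add: dist_norm norm_minus_commute)
    finally have nb: "norm (b + 3/2) \<le> norm a + r + 3/2" by simp
    have pw: "(1 + t) ^ m \<le> (1 + t) ^ k" if "m \<le> k" for m using t that by (intro power_increasing) auto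
    have "pcG b (of_real t) = of_real t * pcG (b + 1) (of_real t) + (b + 3/2) * pcG (b + 2) (of_real t)"
      using pcG_rec[of "b + 1" "of_real t"] by (simp add: add_ac)
    then have "norm (pcG b (of_real t)) \<le> t * norm (pcG (b + 1) (of_real t)) + norm (b + 3/2) * norm (pcG (b + 2) (of_real t))"
      using norm_triangle_ineq[of "of_real t * pcG (b + 1) (of_real t)" "(b + 3/2) * pcG (b + 2) (of_real t)"] t by (simp add: norm_mult)
    also have "\<dots> \<le> (1 + t) * (C1 * (1 + t) ^ k1) + (norm a + r + 3/2) * (C2 * (1 + t) ^ k2)"
      using t nb by (intro add_mono mult_mono 1 2 b1) (auto simp: C intro: order_trans[OF norm_ge_zero])
    also have "\<dots> = C1 * (1 + t) ^ Suc k1 + (norm a + r + 3/2) * C2 * (1 + t) ^ k2" by simp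
    also have "\<dots> \<le> C1 * (1 + t) ^ k + (norm a + r + 3/2) * C2 * (1 + t) ^ k"
      using r C by (intro add_mono mult_left_mono pw) (auto simp: k_def r_def)
    finally show "norm (pcG b (of_real t)) \<le> (C1 + (norm a + r + 3/2) * C2) * (1 + t) ^ k" by (simp add: algebra_simps)
  qed (use r in \<open>auto simp: r_def\<close>)
qed

section \<open>Uniqueness and connection formula\<close>

lemma power_exp_bounded:
  "\<exists>C. \<forall>t\<ge>0. (1 + t) ^ k * exp (- t\<^sup>2 / 8) \<le> (C :: real)"
proof (intro exI allI impI)
  fix t :: real assume t: "t \<ge> 0"
  have "(1 + t) ^ k \<le> fact k * exp (1 + t)" using t by (intro power_le_fact_exp) simp
  then have "(1 + t) ^ k * exp (- t\<^sup>2 / 8) \<le> fact k * exp (1 + t) * exp (- t\<^sup>2 / 8)" by (rule mult_right_mono) simp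
  also have "\<dots> = fact k * exp (1 + t - t\<^sup>2 / 8)" by (simp add: mult.assoc flip: exp_add)
  also have "1 + t - t\<^sup>2 / 8 = 3 - (t - 4)\<^sup>2 / 8" by (simp add: power2_eq_square field_simps)
  also have "fact k * exp (3 - (t - 4)\<^sup>2 / 8) \<le> fact k * exp (3 :: real)" by simp
  finally show "(1 + t) ^ k * exp (- t\<^sup>2 / 8) \<le> fact k * exp 3" .
qed

lemma pcU_locally_bounded:
  "\<exists>C r. r > 0 \<and> (\<forall>b\<in>ball a r. \<forall>t\<ge>0. norm (pcU b (of_real t)) \<le> C * exp (- t\<^sup>2 / 8))"
proof -
  obtain C k r where r: "r > 0" and C: "\<And>b t. b \<in> ball a r \<Longrightarrow> t \<ge> 0 \<Longrightarrow> norm (pcG b (of_real t)) \<le> C * (1 + t) ^ k"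
    using pcG_locally_bounded by blast
  obtain D where D: "\<And>t. t \<ge> 0 \<Longrightarrow> (1 + t) ^ k * exp (- t\<^sup>2 / 8) \<le> (D :: real)" using power_exp_bounded by blast
  have C0: "C \<ge> 0" using order_trans[OF norm_ge_zero C[of a 0]] r by auto
  have "norm (pcU b (of_real t)) \<le> C * D * exp (- t\<^sup>2 / 8)" if "b \<in> ball a r" "t \<ge> 0" for b t
  proof -
    \<comment> \<open>One half of the Gaussian absorbs the polynomial growth of \<open>pcG\<close>,
      the other half is the decay that is kept.\<close>
    have e: "exp (- t\<^sup>2 / 4) = exp (- t\<^sup>2 / 8) * exp (- t\<^sup>2 / 8)" by (simp flip: exp_add)
    have "norm (exp (- (complex_of_real t)\<^sup>2 / 4)) = exp (- t\<^sup>2 / 4)"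
      unfolding norm_exp_eq_Re by (simp add: power2_eq_square)
    then have "norm (pcU b (of_real t)) = exp (- t\<^sup>2 / 4) * norm (pcG b (of_real t))"
      by (simp only: pcU_eq norm_mult)
    also have "\<dots> \<le> exp (- t\<^sup>2 / 4) * (C * (1 + t) ^ k)" using C[OF that] by simp
    also have "\<dots> = C * ((1 + t) ^ k * exp (- t\<^sup>2 / 8)) * exp (- t\<^sup>2 / 8)" unfolding e by simp
    also have "\<dots> \<le> C * D * exp (- t\<^sup>2 / 8)"
      using D[OF that(2)] C0 by (intro mult_right_mono mult_left_mono) auto
    finally show ?thesis .
  qed
  with r show ?thesis by blast
qed

lemma pcU_bounded: "\<exists>C. \<forall>t\<ge>0. norm (pcU a (of_real t)) \<le> C * exp (- t\<^sup>2 / 8)"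
proof -
  obtain C r where "r > 0" "\<And>b t. b \<in> ball a r \<Longrightarrow> t \<ge> 0 \<Longrightarrow> norm (pcU b (of_real t)) \<le> C * exp (- t\<^sup>2 / 8)"
    using pcU_locally_bounded by blast
  then have "\<forall>t\<ge>0. norm (pcU a (of_real t)) \<le> C * exp (- t\<^sup>2 / 8)" by simp
  then show ?thesis ..
qed

text \<open>Expresses the derivative by two values of \<open>pcU\<close>, so that decay of U at all
  parameters gives decay of U'.\<close>

lemma pcU'_rec: "pcU' a z = z / 2 * pcU a z - pcU (a - 1) z"
  unfolding pcU'_eq pcU_eq pcG_rec by (simp add: algebra_simps)

lemma pcU'_bounded: "\<exists>C. \<forall>t\<ge>0. norm (pcU' a (of_real t)) \<le> C * ((1 + t) * exp (- t\<^sup>2 / 8))"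
proof -
  obtain C where C: "\<And>t. t \<ge> 0 \<Longrightarrow> norm (pcU a (of_real t)) \<le> C * exp (- t\<^sup>2 / 8)" using pcU_bounded by blast
  obtain D where D: "\<And>t. t \<ge> 0 \<Longrightarrow> norm (pcU (a - 1) (of_real t)) \<le> D * exp (- t\<^sup>2 / 8)" using pcU_bounded by blast
  have nn: "0 \<le> C * exp (- t\<^sup>2 / 8)" "0 \<le> D * exp (- t\<^sup>2 / 8)" if "t \<ge> 0" for t
    using order_trans[OF norm_ge_zero C[OF that]] order_trans[OF norm_ge_zero D[OF that]] by auto
  have "norm (pcU' a (of_real t)) \<le> (C + D) * ((1 + t) * exp (- t\<^sup>2 / 8))" if t: "t \<ge> 0" for t
  proof -
    have "norm (pcU' a (of_real t)) \<le> t / 2 * norm (pcU a (of_real t)) + norm (pcU (a - 1) (of_real t))"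
      unfolding pcU'_rec using norm_triangle_ineq4[of "of_real t / 2 * pcU a (of_real t)" "pcU (a - 1) (of_real t)"] t
      by (simp add: norm_mult norm_divide)
    also have "\<dots> \<le> (1 + t) * (C * exp (- t\<^sup>2 / 8)) + (1 + t) * (D * exp (- t\<^sup>2 / 8))"
      using t nn[OF t] C[OF t] D[OF t] mult_right_mono[of 1 "1 + t" "D * exp (- t\<^sup>2 / 8)"] by (intro add_mono mult_mono) auto
    finally show ?thesis by (simp add: algebra_simps)
  qed
  then show ?thesis by blast
qed

lemma is_weber_sol_pcU: "is_weber_sol a (pcU a) (pcU' a)"
  unfolding pcU_def pcU'_def by (rule is_weber_sol_weber)

lemma pcU_has_deriv: "(pcU a has_field_derivative pcU' a z) (at z within S)"
  using is_weber_sol_pcU[of a] unfolding is_weber_sol_def by (blast intro: has_field_derivative_at_within)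

lemma pcU_holomorphic [holomorphic_intros]: "pcU a holomorphic_on S"
  using pcU_has_deriv by (auto simp: holomorphic_on_def field_differentiable_def)

lemma pcU_ratio_tendsto:
  assumes d: "\<delta> > 0"
  shows "((\<lambda>z. pcG a z * z powr (a + 1/2)) \<longlongrightarrow> 1) (inf at_infinity (principal {z. \<bar>Arg z\<bar> \<le> 3 / 4 * pi - \<delta>}))"
    (is "(_ \<longlongrightarrow> _) ?F")
proof -
  obtain C where C: "\<And>z. norm z \<ge> 1 \<Longrightarrow> \<bar>Arg z\<bar> \<le> 3 / 4 * pi - \<delta> \<Longrightarrow> pc_err a z \<le> C / (norm z)\<^sup>2"
    using pc_asymp[of a] d unfolding pc_asymp_def by blast
  have "((\<lambda>z::complex. C / (norm z)\<^sup>2) \<longlongrightarrow> 0) at_infinity"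
    by (intro tendsto_divide_0[OF tendsto_const] filterlim_at_top_imp_at_infinity filterlim_pow_at_top filterlim_norm_at_top) auto
  then have lim: "((\<lambda>z::complex. C / (norm z)\<^sup>2) \<longlongrightarrow> 0) ?F" by (rule tendsto_mono[rotated]) simp
  have "eventually (\<lambda>z. norm z \<ge> (1::real)) (at_infinity :: complex filter)"
    by (simp add: eventually_at_infinity) blast
  then have "eventually (\<lambda>z. pc_err a z \<le> C / (norm z)\<^sup>2) ?F"
    unfolding eventually_inf_principal by eventually_elim (use C in auto)
  from tendsto_0_le[OF lim, of _ 1] this have "((\<lambda>z. pcG a z * z powr (a + 1/2) - 1) \<longlongrightarrow> 0) ?F"
    by (rule_tac Lim_null_comparison[OF _ lim])
  then show ?thesis by (simp add: LIM_zero_iff)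
qed

lemma filterlim_of_real_sector:
  assumes "\<delta> \<le> 3 / 4 * pi"
  shows "filterlim complex_of_real (inf at_infinity (principal {z. \<bar>Arg z\<bar> \<le> 3 / 4 * pi - \<delta>})) at_top"
proof (rule filterlim_inf[THEN iffD2], intro conjI)
  show "filterlim complex_of_real at_infinity at_top"
    by (rule filterlim_of_real_at_infinity)
  show "filterlim complex_of_real (principal {z. \<bar>Arg z\<bar> \<le> 3 / 4 * pi - \<delta>}) at_top"
    unfolding filterlim_principal using eventually_gt_at_top[of "0::real"]
    by eventually_elim (use assms in simp)
qed

lemma pcG_real_tendsto: "((\<lambda>x. pcG a (of_real x) * of_real x powr (a + 1/2)) \<longlongrightarrow> 1) at_top"
  by (rule filterlim_compose[OF pcU_ratio_tendsto[of "pi / 2" a] filterlim_of_real_sector]) auto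

lemma pcU_real_nonzero: "eventually (\<lambda>x. pcU a (of_real x) \<noteq> 0) at_top"
proof -
  have "eventually (\<lambda>x. pcG a (of_real x) * of_real x powr (a + 1/2) \<noteq> 0) at_top"
    using pcG_real_tendsto by (rule tendsto_imp_eventually_ne) simp
  then show ?thesis by eventually_elim (auto simp: pcU_eq)
qed

text \<open>Integrating the equation shows that \<open>f'\<close> grows at most polynomially,
  whereas U and U' decay like Gaussians. Their constant Wronskian must then be 0, and
  proportionality follows at a point of the positive axis where U does not vanish. This one
  criterion identifies both the functions satisfying \<open>is_parcyl_U\<close> and the generating
  function of the connection coefficients.\<close>

lemma bounded_weber_sol:
  assumes f: "is_weber_sol a f f'" and bd: "\<And>x. x \<ge> 0 \<Longrightarrow> norm (f (of_real x)) \<le> C"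
  shows "\<exists>c. \<forall>z. f z = c * pcU a z"
proof -
  have C0: "C \<ge> 0" using order_trans[OF norm_ge_zero bd[of 0]] by simp
  define A where "A = norm (f' 0) + C * (1 + norm a)"
  have A0: "A \<ge> 0" using C0 by (simp add: A_def)
  have f': "norm (f' (of_real x)) \<le> A * (1 + x) ^ 3" if x: "x \<ge> 0" for x
  proof -
    have "norm (f' (of_real x) - f' 0) \<le> ((1 + norm a) * (1 + x)\<^sup>2 * C) * norm (of_real x - (0::complex))"
    proof (rule field_differentiable_bound[where S="closed_segment 0 (of_real x)" and f'="\<lambda>z. (z\<^sup>2 / 4 + a) * f z"])
      show "(f' has_field_derivative (z\<^sup>2 / 4 + a) * f z) (at z within closed_segment 0 (of_real x))" for z
        using f unfolding is_weber_sol_def by (blast intro: has_field_derivative_at_within)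
      show "norm ((z\<^sup>2 / 4 + a) * f z) \<le> (1 + norm a) * (1 + x)\<^sup>2 * C" if "z \<in> closed_segment 0 (of_real x)" for z
      proof -
        from in_segment(1)[THEN iffD1, OF that]
        obtain u where u': "0 \<le> u \<and> u \<le> 1 \<and> z = (1 - u) *\<^sub>R 0 + u *\<^sub>R of_real x" by auto
        then have u: "0 \<le> u" "u \<le> 1" "z = of_real (u * x)"
          by (simp_all add: scaleR_conv_of_real)
        define y where "y = u * x"
        have y: "0 \<le> y" "y \<le> x" using u x mult_right_mono[of u 1 x] by (auto simp: y_def)
        have "norm (z\<^sup>2 / 4 + a) \<le> norm (z\<^sup>2 / 4) + norm a" by (rule norm_triangle_ineq)
        also have "\<dots> = y\<^sup>2 / 4 + norm a" unfolding u(3) y_def[symmetric] by (simp add: norm_divide norm_power)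
        also have "\<dots> \<le> (1 + x)\<^sup>2 + norm a * (1 + x)\<^sup>2"
        proof (rule add_mono)
          have "y\<^sup>2 \<le> (1 + x)\<^sup>2" using y by (intro power_mono) auto
          then show "y\<^sup>2 / 4 \<le> (1 + x)\<^sup>2" using zero_le_power2[of y] by linarith
          have "1 \<le> (1 + x)\<^sup>2" using x by (intro one_le_power) auto
          then show "norm a \<le> norm a * (1 + x)\<^sup>2" using mult_left_mono[of 1 "(1 + x)\<^sup>2" "norm a"] by simp
        qed
        finally have "norm (z\<^sup>2 / 4 + a) \<le> (1 + norm a) * (1 + x)\<^sup>2" by (simp add: algebra_simps)
        then show ?thesis unfolding norm_mult using bd[OF y(1)] u(3) C0
          by (intro mult_mono) (auto simp: y_def)
      qed
    qed auto
    also have "norm (of_real x - (0::complex)) = x" using x by simp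
    also have "(1 + norm a) * (1 + x)\<^sup>2 * C * x \<le> (1 + norm a) * (1 + x)\<^sup>2 * C * (1 + x)"
      using C0 by (intro mult_left_mono) auto
    also have "\<dots> = C * (1 + norm a) * (1 + x) ^ 3" by (simp add: power2_eq_square power3_eq_cube)
    finally have "norm (f' (of_real x)) \<le> norm (f' 0) * 1 + C * (1 + norm a) * (1 + x) ^ 3"
      using norm_triangle_ineq2[of "f' (of_real x)" "f' 0"] by simp
    also have "norm (f' 0) * 1 \<le> norm (f' 0) * (1 + x) ^ 3"
      using x by (intro mult_left_mono one_le_power) auto
    finally show ?thesis by (simp add: A_def algebra_simps)
  qed
  obtain K1 where K1: "\<And>t. t \<ge> 0 \<Longrightarrow> norm (pcU a (of_real t)) \<le> K1 * exp (- t\<^sup>2 / 8)" using pcU_bounded by blast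
  obtain K2 where K2: "\<And>t. t \<ge> 0 \<Longrightarrow> norm (pcU' a (of_real t)) \<le> K2 * ((1 + t) * exp (- t\<^sup>2 / 8))" using pcU'_bounded by blast
  have K0: "K1 \<ge> 0" "K2 \<ge> 0" using order_trans[OF norm_ge_zero K1[of 0]] order_trans[OF norm_ge_zero K2[of 0]] by auto
  obtain D where D: "\<And>t. t \<ge> 0 \<Longrightarrow> (1 + t) ^ 4 * exp (- t\<^sup>2 / 8) \<le> (D :: real)" using power_exp_bounded by blast
  define w where "w = f 0 * pcU' a 0 - f' 0 * pcU a 0"
  define B where "B = C * K2 + A * K1"
  \<comment> \<open>The spare factor \<open>1 + x\<close> turns boundedness into vanishing: a
    nonzero \<open>w\<close> is refuted by taking \<open>x\<close> equal to
    \<open>\<bar>B * D\<bar> / norm w\<close>.\<close>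
  have wb: "norm w * (1 + x) \<le> B * D" if x: "x \<ge> 0" for x
  proof -
    have "w = f (of_real x) * pcU' a (of_real x) - f' (of_real x) * pcU a (of_real x)"
      unfolding w_def by (rule wronskian_const[OF f is_weber_sol_pcU])
    then have "norm w \<le> norm (f (of_real x)) * norm (pcU' a (of_real x)) + norm (f' (of_real x)) * norm (pcU a (of_real x))"
      using norm_triangle_ineq4[of "f (of_real x) * pcU' a (of_real x)" "f' (of_real x) * pcU a (of_real x)"] by (simp add: norm_mult)
    also have "\<dots> \<le> C * (K2 * ((1 + x) * exp (- x\<^sup>2 / 8))) + A * (1 + x) ^ 3 * (K1 * exp (- x\<^sup>2 / 8))"
      using x by (intro add_mono mult_mono bd K1 K2 f') (auto simp: C0 A0)
    also have "\<dots> \<le> C * (K2 * ((1 + x) ^ 3 * exp (- x\<^sup>2 / 8))) + A * (1 + x) ^ 3 * (K1 * exp (- x\<^sup>2 / 8))"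
      using x C0 K0 power_increasing[of 1 3 "1 + x"] by (intro add_mono mult_left_mono mult_right_mono order_refl) auto
    also have "\<dots> = B * ((1 + x) ^ 3 * exp (- x\<^sup>2 / 8))" by (simp add: B_def algebra_simps)
    finally have "norm w * (1 + x) \<le> B * ((1 + x) ^ 3 * exp (- x\<^sup>2 / 8)) * (1 + x)"
      using x by (intro mult_right_mono) auto
    also have "\<dots> = B * ((1 + x) ^ 4 * exp (- x\<^sup>2 / 8))" by (simp add: power4_eq_xxxx power3_eq_cube)
    also have "\<dots> \<le> B * D" using D[OF x] C0 A0 K0 by (intro mult_left_mono) (auto simp: B_def)
    finally show ?thesis .
  qed
  have "w = 0"
  proof (rule ccontr)
    assume "w \<noteq> 0"
    then have "norm w * (1 + \<bar>B * D\<bar> / norm w) = norm w + \<bar>B * D\<bar>" by (simp add: field_simps)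
    moreover have "norm w * (1 + \<bar>B * D\<bar> / norm w) \<le> B * D" by (rule wb) simp
    ultimately show False using \<open>w \<noteq> 0\<close> by (simp add: abs_if split: if_splits) (smt (verit) zero_less_norm_iff)
  qed
  then have W: "f z * pcU' a z = f' z * pcU a z" for z
    using wronskian_const[OF f is_weber_sol_pcU, of z 0] by (simp add: w_def)
  obtain x where x: "pcU a (of_real x) \<noteq> 0"
    using eventually_happens[OF pcU_real_nonzero] by auto
  define c where "c = f (of_real x) / pcU a (of_real x)"
  have "1 * f z + (- c) * pcU a z = 0" for z
  proof (rule weber_sol_zero[OF is_weber_sol_lincomb[OF f is_weber_sol_pcU]])
    show "1 * f (of_real x) + (- c) * pcU a (of_real x) = 0" using x by (simp add: c_def)
    show "1 * f' (of_real x) + (- c) * pcU' a (of_real x) = 0" using x W[of "of_real x"] by (simp add: c_def field_simps)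
  qed
  then show ?thesis by (intro exI[of _ c]) (simp add: eq_neg_iff_add_eq_0)
qed

lemma is_parcyl_U_pcU: "is_parcyl_U a (pcU a)"
  unfolding is_parcyl_U_def
proof (intro conjI allI impI)
  have d: "deriv (pcU a) = pcU' a" using pcU_has_deriv DERIV_imp_deriv by blast
  have "deriv (pcU' a) z = (z\<^sup>2 / 4 + a) * pcU a z" for z
    using is_weber_sol_pcU[of a] unfolding is_weber_sol_def by (blast intro: DERIV_imp_deriv)
  then show "deriv (deriv (pcU a)) z - (z\<^sup>2 / 4 + a) * pcU a z = 0" for z by (simp add: d)
  fix \<delta> :: real assume d: "\<delta> > 0"
  let ?F = "inf at_infinity (principal {z. \<bar>Arg z\<bar> \<le> 3 / 4 * pi - \<delta>})"
  have "eventually (\<lambda>z. z \<noteq> (0::complex)) at_infinity" by (rule eventually_not_equal_at_infinity)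
  then have "eventually (\<lambda>z. z \<noteq> (0::complex)) ?F" by (rule filter_leD[rotated]) simp
  then have "eventually (\<lambda>z. pcG a z * z powr (a + 1/2) = pcU a z / (z powr (- a - 1/2) * exp (- z\<^sup>2 / 4))) ?F"
  proof eventually_elim
    case (elim z)
    have "- a - 1/2 = - (a + 1/2)" by simp
    then have "z powr (- a - 1/2) = inverse (z powr (a + 1/2))" by (simp only: powr_minus)
    then show ?case using elim by (simp add: pcU_eq field_simps)
  qed
  from Lim_transform_eventually[OF pcU_ratio_tendsto[OF d] this]
  show "pcU a \<sim>[?F] (\<lambda>z. z powr (- a - 1/2) * exp (- z\<^sup>2 / 4))"
    by (rule asymp_equivI')
qed (rule pcU_holomorphic)

text \<open>Only the positive axis is used, and \<open>pi / 2\<close> is one choice of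
  \<open>\<delta>\<close> whose sector contains it. There f / U tends to 1, so f is bounded, hence a
  multiple of U, and the limit fixes the multiple.\<close>

lemma is_parcyl_U_unique:
  assumes f: "is_parcyl_U a f"
  shows "f = pcU a"
proof -
  define F where "F = inf at_infinity (principal {z. \<bar>Arg z\<bar> \<le> 3 / 4 * pi - pi / 2})"
  have hol: "f holomorphic_on UNIV" and ode: "\<And>z. deriv (deriv f) z - (z\<^sup>2 / 4 + a) * f z = 0"
    using f unfolding is_parcyl_U_def by auto
  have as: "f \<sim>[F] (\<lambda>z. z powr (- a - 1/2) * exp (- z\<^sup>2 / 4))"
    using f pi_half_gt_zero unfolding is_parcyl_U_def F_def by blast
  have sol: "is_weber_sol a f (deriv f)"
    unfolding is_weber_sol_def
  proof (intro allI conjI)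
    fix z
    show "(f has_field_derivative deriv f z) (at z)" using holomorphic_derivI[OF hol] by auto
    have "deriv f holomorphic_on UNIV" by (rule holomorphic_deriv[OF hol]) auto
    from holomorphic_derivI[OF this, of z] show "(deriv f has_field_derivative (z\<^sup>2 / 4 + a) * f z) (at z)" using ode[of z] by simp
  qed
  have "pcU a \<sim>[F] (\<lambda>z. z powr (- a - 1/2) * exp (- z\<^sup>2 / 4))"
    using is_parcyl_U_pcU[of a] pi_half_gt_zero unfolding is_parcyl_U_def F_def by blast
  with as have fU: "f \<sim>[F] pcU a" using asymp_equiv_sym asymp_equiv_trans by blast
  have rF: "filterlim complex_of_real F at_top" unfolding F_def by (rule filterlim_of_real_sector) simp
  have "((\<lambda>x. if f x = 0 \<and> pcU a x = 0 then 1 else f x / pcU a x) \<longlongrightarrow> 1) F"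
    using fU by (simp add: asymp_equiv_def)
  from filterlim_compose[OF this rF]
  have "((\<lambda>x. if f (of_real x) = 0 \<and> pcU a (of_real x) = 0 then 1 else f (of_real x) / pcU a (of_real x)) \<longlongrightarrow> 1) at_top" .
  moreover have "eventually (\<lambda>x. (if f (of_real x) = 0 \<and> pcU a (of_real x) = 0 then 1 else f (of_real x) / pcU a (of_real x)) = f (of_real x) / pcU a (of_real x)) at_top"
    using pcU_real_nonzero[of a] by eventually_elim simp
  ultimately have lim: "((\<lambda>x. f (of_real x) / pcU a (of_real x)) \<longlongrightarrow> 1) at_top"
    by (rule Lim_transform_eventually)
  obtain K where K: "\<And>t. t \<ge> 0 \<Longrightarrow> norm (pcU a (of_real t)) \<le> K * exp (- t\<^sup>2 / 8)" using pcU_bounded by blast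
  have K0: "K \<ge> 0" using order_trans[OF norm_ge_zero K[of 0]] by simp
  have "eventually (\<lambda>x. norm (f (of_real x) / pcU a (of_real x)) < 2) at_top"
    using tendsto_norm[OF lim] by (rule order_tendstoD) simp
  with pcU_real_nonzero[of a] eventually_ge_at_top[of "0::real"]
  have "eventually (\<lambda>x. norm (f (of_real x)) \<le> 2 * K) at_top"
  proof eventually_elim
    case (elim x)
    have "norm (f (of_real x)) \<le> 2 * norm (pcU a (of_real x))" using elim by (simp add: norm_divide field_simps)
    also have "norm (pcU a (of_real x)) \<le> K * exp (- x\<^sup>2 / 8)" using K elim by simp
    also have "\<dots> \<le> K * 1" using K0 by (intro mult_left_mono) auto
    finally show ?case by simp
  qed
  then obtain X where X: "\<And>x. x \<ge> X \<Longrightarrow> norm (f (of_real x)) \<le> 2 * K" by (auto simp: eventually_at_top_linorder)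
  have "compact ((\<lambda>x. f (complex_of_real x)) ` {0..X})"
    by (intro compact_continuous_image continuous_on_compose2[OF holomorphic_on_imp_continuous_on[OF hol]] continuous_intros) auto
  then have "bounded ((\<lambda>x. f (complex_of_real x)) ` {0..X})" by (rule compact_imp_bounded)
  then obtain B where "\<forall>y\<in>(\<lambda>x. f (complex_of_real x)) ` {0..X}. norm y \<le> B"
    unfolding bounded_iff by (elim exE)
  then have B: "\<And>x. x \<in> {0..X} \<Longrightarrow> norm (f (of_real x)) \<le> B" by simp
  have "norm (f (of_real x)) \<le> max B (2 * K)" if "x \<ge> 0" for x
    using X[of x] B[of x] that by (cases "x \<ge> X") auto
  then obtain c where c: "\<And>z. f z = c * pcU a z" using bounded_weber_sol[OF sol] by blast
  have "eventually (\<lambda>x. f (of_real x) / pcU a (of_real x) = c) at_top"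
    using pcU_real_nonzero[of a] by eventually_elim (simp add: c)
  then have "((\<lambda>x::real. c) \<longlongrightarrow> 1) at_top" by (rule Lim_transform_eventually[OF lim])
  then have "c = 1" by (simp add: tendsto_const_iff)
  then show ?thesis using c by auto
qed

lemma parcyl_U_eq: "parcyl_U a = pcU a"
  unfolding parcyl_U_def using is_parcyl_U_pcU is_parcyl_U_unique by (rule the_equality)

section \<open>The connection formula\<close>

lemma two_powr_half: "(2 :: complex) powr (1/2) = of_real (sqrt 2)"
  using powr_of_real[of 2 "1/2"] by (simp add: powr_half_sqrt)

text \<open>The phase in front of \<open>U01\<close>. Together with \<open>pcA\<close>, which is the
  prefactor of \<open>U02\<close> up to sign, it also supplies the coefficients of the connection
  formula.\<close>

definition pce :: "complex \<Rightarrow> complex" where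
  "pce a = exp (\<i> * of_real pi * (a / 2 - 1/4))"

lemma pce_nonzero [simp]: "pce a \<noteq> 0"
  by (simp add: pce_def)

definition pcA :: "complex \<Rightarrow> complex" where
  "pcA a = Gamma (a + 1/2) / of_real (sqrt (2 * pi))"

text \<open>The reflection formula brings the Gamma factors at -a to those at a and produces the
  trigonometric factors; the duplication formula then trades the two Gamma values with arguments
  differing by 1/2 for one another.\<close>

lemma pcf_connection:
  assumes p: "a + 1/2 \<notin> \<int>\<^sub>\<le>\<^sub>0"
  defines "\<alpha> \<equiv> of_real pi * (a / 2 - 1/4)"
  shows "of_real (sqrt (2 * pi)) * pcf0 (- a) = Gamma (a + 1/2) * (2 * cos \<alpha>) * pcf0 a"
    and "of_real (sqrt (2 * pi)) * pcf1 (- a) = - (Gamma (a + 1/2) * (2 * sin \<alpha>) * pcf1 a)"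
proof -
  note D = Gamma_duplication_quarter[OF p]
  define w where "w = a / 2 + 1/4"
  define v where "v = a / 2 + 3/4"
  define s :: complex where "s = of_real (sqrt 2)"
  define q :: complex where "q = of_real (sqrt pi)"
  define E :: complex where "E = 2 powr (a / 2 - 1/4)"
  have s2: "s * s = 2" unfolding s_def by (simp flip: of_real_mult)
  have q2: "q * q = of_real pi" unfolding q_def by (simp flip: of_real_mult)
  have sq: "of_real (sqrt (2 * pi)) = s * q" by (simp add: s_def q_def real_sqrt_mult)
  have pw: "2 powr (x + 1/2) = s * 2 powr x" for x :: complex
    by (simp add: powr_add two_powr_half s_def)
  have e1: "2 powr (- (- a) / 2 - 1/4) = E" by (simp add: E_def)
  have e2: "2 powr (- (- a) / 2 + 1/4) = s * E" proof -
    have "2 powr (- (- a) / 2 + 1/4) = (2 powr ((a / 2 - 1/4) + 1/2) :: complex)" by (rule arg_cong) simp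
    then show ?thesis unfolding pw E_def .
  qed
  have e3: "2 powr (- a / 2 - 1/4) = s * (2 powr (1/2 - a) * E) / 2"
  proof -
    have "2 powr (1/2 - a) * E = 2 powr ((- a / 2 - 1/4) + 1/2)"
      unfolding E_def powr_add[symmetric] by (rule arg_cong) (simp add: field_simps)
    then have "s * (2 powr (1/2 - a) * E) = (s * s) * 2 powr (- a / 2 - 1/4)" unfolding pw by simp
    then show ?thesis unfolding s2 by simp
  qed
  have e4: "2 powr (- a / 2 + 1/4) = 2 powr (1/2 - a) * E"
    unfolding E_def powr_add[symmetric] by (rule arg_cong) (simp add: field_simps)
  have G: "rGamma v * Gamma (a + 1/2) * 2 powr (1/2 - a) * q = Gamma w" "rGamma w * Gamma (a + 1/2) * 2 powr (1/2 - a) * q = Gamma v"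
    using D unfolding w_def v_def q_def by (simp_all add: rGamma_inverse_Gamma Gamma_eq_zero_iff field_simps)
  have r1: "rGamma (- a / 2 + 3/4) = Gamma w * cos \<alpha> / of_real pi"
  proof -
    have "rGamma w * rGamma (1 - w) = sin (of_real pi * w) / of_real pi" by (rule rGamma_reflection_complex)
    moreover have "sin (of_real pi * w) = cos \<alpha>"
    proof -
      have "\<alpha> = - (of_real pi / 2 - of_real pi * w)" by (simp add: \<alpha>_def w_def field_simps)
      then have "cos \<alpha> = cos (of_real pi / 2 - of_real pi * w)" by (simp only: cos_minus)
      then show ?thesis by (simp add: cos_diff)
    qed
    moreover have "1 - w = - a / 2 + 3/4" by (simp add: w_def field_simps)
    moreover have "Gamma w * rGamma w = 1" using D(1) by (simp add: w_def rGamma_inverse_Gamma Gamma_eq_zero_iff)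
    ultimately show ?thesis by (metis mult.assoc mult_1 times_divide_eq_right)
  qed
  have r2: "rGamma (- a / 2 + 1/4) = - (Gamma v * sin \<alpha> / of_real pi)"
  proof -
    have "rGamma v * rGamma (1 - v) = sin (of_real pi * v) / of_real pi" by (rule rGamma_reflection_complex)
    moreover have "sin (of_real pi * v) = - sin \<alpha>"
    proof -
      have "of_real pi * v = \<alpha> + of_real pi" by (simp add: \<alpha>_def v_def field_simps)
      then show ?thesis by (simp add: sin_add)
    qed
    moreover have "1 - v = - a / 2 + 1/4" by (simp add: v_def field_simps)
    moreover have "Gamma v * rGamma v = 1" using D(2) by (simp add: v_def rGamma_inverse_Gamma Gamma_eq_zero_iff)
    ultimately show ?thesis by (metis mult.assoc mult_1 times_divide_eq_right mult_minus_right minus_divide_left)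
  qed
  show "of_real (sqrt (2 * pi)) * pcf0 (- a) = Gamma (a + 1/2) * (2 * cos \<alpha>) * pcf0 a"
  proof -
    have "of_real (sqrt (2 * pi)) * pcf0 (- a) = s * E * cos \<alpha> * Gamma w * (q * q / of_real pi)"
      unfolding sq pcf0_def e1 r1 q_def[symmetric] by simp
    also have "\<dots> = s * E * cos \<alpha> * Gamma w" unfolding q2 by simp
    also have "\<dots> = s * E * cos \<alpha> * (rGamma v * Gamma (a + 1/2) * 2 powr (1/2 - a) * q)" by (simp only: G)
    also have "\<dots> = Gamma (a + 1/2) * (2 * cos \<alpha>) * pcf0 a"
      unfolding pcf0_def e3 v_def[symmetric] q_def[symmetric] by simp
    finally show ?thesis .
  qed
  show "of_real (sqrt (2 * pi)) * pcf1 (- a) = - (Gamma (a + 1/2) * (2 * sin \<alpha>) * pcf1 a)"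
  proof -
    have "of_real (sqrt (2 * pi)) * pcf1 (- a) = (s * s) * E * sin \<alpha> * Gamma v * (q * q / of_real pi)"
      unfolding sq pcf1_def e2 r2 q_def[symmetric] by simp
    also have "\<dots> = 2 * E * sin \<alpha> * Gamma v" unfolding q2 s2 by simp
    also have "\<dots> = 2 * E * sin \<alpha> * (rGamma w * Gamma (a + 1/2) * 2 powr (1/2 - a) * q)" by (simp only: G)
    also have "\<dots> = - (Gamma (a + 1/2) * (2 * sin \<alpha>) * pcf1 a)"
      unfolding pcf1_def e4 w_def[symmetric] q_def[symmetric] by simp
    finally show ?thesis .
  qed
qed

text \<open>The symmetries of Weber's equation: c = -1 keeps the parameter, c = i or -i reverses its
  sign.\<close>

lemma is_weber_sol_scale:
  assumes f: "is_weber_sol b f f'" and c: "c ^ 4 = 1" "c\<^sup>2 * b = a"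
  shows "is_weber_sol a (\<lambda>z. f (c * z)) (\<lambda>z. c * f' (c * z))"
  unfolding is_weber_sol_def
proof (intro allI conjI)
  fix z
  have l: "((\<lambda>z. c * z) has_field_derivative c) (at z)" by (auto intro!: derivative_eq_intros)
  have d: "(f has_field_derivative f' (c * z)) (at (c * z))" "(f' has_field_derivative ((c * z)\<^sup>2 / 4 + b) * f (c * z)) (at (c * z))"
    using f unfolding is_weber_sol_def by blast+
  show "((\<lambda>z. f (c * z)) has_field_derivative c * f' (c * z)) (at z)"
    using DERIV_chain2[OF d(1) l] by (simp add: mult.commute)
  have "((\<lambda>z. c * f' (c * z)) has_field_derivative c * (((c * z)\<^sup>2 / 4 + b) * f (c * z) * c)) (at z)"
    by (intro DERIV_cmult DERIV_chain2[OF d(2) l])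
  also have "c * (((c * z)\<^sup>2 / 4 + b) * f (c * z) * c) = (c ^ 4 * z\<^sup>2 / 4 + c\<^sup>2 * b) * f (c * z)"
    by (simp add: algebra_simps power2_eq_square power4_eq_xxxx)
  finally show "((\<lambda>z. c * f' (c * z)) has_field_derivative (z\<^sup>2 / 4 + a) * f (c * z)) (at z)"
    by (simp add: c)
qed

text \<open>The connection formula at 0, for value and derivative. It is used twice: to prove the
  formula for all z, and to cancel the boundary terms of the moments in
  \<open>lamM_rec\<close>.\<close>

lemma pcf_connection_exp:
  assumes p: "a + 1/2 \<notin> \<int>\<^sub>\<le>\<^sub>0"
  shows "pce a * pcf0 (- a) = pcA a * (1 + (pce a)\<^sup>2) * pcf0 a"
    and "\<i> * pce a * pcf1 (- a) = pcA a * (1 - (pce a)\<^sup>2) * pcf1 a"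
proof -
  define \<alpha> where "\<alpha> = of_real pi * (a / 2 - 1/4)"
  define q where "q = complex_of_real (sqrt (2 * pi))"
  have q0: "q \<noteq> 0" by (simp add: q_def)
  have e: "pce a = exp (\<i> * \<alpha>)" by (simp add: pce_def \<alpha>_def mult.assoc)
  have cs': "2 * cos \<alpha> = pce a + inverse (pce a)" "2 * sin \<alpha> = - \<i> * (pce a - inverse (pce a))"
    unfolding e cos_exp_eq sin_exp_eq by (simp_all add: Transcendental.exp_minus)
  have cs: "pce a * (2 * cos \<alpha>) = 1 + (pce a)\<^sup>2" "\<i> * pce a * (2 * sin \<alpha>) = (pce a)\<^sup>2 - 1"
    unfolding cs' by (simp_all add: algebra_simps power2_eq_square)
  note C = pcf_connection[OF p, folded \<alpha>_def q_def]
  have "q * (pce a * pcf0 (- a)) = Gamma (a + 1/2) * (pce a * (2 * cos \<alpha>)) * pcf0 a"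
    using C(1) by (simp add: mult_ac)
  then show "pce a * pcf0 (- a) = pcA a * (1 + (pce a)\<^sup>2) * pcf0 a"
    using q0 unfolding cs pcA_def q_def[symmetric] by (simp add: field_simps)
  have "q * (\<i> * pce a * pcf1 (- a)) = \<i> * pce a * (q * pcf1 (- a))" by simp
  also have "\<dots> = - (Gamma (a + 1/2) * (\<i> * pce a * (2 * sin \<alpha>)) * pcf1 a)"
    unfolding C(2) by simp
  finally have "q * (\<i> * pce a * pcf1 (- a)) = - (Gamma (a + 1/2) * (\<i> * pce a * (2 * sin \<alpha>)) * pcf1 a)" .
  then show "\<i> * pce a * pcf1 (- a) = pcA a * (1 - (pce a)\<^sup>2) * pcf1 a"
    using q0 unfolding cs pcA_def q_def[symmetric] by (simp add: field_simps)
qed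

lemma pcU_connection:
  assumes p: "a + 1/2 \<notin> \<int>\<^sub>\<le>\<^sub>0"
  shows "pce a * pcU (- a) (- \<i> * z) = pcA a * (pcU a (- z) + (pce a)\<^sup>2 * pcU a z)"
proof -
  note C = pcf_connection_exp[OF p]
  \<comment> \<open>The zero summand brings the left side into the shape of
    \<open>is_weber_sol_lincomb\<close>; the factor \<open>-1\<close> in the next fact likewise
    makes \<open>is_weber_sol_scale\<close> applicable.\<close>
  have l: "is_weber_sol a (\<lambda>z. pce a * pcU (- a) (- \<i> * z) + 0 * pcU a z) (\<lambda>z. pce a * (- \<i> * pcU' (- a) (- \<i> * z)) + 0 * pcU' a z)"
    by (intro is_weber_sol_lincomb is_weber_sol_scale[OF is_weber_sol_pcU] is_weber_sol_pcU) simp_all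
  have r: "is_weber_sol a (\<lambda>z. pcA a * pcU a (-1 * z) + (pcA a * (pce a)\<^sup>2) * pcU a z)
      (\<lambda>z. pcA a * (-1 * pcU' a (-1 * z)) + (pcA a * (pce a)\<^sup>2) * pcU' a z)"
    by (intro is_weber_sol_lincomb is_weber_sol_scale[OF is_weber_sol_pcU] is_weber_sol_pcU) simp_all
  have "pce a * (- \<i> * pcf1 (- a)) = - (\<i> * pce a * pcf1 (- a))" by simp
  then have "(\<lambda>z. pce a * pcU (- a) (- \<i> * z) + 0 * pcU a z) = (\<lambda>z. pcA a * pcU a (-1 * z) + (pcA a * (pce a)\<^sup>2) * pcU a z)"
    using C by (intro weber_sol_unique[OF l r, of 0]) (simp_all add: pcU_0 algebra_simps)
  from fun_cong[OF this, of z] show ?thesis by (simp add: algebra_simps)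
qed

section \<open>Joint continuity in parameter and argument\<close>

lemma continuous_on_pcc: "continuous_on S f \<Longrightarrow> continuous_on S (\<lambda>x. pcc (f x) n)"
proof (induction n rule: induct_nat_012)
  case (ge2 n)
  have "continuous_on S (\<lambda>x. (of_nat n + f x + 1/2) / ((of_nat n + 1) * (of_nat n + 2)) * pcc (f x) n)"
    by (intro continuous_intros ge2) (intro ballI, simp only: mult_eq_0_iff of_nat_add_neq_0 simp_thms)
  then show ?case by (simp add: pcc_def)
qed (simp_all add: pcc_def continuous_on_pcf)

text \<open>Weierstrass' test on a product of balls: \<open>norm_wco_le\<close> majorises the power
  series there by one convergent series, since \<open>pcf0\<close> and \<open>pcf1\<close> are
  bounded on compact sets.\<close>

lemma isCont_pcG: "isCont (\<lambda>x. pcG (fst x) (snd x)) (a, z)"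
proof -
  define r where "r = norm a + norm z + 1"
  have r1: "r \<ge> 1" by (simp add: r_def)
  define A where "A = cball (0::complex) r \<times> cball (0::complex) r"
  have cA: "compact A" unfolding A_def by (intro compact_Times compact_cball)
  have "compact ((\<lambda>x. norm (pcf0 (fst x)) + norm (pcf1 (fst x))) ` A)"
    by (intro compact_continuous_image cA continuous_intros continuous_on_pcf)
  then have "bounded ((\<lambda>x. norm (pcf0 (fst x)) + norm (pcf1 (fst x))) ` A)" by (rule compact_imp_bounded)
  then obtain B where "\<forall>y\<in>(\<lambda>x. norm (pcf0 (fst x)) + norm (pcf1 (fst x))) ` A. norm y \<le> B"
    unfolding bounded_iff by (elim exE)
  then have B: "norm (pcf0 (fst x)) + norm (pcf1 (fst x)) \<le> B" if "x \<in> A" for x using that by fastforce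
  have B0: "B \<ge> 0" using B[of "(0, 0)"] r1 by (simp add: A_def) (smt (verit) norm_ge_zero)
  have m: "norm (pcc (fst x) n * snd x ^ n) \<le> B * (((r + 2) * r) ^ n / fact (n div 2))" if x: "x \<in> A" for x n
  proof -
    have x': "norm (fst x) \<le> r" "norm (snd x) \<le> r" using x by (auto simp: A_def)
    have "norm (pcc (fst x) n) \<le> (norm (pcf0 (fst x)) + norm (pcf1 (fst x))) * (norm (fst x) + 2) ^ n / fact (n div 2)"
      unfolding pcc_def by (rule norm_wco_le)
    also have "\<dots> \<le> B * (r + 2) ^ n / fact (n div 2)"
      using B[OF x] x' B0 r1 by (intro divide_right_mono mult_mono power_mono) auto
    finally have "norm (pcc (fst x) n) * norm (snd x) ^ n \<le> (B * (r + 2) ^ n / fact (n div 2)) * r ^ n"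
      using x' B0 r1 by (intro mult_mono power_mono) auto
    then show ?thesis by (simp add: norm_mult norm_power power_mult_distrib)
  qed
  have "uniform_limit A (\<lambda>n x. \<Sum>i<n. pcc (fst x) i * snd x ^ i) (\<lambda>x. \<Sum>i. pcc (fst x) i * snd x ^ i) sequentially"
    by (rule Weierstrass_m_test, erule m) (intro summable_mult summable_power_fact_half)
  moreover have "continuous_on A (\<lambda>x. \<Sum>i<n. pcc (fst x) i * snd x ^ i)" for n
    by (intro continuous_intros continuous_on_pcc)
  ultimately have "continuous_on A (\<lambda>x. \<Sum>i. pcc (fst x) i * snd x ^ i)"
    by (intro uniform_limit_theorem[where F=sequentially and f="\<lambda>n x. \<Sum>i<n. pcc (fst x) i * snd x ^ i"]) auto
  also have "(\<lambda>x. \<Sum>i. pcc (fst x) i * snd x ^ i) = (\<lambda>x. pcG (fst x) (snd x))"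
    using pcG_sums sums_unique by metis
  finally have "continuous_on A (\<lambda>x. pcG (fst x) (snd x))" .
  moreover have "(a, z) \<in> interior A"
    unfolding A_def interior_Times by (auto simp: r_def interior_cball add_nonneg_pos add_pos_nonneg)
  ultimately show ?thesis using continuous_on_interior by blast
qed

lemma continuous_on_pcU [continuous_intros]:
  assumes "continuous_on S f" "continuous_on S g"
  shows "continuous_on S (\<lambda>x. pcU (f x) (g x))"
proof -
  have "continuous_on UNIV (\<lambda>x. pcG (fst x) (snd x))"
    by (rule continuous_at_imp_continuous_on) (use isCont_pcG in auto)
  then have "continuous_on S (\<lambda>x. (\<lambda>x. pcG (fst x) (snd x)) (f x, g x))"
    by (rule continuous_on_compose2) (auto intro!: continuous_intros assms)
  then show ?thesis unfolding pcU_eq by (auto intro!: continuous_intros assms)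
qed

section \<open>Moments\<close>

lemma integrable_exp_pcU: "integrable half_line (\<lambda>t. exp (r * t) * norm (pcU a (of_real t)))"
proof -
  obtain C where C: "\<And>t. t \<ge> 0 \<Longrightarrow> norm (pcU a (of_real t)) \<le> C * exp (- t\<^sup>2 / 8)" using pcU_bounded by blast
  have i: "integrable half_line (\<lambda>t. C * (t powr (1 - 1) * exp (r * t - 1/8 * t\<^sup>2)))"
    by (intro integrable_mult_right integrable_gaussian_powr) auto
  show ?thesis
  proof (rule integrable_half_line_bound[OF i])
    fix t :: real assume t: "t > 0"
    have "norm (exp (r * t) * norm (pcU a (of_real t))) = exp (r * t) * norm (pcU a (of_real t))" by simp
    also have "\<dots> \<le> exp (r * t) * (C * exp (- t\<^sup>2 / 8))" using C t by (intro mult_left_mono) auto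
    also have "\<dots> = C * (t powr (1 - 1) * exp (r * t - 1/8 * t\<^sup>2))"
      using t by (simp flip: exp_add)
    finally show "norm (exp (r * t) * norm (pcU a (of_real t))) \<le> C * (t powr (1 - 1) * exp (r * t - 1/8 * t\<^sup>2))" .
  qed (intro continuous_intros)
qed

lemma integrable_power_pcU: "integrable half_line (\<lambda>t. of_real t ^ n * pcU a (of_real t))"
proof (rule integrable_half_line_bound[OF integrable_mult_right[OF integrable_exp_pcU[of 1 a], of "fact n"]])
  fix t :: real assume t: "t > 0"
  have "norm (of_real t ^ n * pcU a (of_real t)) = t ^ n * norm (pcU a (of_real t))"
    using t by (simp add: norm_mult norm_power)
  also have "\<dots> \<le> (fact n * exp t) * norm (pcU a (of_real t))"
    using t by (intro mult_right_mono power_le_fact_exp) auto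
  finally show "norm (of_real t ^ n * pcU a (of_real t)) \<le> fact n * (exp (1 * t) * norm (pcU a (of_real t)))" by simp
qed (intro continuous_intros)

definition pcM :: "complex \<Rightarrow> nat \<Rightarrow> complex" where
  "pcM a n = (\<integral>t. of_real t ^ n * pcU a (of_real t) \<partial>half_line)"

text \<open>Links Lebesgue integrals over the half line with limits of finite integrals, the form in
  which \<open>integral_to_inf\<close> and the fundamental theorem deliver them.\<close>

lemma tendsto_integral_half_line:
  fixes f :: "real \<Rightarrow> complex"
  assumes int: "integrable half_line f"
  shows "((\<lambda>X. integral {0..X} f) \<longlongrightarrow> (\<integral>t. f t \<partial>half_line)) at_top"
proof -
  have meas: "(\<lambda>t. indicator {..X} t *\<^sub>R f t) \<in> borel_measurable half_line" for X :: real
    using int by (intro borel_measurable_scaleR borel_measurable_indicator' borel_measurable_integrable)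
       (auto simp: sets_restrict_space)
  have "((\<lambda>X. \<integral>t. indicator {..X} t *\<^sub>R f t \<partial>half_line) \<longlongrightarrow> (\<integral>t. f t \<partial>half_line)) at_top"
  proof (rule integral_dominated_convergence_at_top[where w="\<lambda>t. norm (f t)"])
    show "AE t in half_line. ((\<lambda>X. indicator {..X} t *\<^sub>R f t) \<longlongrightarrow> f t) at_top"
    proof (rule AE_I2)
      fix t :: real
      have "eventually (\<lambda>X. f t = indicator {..X} t *\<^sub>R f t) at_top"
        using eventually_ge_at_top[of t] by eventually_elim simp
      then show "((\<lambda>X. indicator {..X} t *\<^sub>R f t) \<longlongrightarrow> f t) at_top" by (rule Lim_transform_eventually[rotated]) simp
    qed
  qed (use int meas in \<open>auto intro!: always_eventually AE_I2 simp: indicator_def\<close>)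
  moreover have "eventually (\<lambda>X. (\<integral>t. indicator {..X} t *\<^sub>R f t \<partial>half_line) = integral {0..X} f) at_top"
    using eventually_ge_at_top[of 0]
  proof eventually_elim
    case (elim X)
    have "integrable half_line (\<lambda>t. indicator {..X} t *\<^sub>R f t)"
      by (rule Bochner_Integration.integrable_bound[OF int meas]) (auto simp: indicator_def)
    then have "(\<integral>t. indicator {..X} t *\<^sub>R f t \<partial>half_line) = integral {0<..} (\<lambda>t. indicator {..X} t *\<^sub>R f t)"
      by (rule lebesgue_integral_eq_integral) auto
    also have "\<dots> = integral {0<..} (\<lambda>t. if t \<in> {..X} then f t else 0)"
      by (intro arg_cong[of _ _ "integral {0<..}"]) (auto simp: indicator_def)
    also have "\<dots> = integral ({0<..} \<inter> {..X}) f" by (simp only: Henstock_Kurzweil_Integration.integral_restrict_Int Int_commute)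
    also have "\<dots> = integral {0..X} f"
      by (rule integral_spike_set; rule negligible_subset[of "{0}"]) auto
    finally show ?case .
  qed
  ultimately show ?thesis
    by (rule Lim_transform_eventually)
qed

lemma half_line_FTC:
  fixes F f :: "real \<Rightarrow> complex"
  assumes der: "\<And>t. t \<ge> 0 \<Longrightarrow> (F has_vector_derivative f t) (at t)"
    and int: "integrable half_line f"
  shows "(F \<longlongrightarrow> F 0 + (\<integral>t. f t \<partial>half_line)) at_top"
proof -
  have I: "integral {0..X} f = F X - F 0" if "X \<ge> 0" for X
    using that der by (intro integral_unique fundamental_theorem_of_calculus) (auto intro: has_vector_derivative_at_within)
  have "eventually (\<lambda>X. F 0 + integral {0..X} f = F X) at_top"
    using eventually_ge_at_top[of 0] by eventually_elim (simp add: I)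
  then show ?thesis
    by (rule Lim_transform_eventually[rotated]) (intro tendsto_intros tendsto_integral_half_line[OF int])
qed

lemma pcU_power_tendsto_0: "((\<lambda>t. of_real t ^ n * pcU a (of_real t)) \<longlongrightarrow> 0) at_top"
  "((\<lambda>t. of_real t ^ n * pcU' a (of_real t)) \<longlongrightarrow> 0) at_top"
proof -
  obtain C where C: "\<And>t. t \<ge> 0 \<Longrightarrow> norm (pcU a (of_real t)) \<le> C * exp (- t\<^sup>2 / 8)" using pcU_bounded by blast
  obtain D where D: "\<And>t. t \<ge> 0 \<Longrightarrow> norm (pcU' a (of_real t)) \<le> D * ((1 + t) * exp (- t\<^sup>2 / 8))" using pcU'_bounded by blast
  have l: "((\<lambda>t. t ^ n * (C * exp (- t\<^sup>2 / 8))) \<longlongrightarrow> 0) at_top" "((\<lambda>t. t ^ n * (D * ((1 + t) * exp (- t\<^sup>2 / 8)))) \<longlongrightarrow> 0) at_top"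
    by real_asymp+
  show "((\<lambda>t. of_real t ^ n * pcU a (of_real t)) \<longlongrightarrow> 0) at_top"
  proof (rule Lim_null_comparison[OF _ l(1)])
    show "eventually (\<lambda>t. norm (of_real t ^ n * pcU a (of_real t)) \<le> t ^ n * (C * exp (- t\<^sup>2 / 8))) at_top"
      using eventually_ge_at_top[of "0::real"]
      by eventually_elim (use C in \<open>auto simp: norm_mult norm_power intro!: mult_left_mono\<close>)
  qed
  show "((\<lambda>t. of_real t ^ n * pcU' a (of_real t)) \<longlongrightarrow> 0) at_top"
  proof (rule Lim_null_comparison[OF _ l(2)])
    show "eventually (\<lambda>t. norm (of_real t ^ n * pcU' a (of_real t)) \<le> t ^ n * (D * ((1 + t) * exp (- t\<^sup>2 / 8)))) at_top"
      using eventually_ge_at_top[of "0::real"]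
      by eventually_elim (use D in \<open>auto simp: norm_mult norm_power intro!: mult_left_mono\<close>)
  qed
qed

text \<open>Two integrations by parts in the integral of t^n U'', where U'' is replaced by (t^2/4 +
  a) U. Only n = 0 and n = 1 leave a boundary term at 0.\<close>

lemma pcM_rec:
  "pcM a (n + 2) + 4 * a * pcM a n = (if n = 0 then - 4 * pcf1 a else if n = 1 then 4 * pcf0 a else 4 * of_nat n * of_nat (n - 1) * pcM a (n - 2))"
proof -
  \<comment> \<open>The terms with U' and t^(n - 1) cancel in the derivative of \<open>G\<close>.
    Truncated subtraction in the exponents is harmless, because the coefficients \<open>n\<close>
    and \<open>n * (n - 1)\<close> vanish where it takes effect.\<close>
  define G where "G = (\<lambda>z. z ^ n * pcU' a z - of_nat n * z ^ (n - 1) * pcU a z)"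
  define g where "g = (\<lambda>z. z ^ n * ((z\<^sup>2 / 4 + a) * pcU a z) - of_nat n * of_nat (n - 1) * z ^ (n - 2) * pcU a z)"
  have dU': "(pcU' a has_field_derivative (z\<^sup>2 / 4 + a) * pcU a z) (at z)" for z
    using is_weber_sol_pcU[of a] unfolding is_weber_sol_def by blast
  have "(G has_field_derivative g z) (at z)" for z
  proof -
    have "n - Suc (Suc 0) = n - 2" by simp
    then show ?thesis unfolding G_def g_def
      by (auto intro!: derivative_eq_intros dU' pcU_has_deriv simp: algebra_simps)
  qed
  then have der: "((\<lambda>t. G (of_real t)) has_vector_derivative g (of_real t)) (at t)" for t :: real
    by (rule has_vector_derivative_real_field)
  have geq: "g (of_real t) = 1/4 * (of_real t ^ (n + 2) * pcU a (of_real t)) + a * (of_real t ^ n * pcU a (of_real t)) - of_nat n * of_nat (n - 1) * (of_real t ^ (n - 2) * pcU a (of_real t))" for t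
    by (simp add: g_def algebra_simps power_add power2_eq_square)
  have I: "integrable half_line (\<lambda>t. g (of_real t))" and Ig: "(\<integral>t. g (of_real t) \<partial>half_line) = 1/4 * pcM a (n + 2) + a * pcM a n - of_nat n * of_nat (n - 1) * pcM a (n - 2)"
    unfolding geq pcM_def
    by (intro Bochner_Integration.integrable_add Bochner_Integration.integrable_diff integrable_mult_right integrable_power_pcU)
       (simp add: Bochner_Integration.integral_add Bochner_Integration.integral_diff integrable_power_pcU del: power_add power_Suc)
  have lim: "((\<lambda>t. G (of_real t)) \<longlongrightarrow> 0 - of_nat n * 0) at_top"
    unfolding G_def mult.assoc by (intro tendsto_intros pcU_power_tendsto_0)
  have "0 - of_nat n * 0 = G (of_real 0) + (\<integral>t. g (of_real t) \<partial>half_line)"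
    using tendsto_unique[OF _ lim half_line_FTC[OF der I]] by simp
  then have "(\<integral>t. g (of_real t) \<partial>half_line) = - G 0" by (simp add: eq_neg_iff_add_eq_0 add.commute)
  then have "1/4 * pcM a (n + 2) + a * pcM a n - of_nat n * of_nat (n - 1) * pcM a (n - 2) = - G 0" unfolding Ig by simp
  moreover have "pcM a (n + 2) + 4 * a * pcM a n = 4 * (1/4 * pcM a (n + 2) + a * pcM a n - of_nat n * of_nat (n - 1) * pcM a (n - 2)) + 4 * (of_nat n * of_nat (n - 1) * pcM a (n - 2))"
    by (simp add: algebra_simps)
  ultimately have "pcM a (n + 2) + 4 * a * pcM a n = 4 * (- G 0) + 4 * (of_nat n * of_nat (n - 1) * pcM a (n - 2))"
    by (simp only:)
  moreover have "G 0 = (if n = 0 then pcf1 a else if n = 1 then - pcf0 a else 0)"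
    by (auto simp: G_def pcU_0 power_0_left)
  ultimately show ?thesis by (cases "n = 0 \<or> n = 1") auto
qed

text \<open>Dominated convergence along sequences of parameters, with the majorant from
  \<open>pcU_locally_bounded\<close>; the index shift by \<open>N\<close> puts all terms into the
  ball where it is valid.\<close>

lemma isCont_pcM: "isCont (\<lambda>a. pcM a n) a"
proof (unfold continuous_at_sequentially, intro allI impI)
  fix X :: "nat \<Rightarrow> complex" assume X: "X \<longlonglongrightarrow> a"
  obtain C r where r: "r > 0" and C: "\<And>b t. b \<in> ball a r \<Longrightarrow> t \<ge> 0 \<Longrightarrow> norm (pcU b (of_real t)) \<le> C * exp (- t\<^sup>2 / 8)"
    using pcU_locally_bounded by blast
  obtain N where N: "\<And>m. m \<ge> N \<Longrightarrow> X m \<in> ball a r"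
    using X r unfolding lim_sequentially by (auto simp: dist_commute)
  have w: "integrable half_line (\<lambda>t. (fact n * C) * (t powr (1 - 1) * exp (1 * t - 1/8 * t\<^sup>2)))"
    by (intro integrable_mult_right integrable_gaussian_powr) auto
  have "(\<lambda>m. \<integral>t. of_real t ^ n * pcU (X (m + N)) (of_real t) \<partial>half_line) \<longlonglongrightarrow> (\<integral>t. of_real t ^ n * pcU a (of_real t) \<partial>half_line)"
  proof (rule integral_dominated_convergence[OF _ _ w])
    show "AE t in half_line. (\<lambda>m. of_real t ^ n * pcU (X (m + N)) (of_real t)) \<longlonglongrightarrow> of_real t ^ n * pcU a (of_real t)"
    proof (intro AE_I2 tendsto_mult tendsto_const)
      fix t
      have "continuous_on UNIV (\<lambda>b. pcU b (of_real t))" by (intro continuous_intros)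
      then have "isCont (\<lambda>b. pcU b (of_real t)) a" by (simp add: continuous_on_eq_continuous_at)
      then show "(\<lambda>m. pcU (X (m + N)) (of_real t)) \<longlonglongrightarrow> pcU a (of_real t)"
        using LIMSEQ_ignore_initial_segment[OF X, of N] isCont_tendsto_compose by blast
    qed
    show "AE t in half_line. norm (of_real t ^ n * pcU (X (m + N)) (of_real t)) \<le> (fact n * C) * (t powr (1 - 1) * exp (1 * t - 1/8 * t\<^sup>2))" for m
    proof (rule AE_I2)
      fix t assume "t \<in> space half_line"
      then have t: "t > 0" by simp
      have "norm (of_real t ^ n * pcU (X (m + N)) (of_real t)) = t ^ n * norm (pcU (X (m + N)) (of_real t))"
        using t by (simp add: norm_mult norm_power)
      also have "\<dots> \<le> (fact n * exp t) * (C * exp (- t\<^sup>2 / 8))"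
        using t by (intro mult_mono power_le_fact_exp C N) auto
      also have "\<dots> = (fact n * C) * (t powr (1 - 1) * exp (1 * t - 1/8 * t\<^sup>2))"
      proof -
        have "exp (1 * t - 1/8 * t\<^sup>2) = exp t * exp (- t\<^sup>2 / 8)" by (simp flip: exp_add)
        then show ?thesis using t by simp
      qed
      finally show "norm (of_real t ^ n * pcU (X (m + N)) (of_real t)) \<le> (fact n * C) * (t powr (1 - 1) * exp (1 * t - 1/8 * t\<^sup>2))" .
    qed
  qed (auto intro!: borel_measurable_half_line continuous_intros)
  then have "(\<lambda>m. pcM (X (m + N)) n) \<longlonglongrightarrow> pcM a n" by (simp add: pcM_def)
  then show "((\<lambda>a. pcM a n) \<circ> X) \<longlonglongrightarrow> pcM a n" unfolding o_def by (rule LIMSEQ_offset)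
qed

section \<open>The Laplace transform of the parabolic cylinder function\<close>

definition pcP :: "complex \<Rightarrow> complex \<Rightarrow> complex" where
  "pcP a x = (\<integral>t. exp (x * of_real t) * pcU a (of_real t) \<partial>half_line)"

lemma pcP_sums: "(\<lambda>n. x ^ n / fact n * pcM a n) sums pcP a x"
  unfolding pcM_def pcP_def by (rule exp_moment_sums[OF _ integrable_exp_pcU[of "norm x"]]) (auto intro!: continuous_intros)

lemma pcP_bounded: "\<exists>C. \<forall>x. Re x \<le> 0 \<longrightarrow> norm (pcP a x) \<le> C"
proof (intro exI allI impI)
  fix x :: complex assume x: "Re x \<le> 0"
  have i: "integrable half_line (\<lambda>t. norm (pcU a (of_real t)))" using integrable_exp_pcU[of 0 a] by simp
  have le: "norm (exp (x * of_real t) * pcU a (of_real t)) \<le> norm (pcU a (of_real t))" if "t > 0" for t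
  proof -
    have "norm (exp (x * of_real t)) \<le> 1" using x that by (simp add: mult_nonpos_nonneg)
    then show ?thesis using mult_right_mono[of "norm (exp (x * of_real t))" 1 "norm (pcU a (of_real t))"] by (simp add: norm_mult)
  qed
  have "integrable half_line (\<lambda>t. exp (x * of_real t) * pcU a (of_real t))"
    by (rule integrable_half_line_bound[OF i _ le]) (intro continuous_intros)
  then show "norm (pcP a x) \<le> (\<integral>t. norm (pcU a (of_real t)) \<partial>half_line)"
    unfolding pcP_def by (rule Bochner_Integration.integral_norm_bound_integral[OF _ i]) (use le in auto)
qed

lemma gaussian_line:
  "integrable lborel (\<lambda>s::real. exp (- s\<^sup>2 / 8))" "integrable lborel (\<lambda>s::real. exp (- s\<^sup>2 / 4))"
  "(\<integral>s. exp (- s\<^sup>2 / 4) \<partial>lborel) = 2 * sqrt pi"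
proof -
  have e: "exp (- s\<^sup>2 / 8) = sqrt (8 * pi) * normal_density 0 2 s" "exp (- s\<^sup>2 / 4) = sqrt (4 * pi) * normal_density 0 (sqrt 2) s" for s :: real
    by (simp_all add: normal_density_def)
  show "integrable lborel (\<lambda>s::real. exp (- s\<^sup>2 / 8))" "integrable lborel (\<lambda>s::real. exp (- s\<^sup>2 / 4))"
    unfolding e by (intro integrable_mult_right integrable_normal_density; simp)+
  show "(\<integral>s. exp (- s\<^sup>2 / 4) \<partial>lborel) = 2 * sqrt pi"
    unfolding e integral_mult_right_zero by (subst integral_normal_density) (simp_all add: real_sqrt_mult)
qed

lemma powr_le_abs_powr:
  fixes r y \<sigma> :: real
  assumes "r > 0" "r \<le> y" "1 / r \<le> y"
  shows "r powr \<sigma> \<le> y powr \<bar>\<sigma>\<bar>"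
proof (cases "\<sigma> \<ge> 0")
  case True
  then show ?thesis using assms by (simp add: powr_mono2)
next
  case False
  have "r powr \<sigma> = (1 / r) powr (- \<sigma>)" using assms by (simp add: powr_minus_divide powr_divide)
  also have "\<dots> \<le> y powr (- \<sigma>)" using False assms by (intro powr_mono2) auto
  finally show ?thesis using False by simp
qed

text \<open>\<open>max 1 t\<close> joins the asymptotic bound for large t with compactness near 0,
  where a power of t could be singular or vanish.\<close>

lemma pcG_real_bound:
  "\<exists>K. \<forall>t>0. norm (pcG a (of_real t)) \<le> K * max 1 t powr (- Re (a + 1/2))"
proof -
  define \<sigma> where "\<sigma> = Re (a + 1/2)"
  have "\<exists>C. \<forall>z. norm z \<ge> 1 \<longrightarrow> \<bar>Arg z\<bar> \<le> 3 / 4 * pi - pi / 2 \<longrightarrow> pc_err a z \<le> C / (norm z)\<^sup>2"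
    using pc_asymp[of a] pi_half_gt_zero unfolding pc_asymp_def by blast
  then obtain C where C: "\<And>z. norm z \<ge> 1 \<Longrightarrow> \<bar>Arg z\<bar> \<le> 3 / 4 * pi - pi / 2 \<Longrightarrow> pc_err a z \<le> C / (norm z)\<^sup>2"
    by blast
  have b1: "norm (pcG a (of_real t)) \<le> (1 + \<bar>C\<bar>) * t powr (- \<sigma>)" if t: "t \<ge> 1" for t
  proof -
    have "norm (pcG a (of_real t) * of_real t powr (a + 1/2) - 1) \<le> C / t\<^sup>2"
      using C[of "of_real t"] t pi_gt_zero by simp
    also have "\<dots> \<le> \<bar>C\<bar> / 1" using t by (intro frac_le) auto
    finally have "norm (pcG a (of_real t) * of_real t powr (a + 1/2)) \<le> 1 + \<bar>C\<bar>"
      using norm_triangle_ineq2[of "pcG a (of_real t) * of_real t powr (a + 1/2)" 1] by simp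
    moreover have "norm (of_real t powr (a + 1/2)) = t powr \<sigma>"
      using t norm_powr_of_real[of t "a + 1/2"] by (simp add: \<sigma>_def)
    ultimately have "norm (pcG a (of_real t)) * t powr \<sigma> \<le> 1 + \<bar>C\<bar>" by (simp add: norm_mult)
    then show ?thesis using t by (simp add: powr_minus field_simps)
  qed
  have "continuous_on {0..1} (\<lambda>t. pcG a (complex_of_real t))"
    unfolding pcG_def by (intro continuous_intros) auto
  then have "bounded ((\<lambda>t. pcG a (complex_of_real t)) ` {0..1})"
    by (intro compact_imp_bounded compact_continuous_image) auto
  then obtain B where B: "\<forall>y\<in>(\<lambda>t. pcG a (complex_of_real t)) ` {0..1}. norm y \<le> B"
    unfolding bounded_iff by (elim exE)
  have "norm (pcG a (of_real t)) \<le> max (1 + \<bar>C\<bar>) B * max 1 t powr (- \<sigma>)" if "t > 0" for t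
  proof (cases "t \<ge> 1")
    case True
    have "norm (pcG a (of_real t)) \<le> (1 + \<bar>C\<bar>) * t powr (- \<sigma>)" by (rule b1[OF True])
    also have "\<dots> \<le> max (1 + \<bar>C\<bar>) B * t powr (- \<sigma>)" by (intro mult_right_mono) auto
    finally show ?thesis using True by (simp add: max_def)
  next
    case False
    then have "norm (pcG a (of_real t)) \<le> B" using B that by auto
    then show ?thesis using False by (simp add: max_def)
  qed
  then show ?thesis unfolding \<sigma>_def by blast
qed

lemma integral_half_line_shift:
  fixes f :: "real \<Rightarrow> complex"
  assumes f: "continuous_on UNIV f"
  shows "(\<integral>t. f t \<partial>half_line) = (\<integral>s. indicator {0<..} (u + s) *\<^sub>R f (u + s) \<partial>lborel)"
proof -
  have m: "(\<lambda>t. indicator {0<..} t *\<^sub>R f t) \<in> borel_measurable borel"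
    using borel_measurable_continuous_onI[OF f] by measurable
  have "(\<integral>t. f t \<partial>half_line) = (\<integral>t. indicator {0<..} t *\<^sub>R f t \<partial>lebesgue)"
    by (rule integral_restrict_space) auto
  also have "\<dots> = (\<integral>t. indicator {0<..} t *\<^sub>R f t \<partial>lborel)"
    by (rule integral_completion) (use m in simp)
  also have "\<dots> = (\<integral>s. indicator {0<..} (u + s) *\<^sub>R f (u + s) \<partial>lborel)"
    using lborel_integral_real_affine[of 1 "\<lambda>t. indicator {0<..} t *\<^sub>R f t" u] by simp
  finally show ?thesis .
qed

text \<open>Laplace's method. The exponent x t - t^2/4 peaks at t = 2 x with value x^2, and t = 2 x
  + s turns it into x^2 - s^2/4. After normalisation the algebraic factor tends to 1 for fixed s, so
  the limit is the Gaussian integral 2 sqrt(pi).\<close>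

lemma pcP_asymp:
  "((\<lambda>x. of_real (2 * x) powr (a + 1/2) * of_real (exp (- x\<^sup>2)) * pcP a (of_real x)) \<longlongrightarrow> of_real (2 * sqrt pi)) at_top"
proof -
  define p where "p = a + 1/2"
  define h where "h = (\<lambda>x s. if 0 < 2 * x + s then of_real (exp (- s\<^sup>2 / 4)) * (of_real (2 * x) powr p * pcG a (of_real (2 * x + s))) else 0 :: complex)"
  obtain K where K: "\<And>t. t > 0 \<Longrightarrow> norm (pcG a (of_real t)) \<le> K * max 1 t powr (- Re p)"
    using pcG_real_bound unfolding p_def by blast
  have K0: "K \<ge> 0" using order_trans[OF norm_ge_zero K[of 1]] by simp
  define m where "m = nat \<lceil>\<bar>Re p\<bar>\<rceil>"
  obtain D where D: "\<And>t. t \<ge> 0 \<Longrightarrow> (1 + t) ^ m * exp (- t\<^sup>2 / 8) \<le> (D :: real)" using power_exp_bounded by blast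
  have eq: "of_real (2 * x) powr p * of_real (exp (- x\<^sup>2)) * pcP a (of_real x) = (\<integral>s. h x s \<partial>lborel)" for x
  proof -
    have "pcP a (of_real x) = (\<integral>s. indicator {0<..} (2 * x + s) *\<^sub>R (exp (of_real x * of_real (2 * x + s)) * pcU a (of_real (2 * x + s))) \<partial>lborel)"
      unfolding pcP_def by (rule integral_half_line_shift) (intro continuous_intros)
    then have "of_real (2 * x) powr p * of_real (exp (- x\<^sup>2)) * pcP a (of_real x) =
       (\<integral>s. of_real (2 * x) powr p * of_real (exp (- x\<^sup>2)) * (indicator {0<..} (2 * x + s) *\<^sub>R (exp (of_real x * of_real (2 * x + s)) * pcU a (of_real (2 * x + s)))) \<partial>lborel)"
      by (simp only: integral_mult_right_zero)
    also have "\<dots> = (\<integral>s. h x s \<partial>lborel)"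
    proof (rule Bochner_Integration.integral_cong[OF refl])
      fix s :: real
      have "complex_of_real (exp (- x\<^sup>2)) * exp (of_real x * of_real (2 * x + s)) * exp (- (complex_of_real (2 * x + s))\<^sup>2 / 4) = of_real (exp (- x\<^sup>2) * exp (x * (2 * x + s)) * exp (- (2 * x + s)\<^sup>2 / 4))"
        by (simp only: of_real_mult exp_of_real[symmetric] of_real_divide of_real_minus of_real_power of_real_numeral)
      also have "exp (- x\<^sup>2) * exp (x * (2 * x + s)) * exp (- (2 * x + s)\<^sup>2 / 4) = exp (- s\<^sup>2 / 4)"
        unfolding exp_add[symmetric] by (rule arg_cong[of _ _ exp]) (simp add: power2_eq_square field_simps)
      finally have E: "complex_of_real (exp (- x\<^sup>2)) * exp (of_real x * of_real (2 * x + s)) * exp (- (complex_of_real (2 * x + s))\<^sup>2 / 4) = of_real (exp (- s\<^sup>2 / 4))" .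
      show "of_real (2 * x) powr p * of_real (exp (- x\<^sup>2)) * (indicator {0<..} (2 * x + s) *\<^sub>R (exp (of_real x * of_real (2 * x + s)) * pcU a (of_real (2 * x + s)))) = h x s"
        unfolding h_def pcU_eq E[symmetric] by (simp add: indicator_def)
    qed
    finally show ?thesis .
  qed
  have cG: "continuous_on UNIV (\<lambda>s. pcG a (of_real (2 * x + s)))" for x
    unfolding pcG_def by (intro continuous_intros) auto
  have meas: "h x \<in> borel_measurable lborel" for x
  proof -
    have "(\<lambda>s. of_real (exp (- s\<^sup>2 / 4)) * (of_real (2 * x) powr p * pcG a (of_real (2 * x + s)))) \<in> borel_measurable borel"
      by (intro borel_measurable_continuous_onI continuous_intros cG) auto
    then show ?thesis unfolding h_def by measurable
  qed
  have lim: "((\<lambda>x. h x s) \<longlongrightarrow> of_real (exp (- s\<^sup>2 / 4))) at_top" for s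
  proof -
    have l1: "filterlim (\<lambda>x. 2 * x + s) at_top at_top" by real_asymp
    have l2: "((\<lambda>x. 2 * x / (2 * x + s)) \<longlongrightarrow> 1) at_top" by real_asymp
    have l3: "((\<lambda>x. complex_of_real (2 * x / (2 * x + s)) powr p) \<longlongrightarrow> of_real 1 powr p) at_top"
      by (intro tendsto_powr_complex tendsto_of_real l2 tendsto_const) auto
    have "((\<lambda>x. of_real (exp (- s\<^sup>2 / 4)) * (complex_of_real (2 * x / (2 * x + s)) powr p * (pcG a (of_real (2 * x + s)) * of_real (2 * x + s) powr (a + 1/2)))) \<longlongrightarrow> of_real (exp (- s\<^sup>2 / 4)) * (of_real 1 powr p * 1)) at_top"
      by (intro tendsto_mult tendsto_const l3 filterlim_compose[OF pcG_real_tendsto l1])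
    moreover have "eventually (\<lambda>x. of_real (exp (- s\<^sup>2 / 4)) * (complex_of_real (2 * x / (2 * x + s)) powr p * (pcG a (of_real (2 * x + s)) * of_real (2 * x + s) powr (a + 1/2))) = h x s) at_top"
      using eventually_gt_at_top[of 0] filterlim_at_top_dense[THEN iffD1, rule_format, OF l1, of 0]
    proof eventually_elim
      case (elim x)
      have "2 * x = 2 * x / (2 * x + s) * (2 * x + s)" using elim by simp
      then have "complex_of_real (2 * x) = of_real (2 * x / (2 * x + s)) * of_real (2 * x + s)" by (metis of_real_mult)
      moreover have "(complex_of_real (2 * x / (2 * x + s)) * of_real (2 * x + s)) powr p = of_real (2 * x / (2 * x + s)) powr p * of_real (2 * x + s) powr p"
        using elim by (intro powr_times_real_left) (auto simp del: of_real_divide)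
      ultimately have "complex_of_real (2 * x) powr p = of_real (2 * x / (2 * x + s)) powr p * of_real (2 * x + s) powr p"
        by (simp only:)
      then show ?case using elim unfolding h_def p_def by simp
    qed
    ultimately have "((\<lambda>x. h x s) \<longlongrightarrow> of_real (exp (- s\<^sup>2 / 4)) * (of_real 1 powr p * 1)) at_top"
      by (rule Lim_transform_eventually)
    then show ?thesis by simp
  qed
  \<comment> \<open>Both 2 x / max 1 t and its reciprocal are at most 1 + |s|, so the algebraic
    factor is bounded by a power of 1 + |s| whatever the sign of \<open>Re p\<close>. Half of the
    Gaussian then absorbs this power, giving a majorant independent of x.\<close>
  have bd: "norm (h x s) \<le> K * D * exp (- s\<^sup>2 / 8)" if x: "x \<ge> 1/2" for x s
  proof (cases "0 < 2 * x + s")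
    case True
    define t where "t = 2 * x + s"
    define y where "y = 1 + \<bar>s\<bar>"
    define r where "r = 2 * x / max 1 t"
    have t: "t > 0" using True by (simp add: t_def)
    have r: "r > 0" using x by (simp add: r_def)
    have "norm (of_real (2 * x) powr p * pcG a (of_real t)) \<le> (2 * x) powr Re p * (K * max 1 t powr (- Re p))"
      unfolding norm_mult using x K[OF t] norm_powr_of_real[of "2 * x" p] by (intro mult_mono) auto
    also have "\<dots> = K * r powr Re p" using x by (simp add: r_def powr_divide powr_minus_divide)
    also have "r powr Re p \<le> y powr \<bar>Re p\<bar>"
    proof (rule powr_le_abs_powr[OF r])
      have m0: "max 1 t > 0" by simp
      have "2 * x \<le> y * max 1 t"
      proof (cases "t \<ge> 1")
        case True
        have "2 * x = t - s" by (simp add: t_def)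
        also have "\<dots> \<le> t + \<bar>s\<bar> * t" using mult_left_mono[OF True abs_ge_zero[of s]] by linarith
        finally show ?thesis using True by (simp add: y_def algebra_simps max_def)
      next
        case False
        then show ?thesis by (simp add: y_def t_def max_def)
      qed
      then show "r \<le> y" unfolding r_def using m0 by (simp add: divide_le_eq)
      have "max 1 t \<le> y * (2 * x)"
      proof -
        have "t \<le> 2 * x + \<bar>s\<bar>" by (simp add: t_def)
        also have "\<dots> \<le> 2 * x + \<bar>s\<bar> * (2 * x)" using x mult_left_mono[of 1 "2 * x" "\<bar>s\<bar>"] by simp
        finally have "t \<le> y * (2 * x)" by (simp add: y_def algebra_simps)
        moreover have "1 * 1 \<le> y * (2 * x)" using x by (intro mult_mono) (auto simp: y_def)
        ultimately show ?thesis by simp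
      qed
      then show "1 / r \<le> y" unfolding r_def using m0 x by (simp add: divide_le_eq)
    qed
    also have "y powr \<bar>Re p\<bar> \<le> y powr real m"
      by (intro powr_mono) (auto simp: y_def m_def)
    also have "y powr real m = y ^ m" by (rule powr_realpow) (simp add: y_def add_pos_nonneg)
    finally have b: "norm (of_real (2 * x) powr p * pcG a (of_real t)) \<le> K * y ^ m"
      using K0 by (simp add: mult_left_mono)
    have e2: "exp (- s\<^sup>2 / 4) = exp (- s\<^sup>2 / 8) * exp (- s\<^sup>2 / 8)" by (simp flip: exp_add)
    have "norm (h x s) = exp (- s\<^sup>2 / 4) * norm (of_real (2 * x) powr p * pcG a (of_real t))"
      using True unfolding h_def t_def[symmetric] by (simp add: norm_mult)
    also have "\<dots> \<le> exp (- s\<^sup>2 / 4) * (K * y ^ m)" by (intro mult_left_mono b) auto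
    also have "\<dots> = K * (y ^ m * exp (- \<bar>s\<bar>\<^sup>2 / 8)) * exp (- s\<^sup>2 / 8)" unfolding e2 by simp
    also have "\<dots> \<le> K * D * exp (- s\<^sup>2 / 8)"
      using D[of "\<bar>s\<bar>"] K0 unfolding y_def by (intro mult_right_mono mult_left_mono) auto
    finally show ?thesis .
  next
    case False
    have "D \<ge> 0" using D[of 0] by simp
    then show ?thesis using False K0 by (simp add: h_def)
  qed
  have "((\<lambda>x. \<integral>s. h x s \<partial>lborel) \<longlongrightarrow> (\<integral>s. complex_of_real (exp (- s\<^sup>2 / 4)) \<partial>lborel)) at_top"
  proof (rule integral_dominated_convergence_at_top[where w="\<lambda>s. K * D * exp (- s\<^sup>2 / 8)"])
    show "eventually (\<lambda>x. AE s in lborel. norm (h x s) \<le> K * D * exp (- s\<^sup>2 / 8)) at_top"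
      using eventually_ge_at_top[of "1/2"] by eventually_elim (use bd in auto)
    show "AE s in lborel. ((\<lambda>x. h x s) \<longlongrightarrow> of_real (exp (- s\<^sup>2 / 4))) at_top" using lim by auto
    show "integrable lborel (\<lambda>s. K * D * exp (- s\<^sup>2 / 8))" by (intro integrable_mult_right gaussian_line)
  qed (use meas in \<open>auto intro!: borel_measurable_continuous_onI continuous_intros\<close>)
  also have "(\<integral>s. complex_of_real (exp (- s\<^sup>2 / 4)) \<partial>lborel) = of_real (2 * sqrt pi)"
    using gaussian_line(2,3) by (subst integral_of_real) auto
  finally show ?thesis unfolding eq[symmetric] by (simp add: p_def)
qed

section \<open>The connection coefficients\<close>

text \<open>The coefficient of U(a,z) that remains in the difference of the two particular solutions
  once U(-a,-iz) is eliminated by the connection formula. It does not depend on z (see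
  \<open>rawU02_eq\<close>), and this is its expression at z = 0.\<close>

definition lamM :: "complex \<Rightarrow> nat \<Rightarrow> complex" where
  "lamM a n = - (pcA a * ((-1) ^ n - (pce a)\<^sup>2) * pcM a n) - pce a * \<i> ^ (n + 1) * pcM (- a) n"

text \<open>The moment recurrences for a and -a combine because
  \<open>\<i> ^ (n + 3) = - \<i> ^ (n + 1)\<close> compensates the change of sign of the parameter.
  The boundary terms cancel by \<open>pcf_connection_exp\<close>: the derivatives for n = 0, the
  values for n = 1.\<close>

lemma lamM_rec:
  assumes p: "a + 1/2 \<notin> \<int>\<^sub>\<le>\<^sub>0"
  shows "lamM a (n + 2) + 4 * a * lamM a n = (if n < 2 then 0 else 4 * of_nat n * of_nat (n - 1) * lamM a (n - 2))"
proof -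
  define A where "A = pcA a"
  define X where "X = pcM a (n + 2) + 4 * a * pcM a n"
  define Y where "Y = pcM (- a) (n + 2) + 4 * (- a) * pcM (- a) n"
  note C = pcf_connection_exp[OF p, folded A_def]
  have "lamM a (n + 2) + 4 * a * lamM a n = - (A * ((-1) ^ n - (pce a)\<^sup>2) * X) + pce a * \<i> ^ (n + 1) * Y"
    unfolding lamM_def A_def[symmetric] X_def Y_def by (simp add: algebra_simps)
  also have "\<dots> = (if n < 2 then 0 else 4 * of_nat n * of_nat (n - 1) * lamM a (n - 2))"
  proof -
    consider "n = 0" | "n = 1" | m where "n = m + 2" by (metis One_nat_def add_2_eq_Suc' not0_implies_Suc)
    then show ?thesis
    proof cases
      case 1
      have XY: "X = - 4 * pcf1 a" "Y = - 4 * pcf1 (- a)" using 1 pcM_rec[of a 0] pcM_rec[of "- a" 0] by (simp_all add: X_def Y_def)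
      have "- (A * ((-1) ^ n - (pce a)\<^sup>2) * X) + pce a * \<i> ^ (n + 1) * Y = 4 * (A * (1 - (pce a)\<^sup>2) * pcf1 a - \<i> * pce a * pcf1 (- a))"
        unfolding XY using 1 by (simp add: algebra_simps)
      then show ?thesis using 1 unfolding C(2) by simp
    next
      case 2
      have XY: "X = 4 * pcf0 a" "Y = 4 * pcf0 (- a)" using 2 pcM_rec[of a 1] pcM_rec[of "- a" 1] by (simp_all add: X_def Y_def)
      have "- (A * ((-1) ^ n - (pce a)\<^sup>2) * X) + pce a * \<i> ^ (n + 1) * Y = 4 * (A * (1 + (pce a)\<^sup>2) * pcf0 a - pce a * pcf0 (- a))"
        unfolding XY using 2 by (simp add: algebra_simps)
      then show ?thesis using 2 unfolding C(1) by simp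
    next
      case (3 m)
      have XY: "X = 4 * of_nat n * of_nat (n - 1) * pcM a m" "Y = 4 * of_nat n * of_nat (n - 1) * pcM (- a) m"
        using 3 pcM_rec[of a n] pcM_rec[of "- a" n] by (simp_all add: X_def Y_def)
      show ?thesis unfolding XY unfolding 3 lamM_def A_def[symmetric] by (simp add: algebra_simps)
    qed
  qed
  finally show ?thesis .
qed

text \<open>The exponential generating function of \<open>lamM\<close>; the powers (-1)^n and i^n
  become the rotated arguments of the Laplace transforms.\<close>

definition lamL :: "complex \<Rightarrow> complex \<Rightarrow> complex" where
  "lamL a x = - (pcA a * (pcP a (- x) - (pce a)\<^sup>2 * pcP a x))
     - pce a * \<i> * pcP (- a) (\<i> * x)"

lemma lamL_sums: "(\<lambda>n. x ^ n / fact n * lamM a n) sums lamL a x"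
proof -
  define A where "A = pcA a"
  have "(\<lambda>n. - (A * ((- x) ^ n / fact n * pcM a n - (pce a)\<^sup>2 * (x ^ n / fact n * pcM a n))) - pce a * \<i> * ((\<i> * x) ^ n / fact n * pcM (- a) n)) sums lamL a x"
    unfolding lamL_def A_def[symmetric] by (intro sums_diff sums_minus sums_mult pcP_sums)
  also have "(\<lambda>n. - (A * ((- x) ^ n / fact n * pcM a n - (pce a)\<^sup>2 * (x ^ n / fact n * pcM a n))) - pce a * \<i> * ((\<i> * x) ^ n / fact n * pcM (- a) n)) = (\<lambda>n. x ^ n / fact n * lamM a n)"
    unfolding lamM_def A_def[symmetric] power_mult_distrib power_minus[of x] by (simp add: algebra_simps)
  finally show ?thesis .
qed

text \<open>The factor (i/2)^n is the rescaling under which \<open>lamM_rec\<close> becomes exactly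
  the coefficient recurrence of Weber's equation with the same parameter.\<close>

definition lam_fps :: "complex \<Rightarrow> complex fps" where
  "lam_fps a = Abs_fps (\<lambda>n. lamM a n / fact n * (\<i> / 2) ^ n)"

lemma lam_fps_sums: "(\<lambda>n. fps_nth (lam_fps a) n * w ^ n) sums lamL a (\<i> / 2 * w)"
  using lamL_sums[of "\<i> / 2 * w" a] unfolding power_mult_distrib by (simp add: lam_fps_def mult_ac)

lemma lam_fps_conv_radius: "fps_conv_radius (lam_fps a) = \<infinity>"
  unfolding fps_conv_radius_def by (rule conv_radius_inftyI'') (use lam_fps_sums in \<open>blast intro: sums_summable\<close>)

lemma eval_lam_fps: "eval_fps (lam_fps a) w = lamL a (\<i> / 2 * w)"
  unfolding eval_fps_def using lam_fps_sums sums_unique by metis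

lemma fps_weber_ode_nth:
  fixes F :: "complex fps"
  shows "weber_ode a F \<longleftrightarrow>
    (\<forall>n. (of_nat n + 1) * (of_nat n + 2) * fps_nth F (n + 2) = a * fps_nth F n + (if n < 2 then 0 else fps_nth F (n - 2) / 4))"
proof -
  have l: "fps_nth (fps_deriv (fps_deriv F)) n = (of_nat n + 1) * (of_nat n + 2) * fps_nth F (n + 2)" for n
    by (simp add: algebra_simps)
  have r: "fps_nth ((fps_const (1/4) * fps_X\<^sup>2 + fps_const a) * F) n = a * fps_nth F n + (if n < 2 then 0 else fps_nth F (n - 2) / 4)" for n
    by (simp add: distrib_right mult.assoc fps_X_power_mult_nth)
  show ?thesis unfolding fps_eq_iff l r ..
qed

lemma lam_fps_ode:
  assumes p: "a + 1/2 \<notin> \<int>\<^sub>\<le>\<^sub>0"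
  shows "weber_ode a (lam_fps a)"
  unfolding fps_weber_ode_nth
proof
  fix n
  have f: "(fact (n + 2) :: complex) = (of_nat n + 1) * (of_nat n + 2) * fact n" by (simp add: algebra_simps)
  have "(of_nat n + 1) * (of_nat n + 2) * fps_nth (lam_fps a) (n + 2) = - (lamM a (n + 2) * (\<i> / 2) ^ n / (4 * fact n))"
  proof -
    have i: "(\<i> / 2) ^ (n + 2) = - ((\<i> / 2) ^ n / 4)" by (simp add: power_add power2_eq_square)
    have nz: "(of_nat n + 1) * (of_nat n + 2) \<noteq> (0 :: complex)" using of_nat_add_neq_0 by (simp only: mult_eq_0_iff) simp
    have "fps_nth (lam_fps a) (n + 2) = lamM a (n + 2) / ((of_nat n + 1) * (of_nat n + 2) * fact n) * - ((\<i> / 2) ^ n / 4)"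
      unfolding lam_fps_def fps_nth_Abs_fps f i ..
    then show ?thesis using nz by simp
  qed
  also have "lamM a (n + 2) = (if n < 2 then 0 else 4 * of_nat n * of_nat (n - 1) * lamM a (n - 2)) - 4 * a * lamM a n"
    using lamM_rec[OF p, of n] by (simp add: eq_diff_eq)
  also have "- (((if n < 2 then 0 else 4 * of_nat n * of_nat (n - 1) * lamM a (n - 2)) - 4 * a * lamM a n) * (\<i> / 2) ^ n / (4 * fact n)) = a * fps_nth (lam_fps a) n + (if n < 2 then 0 else fps_nth (lam_fps a) (n - 2) / 4)"
  proof (cases "n < 2")
    case True
    then show ?thesis by (simp add: lam_fps_def)
  next
    case False
    then obtain m where m: "n = m + 2" by (metis add.commute le_Suc_ex not_less)
    have f: "(fact n :: complex) = of_nat n * of_nat (n - 1) * fact m" unfolding m by (simp add: algebra_simps)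
    have i: "(\<i> / 2) ^ n = - ((\<i> / 2) ^ m / 4)" by (simp add: m power_add power2_eq_square)
    have nz: "of_nat n \<noteq> (0 :: complex)" "of_nat (n - 1) \<noteq> (0 :: complex)" unfolding m of_nat_eq_0_iff by simp_all
    have "4 * of_nat n * of_nat (n - 1) * lamM a m * (\<i> / 2) ^ n / (4 * fact n) = - (fps_nth (lam_fps a) m / 4)"
      unfolding f i lam_fps_def fps_nth_Abs_fps using nz by simp
    then show ?thesis using False m by (simp add: lam_fps_def left_diff_distrib diff_divide_distrib)
  qed
  finally show "(of_nat n + 1) * (of_nat n + 2) * fps_nth (lam_fps a) (n + 2) = a * fps_nth (lam_fps a) n + (if n < 2 then 0 else fps_nth (lam_fps a) (n - 2) / 4)" .
qed

text \<open>For w >= 0 the transforms of U(a,.) are taken at the imaginary points -iw/2 and iw/2,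
  that of U(-a,.) at -w/2. All are bounded there, so \<open>bounded_weber_sol\<close>
  applies.\<close>

lemma lamL_eq_pcU:
  assumes p: "a + 1/2 \<notin> \<int>\<^sub>\<le>\<^sub>0"
  shows "\<exists>c. \<forall>w. lamL a (\<i> / 2 * w) = c * pcU a w"
proof -
  obtain B1 where B1: "\<And>x. Re x \<le> 0 \<Longrightarrow> norm (pcP a x) \<le> B1" using pcP_bounded by blast
  obtain B2 where B2: "\<And>x. Re x \<le> 0 \<Longrightarrow> norm (pcP (- a) x) \<le> B2" using pcP_bounded by blast
  define A where "A = pcA a"
  have "norm (eval_fps (lam_fps a) (of_real w)) \<le> norm A * (B1 + norm ((pce a)\<^sup>2) * B1) + norm (pce a) * B2" if w: "w \<ge> 0" for w
  proof -
    let ?x = "\<i> / 2 * of_real w"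
    have "norm (lamL a ?x) \<le> norm (A * (pcP a (- ?x) - (pce a)\<^sup>2 * pcP a ?x)) + norm (pce a * \<i> * pcP (- a) (\<i> * ?x))"
      unfolding lamL_def A_def[symmetric] by (rule order_trans[OF norm_triangle_ineq4]) simp
    also have "\<dots> \<le> norm A * (B1 + norm ((pce a)\<^sup>2) * B1) + norm (pce a) * B2"
      unfolding norm_mult norm_ii mult_1_right
    proof (intro add_mono mult_left_mono)
      show "norm (pcP a (- ?x) - (pce a)\<^sup>2 * pcP a ?x) \<le> B1 + norm ((pce a)\<^sup>2) * B1"
        by (rule order_trans[OF norm_triangle_ineq4]) (auto simp: norm_mult intro!: add_mono mult_left_mono B1)
      show "norm (pcP (- a) (\<i> * ?x)) \<le> B2" using w by (intro B2) simp
    qed auto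
    finally show ?thesis by (simp add: eval_lam_fps)
  qed
  then have "\<exists>c. \<forall>z. eval_fps (lam_fps a) z = c * pcU a z"
    by (rule bounded_weber_sol[OF eval_fps_weber[OF lam_fps_conv_radius lam_fps_ode[OF p]]])
  then show ?thesis by (simp add: eval_lam_fps)
qed

lemma powr_exp_tendsto_0: "((\<lambda>x. of_real (2 * x) powr p * of_real (exp (- x\<^sup>2)) :: complex) \<longlongrightarrow> 0) at_top"
proof -
  have "((\<lambda>x. (2 * x) powr Re p * exp (- x\<^sup>2)) \<longlongrightarrow> 0) at_top" by real_asymp
  moreover have "eventually (\<lambda>x. norm (of_real (2 * x) powr p * of_real (exp (- x\<^sup>2)) :: complex) \<le> (2 * x) powr Re p * exp (- x\<^sup>2)) at_top"
    using eventually_gt_at_top[of 0]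
  proof eventually_elim
    case (elim x)
    then show ?case using norm_powr_of_real[of "2 * x" p] by (simp add: norm_mult)
  qed
  ultimately show ?thesis by (rule Lim_null_comparison[rotated])
qed

lemma tendsto_0_mult_bounded:
  fixes f g :: "real \<Rightarrow> complex"
  assumes "(f \<longlongrightarrow> 0) at_top" "\<And>x. x \<ge> 0 \<Longrightarrow> norm (g x) \<le> B"
  shows "((\<lambda>x. f x * g x) \<longlongrightarrow> 0) at_top"
proof (rule Lim_null_comparison)
  show "((\<lambda>x. norm (f x) * B) \<longlongrightarrow> 0) at_top"
    using tendsto_mult_left_zero[OF tendsto_norm_zero[OF assms(1)]] .
  show "eventually (\<lambda>x. norm (f x * g x) \<le> norm (f x) * B) at_top"
    using eventually_ge_at_top[of 0] by eventually_elim (auto simp: norm_mult intro!: mult_left_mono assms)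
qed

text \<open>The multiple is found by comparing growth for x tending to +infinity. After division by
  the growth of \<open>pcP a x\<close> the other two transforms disappear and
  \<open>pcP_asymp\<close> gives the limit of \<open>lamL a x\<close>; on the other side stands U at
  w = -2 i x, whose limit is read from its sectorial asymptotics.\<close>

lemma lamL_closed:
  assumes p: "a + 1/2 \<notin> \<int>\<^sub>\<le>\<^sub>0"
  shows "lamL a (\<i> / 2 * w) = of_real (sqrt 2) * exp ((a / 2 - 3/4) * of_real pi * \<i>) * Gamma (a + 1/2) * pcU a w"
proof -
  obtain c where c: "\<And>w. lamL a (\<i> / 2 * w) = c * pcU a w" using lamL_eq_pcU[OF p] by blast
  define q where "q = a + 1/2"
  define A where "A = pcA a"
  let ?m = "\<lambda>x. of_real (2 * x) powr q * of_real (exp (- x\<^sup>2)) :: complex"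
  obtain B1 where B1: "\<And>x. Re x \<le> 0 \<Longrightarrow> norm (pcP a x) \<le> B1" using pcP_bounded by blast
  obtain B2 where B2: "\<And>x. Re x \<le> 0 \<Longrightarrow> norm (pcP (- a) x) \<le> B2" using pcP_bounded by blast
  have P: "((\<lambda>x. ?m x * pcP a (of_real x)) \<longlongrightarrow> of_real (2 * sqrt pi)) at_top"
    unfolding q_def by (rule pcP_asymp)
  have P1: "((\<lambda>x. ?m x * pcP a (- of_real x)) \<longlongrightarrow> 0) at_top"
    by (rule tendsto_0_mult_bounded[OF powr_exp_tendsto_0]) (rule B1, simp)
  have P2: "((\<lambda>x. ?m x * pcP (- a) (\<i> * of_real x)) \<longlongrightarrow> 0) at_top"
    by (rule tendsto_0_mult_bounded[OF powr_exp_tendsto_0]) (rule B2, simp)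
  have "((\<lambda>x. - (A * (?m x * pcP a (- of_real x) - (pce a)\<^sup>2 * (?m x * pcP a (of_real x)))) - pce a * \<i> * (?m x * pcP (- a) (\<i> * of_real x)))
      \<longlongrightarrow> - (A * (0 - (pce a)\<^sup>2 * of_real (2 * sqrt pi))) - pce a * \<i> * 0) at_top"
    by (intro tendsto_intros P P1 P2)
  also have "(\<lambda>x. - (A * (?m x * pcP a (- of_real x) - (pce a)\<^sup>2 * (?m x * pcP a (of_real x)))) - pce a * \<i> * (?m x * pcP (- a) (\<i> * of_real x))) = (\<lambda>x. ?m x * lamL a (of_real x))"
    unfolding lamL_def A_def[symmetric] by (rule ext) (simp add: algebra_simps)
  finally have L1: "((\<lambda>x. ?m x * lamL a (of_real x)) \<longlongrightarrow> A * (pce a)\<^sup>2 * of_real (2 * sqrt pi)) at_top" by (simp add: mult.assoc)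
  let ?F = "inf at_infinity (principal {z. \<bar>Arg z\<bar> \<le> 3 / 4 * pi - pi / 4})"
  \<comment> \<open>The ray arg w = -pi/2 is an edge of the closed sector for
    \<open>\<delta> = pi / 4\<close>, so the asymptotics apply along it.\<close>
  have fl: "filterlim (\<lambda>x. - 2 * \<i> * complex_of_real x) ?F at_top"
  proof (rule filterlim_inf[THEN iffD2], intro conjI)
    show "filterlim (\<lambda>x. - 2 * \<i> * complex_of_real x) at_infinity at_top"
      by (intro tendsto_mult_filterlim_at_infinity[OF tendsto_const] filterlim_of_real_at_infinity) auto
    show "filterlim (\<lambda>x. - 2 * \<i> * complex_of_real x) (principal {z. \<bar>Arg z\<bar> \<le> 3 / 4 * pi - pi / 4}) at_top"
      unfolding filterlim_principal using eventually_gt_at_top[of "0::real"]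
    proof eventually_elim
      case (elim x)
      have "Arg (- 2 * \<i> * complex_of_real x) = Arg (of_real (2 * x) * (- \<i>))" by (simp add: mult_ac)
      also have "\<dots> = Arg (- \<i>)" using elim by (intro Arg_times_of_real) auto
      also have "\<dots> = - pi / 2" by (simp add: Arg_minus_ii)
      finally show ?case by simp
    qed
  qed
  have G: "((\<lambda>x. pcG a (- 2 * \<i> * complex_of_real x) * (- 2 * \<i> * complex_of_real x) powr (a + 1/2)) \<longlongrightarrow> 1) at_top"
    by (rule filterlim_compose[OF pcU_ratio_tendsto fl]) auto
  have "((\<lambda>x. c * exp (\<i> * of_real pi / 2 * q) * (pcG a (- 2 * \<i> * complex_of_real x) * (- 2 * \<i> * complex_of_real x) powr (a + 1/2))) \<longlongrightarrow> c * exp (\<i> * of_real pi / 2 * q) * 1) at_top"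
    by (intro tendsto_mult tendsto_const G)
  moreover have "eventually (\<lambda>x. c * exp (\<i> * of_real pi / 2 * q) * (pcG a (- 2 * \<i> * complex_of_real x) * (- 2 * \<i> * complex_of_real x) powr (a + 1/2)) = ?m x * lamL a (of_real x)) at_top"
    using eventually_gt_at_top[of "0::real"]
  proof eventually_elim
    case (elim x)
    have "lamL a (of_real x) = lamL a (\<i> / 2 * (- 2 * \<i> * of_real x))" by simp
    also have "\<dots> = c * pcU a (- 2 * \<i> * of_real x)" by (rule c)
    also have "pcU a (- 2 * \<i> * of_real x) = of_real (exp (x\<^sup>2)) * pcG a (- 2 * \<i> * of_real x)"
    proof -
      have "- (- 2 * \<i> * complex_of_real x)\<^sup>2 / 4 = of_real (x\<^sup>2)" by (simp add: power_mult_distrib)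
      then show ?thesis unfolding pcU_eq by (simp only: exp_of_real)
    qed
    finally have l: "lamL a (of_real x) = c * (of_real (exp (x\<^sup>2)) * pcG a (- 2 * \<i> * of_real x))" .
    have "- 2 * \<i> * complex_of_real x = of_real (2 * x) * (- \<i>)" by simp
    then have "(- 2 * \<i> * complex_of_real x) powr (a + 1/2) = of_real (2 * x) powr q * (- \<i>) powr q"
      using elim unfolding q_def by (simp only:) (rule powr_times_real_left, auto)
    also have "(- \<i>) powr q = exp (- (\<i> * of_real pi / 2 * q))" by (simp add: powr_def mult_ac)
    finally have pw: "(- 2 * \<i> * complex_of_real x) powr (a + 1/2) = of_real (2 * x) powr q * exp (- (\<i> * of_real pi / 2 * q))" .
    have e1: "exp (\<i> * of_real pi / 2 * q) * exp (- (\<i> * of_real pi / 2 * q)) = 1" by (simp flip: exp_add)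
    have e2: "complex_of_real (exp (- x\<^sup>2)) * of_real (exp (x\<^sup>2)) = 1" by (simp flip: of_real_mult exp_add)
    have "c * exp (\<i> * of_real pi / 2 * q) * (pcG a (- 2 * \<i> * complex_of_real x) * (- 2 * \<i> * complex_of_real x) powr (a + 1/2))
       = c * pcG a (- 2 * \<i> * complex_of_real x) * of_real (2 * x) powr q * (exp (\<i> * of_real pi / 2 * q) * exp (- (\<i> * of_real pi / 2 * q)))"
      unfolding pw by simp
    also have "\<dots> = c * pcG a (- 2 * \<i> * complex_of_real x) * of_real (2 * x) powr q * (of_real (exp (- x\<^sup>2)) * of_real (exp (x\<^sup>2)))"
      unfolding e1 e2 ..
    also have "\<dots> = ?m x * lamL a (of_real x)" unfolding l by simp
    finally show ?case .
  qed
  ultimately have "((\<lambda>x. ?m x * lamL a (of_real x)) \<longlongrightarrow> c * exp (\<i> * of_real pi / 2 * q) * 1) at_top"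
    by (rule Lim_transform_eventually)
  then have ce: "c * exp (\<i> * of_real pi / 2 * q) = A * (pce a)\<^sup>2 * of_real (2 * sqrt pi)"
    using tendsto_unique[OF _ _ L1] by simp
  have e1: "exp (\<i> * of_real pi / 2 * q) * exp (- (\<i> * of_real pi / 2 * q)) = 1" by (simp flip: exp_add)
  have "c = c * exp (\<i> * of_real pi / 2 * q) * exp (- (\<i> * of_real pi / 2 * q))" using e1 by (simp add: mult.assoc)
  also have "\<dots> = A * of_real (2 * sqrt pi) * ((pce a)\<^sup>2 * exp (- (\<i> * of_real pi / 2 * q)))" unfolding ce by simp
  also have "(pce a)\<^sup>2 * exp (- (\<i> * of_real pi / 2 * q)) = exp ((a / 2 - 3/4) * of_real pi * \<i>)"
    unfolding pce_def q_def power2_eq_square exp_add[symmetric] by (rule arg_cong[of _ _ exp]) (simp add: field_simps)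
  also have "A * of_real (2 * sqrt pi) = of_real (sqrt 2) * Gamma (a + 1/2)"
  proof -
    have "2 * sqrt pi / sqrt (2 * pi) = sqrt 2" by (simp add: real_sqrt_mult field_simps)
    then have "complex_of_real (2 * sqrt pi) / of_real (sqrt (2 * pi)) = of_real (sqrt 2)" by (metis of_real_divide)
    moreover have "A * of_real (2 * sqrt pi) = complex_of_real (2 * sqrt pi) / of_real (sqrt (2 * pi)) * Gamma (a + 1/2)"
      unfolding A_def pcA_def by simp
    ultimately show ?thesis by (simp only:)
  qed
  finally show ?thesis unfolding c by simp
qed

lemma lamM_closed:
  assumes p: "a + 1/2 \<notin> \<int>\<^sub>\<le>\<^sub>0"
  shows "lamM a n = of_real (sqrt 2) * exp ((a / 2 - 3/4) * of_real pi * \<i>) * Gamma (a + 1/2) * (- 2 * \<i>) ^ n * fact n * fps_nth (weber_fps a (pcf0 a) (pcf1 a)) n"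
proof -
  define c where "c = of_real (sqrt 2) * exp ((a / 2 - 3/4) * of_real pi * \<i>) * Gamma (a + 1/2)"
  have cr: "fps_conv_radius (fps_const c * weber_fps a (pcf0 a) (pcf1 a)) = \<infinity>"
    using fps_conv_radius_mult[of "fps_const c" "weber_fps a (pcf0 a) (pcf1 a)"] by simp
  have "eval_fps (lam_fps a) w = eval_fps (fps_const c * weber_fps a (pcf0 a) (pcf1 a)) w" for w
    using lamL_closed[OF p, of w] by (simp add: eval_lam_fps eval_fps_mult eval_weber_fps c_def flip: pcU_def)
  then have "lam_fps a = fps_const c * weber_fps a (pcf0 a) (pcf1 a)"
    by (intro eval_fps_eqD) (auto simp: lam_fps_conv_radius cr)
  then have "fps_nth (lam_fps a) n = c * fps_nth (weber_fps a (pcf0 a) (pcf1 a)) n" by simp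
  then have "lamM a n * (\<i> / 2) ^ n = c * fact n * fps_nth (weber_fps a (pcf0 a) (pcf1 a)) n"
    by (simp add: lam_fps_def field_simps)
  then have "lamM a n * ((\<i> / 2) ^ n * (- 2 * \<i>) ^ n) = c * (- 2 * \<i>) ^ n * fact n * fps_nth (weber_fps a (pcf0 a) (pcf1 a)) n"
    by (simp add: mult_ac)
  also have "(\<i> / 2) ^ n * (- 2 * \<i>) ^ n = 1" by (simp flip: power_mult_distrib)
  finally show ?thesis by (simp add: c_def)
qed

section \<open>Two finite sums for the Taylor coefficients of U\<close>

lemma gauss_fps_mult_nth:
  "fps_nth (gauss_fps c * H) n = (\<Sum>s\<le>n div 2. c ^ s / fact s * fps_nth H (n - 2 * s))"
proof -
  have "fps_nth (gauss_fps c * H) n = (\<Sum>i=0..n. fps_nth (gauss_fps c) i * fps_nth H (n - i))"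
    by (rule fps_mult_nth)
  also have "\<dots> = (\<Sum>i\<in>(*) 2 ` {..n div 2}. fps_nth (gauss_fps c) i * fps_nth H (n - i))"
    by (rule sum.mono_neutral_right) (auto simp: gauss_fps_def elim!: evenE)
  also have "\<dots> = (\<Sum>s\<le>n div 2. c ^ s / fact s * fps_nth H (n - 2 * s))"
    by (subst sum.reindex) (auto simp: inj_on_def gauss_fps_def)
  finally show ?thesis .
qed

lemma fps_weber_ode_unique:
  fixes F :: "complex fps"
  assumes F: "weber_ode a F"
    and G: "weber_ode a G"
    and 0: "fps_nth F 0 = fps_nth G 0" "fps_nth F 1 = fps_nth G 1"
  shows "F = G"
proof (rule fps_ext)
  fix n show "fps_nth F n = fps_nth G n"
  proof (induction n rule: less_induct)
    case (less n)
    consider "n = 0" | "n = 1" | m where "n = m + 2" by (metis One_nat_def add_2_eq_Suc' not0_implies_Suc)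
    then show ?case
    proof cases
      case (3 m)
      have "(of_nat m + 1) * (of_nat m + 2) * fps_nth F n = (of_nat m + 1) * (of_nat m + 2) * fps_nth G n"
        using F[unfolded fps_weber_ode_nth, rule_format, of m] G[unfolded fps_weber_ode_nth, rule_format, of m] less[of m] less[of "m - 2"] 3
        by (simp del: mult_cancel_left)
      then show ?thesis using of_nat_add_neq_0 by (simp only: mult_cancel_left mult_eq_0_iff) simp
    qed (use 0 in auto)
  qed
qed

text \<open>The Taylor coefficients of \<open>exp(-z\<^sup>2/4) U(a,z)\<close>.\<close>

definition hco :: "complex \<Rightarrow> nat \<Rightarrow> complex" where
  "hco a n = (-1) ^ n / fact n * of_real (sqrt pi) * 2 powr (of_nat n / 2 - a / 2 - 1/4) * rGamma (a / 2 + 3/4 - of_nat n / 2)"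

text \<open>The functional equation of \<open>rGamma\<close> in disguise. As \<open>rGamma\<close>
  is entire, this expansion holds for every \<open>a\<close>, in contrast to
  \<open>pcc_closed\<close>.\<close>

lemma hco_rec: "(of_nat n + 1) * (of_nat n + 2) * hco a (n + 2) = (a - 1/2 - of_nat n) * hco a n"
proof -
  define N where "N = complex_of_nat n"
  have nz: "(N + 1) * (N + 2) \<noteq> 0" unfolding N_def using of_nat_add_neq_0 by (simp only: mult_eq_0_iff) simp
  have f: "(fact (n + 2) :: complex) = (N + 1) * (N + 2) * fact n" by (simp add: N_def algebra_simps)
  have e: "of_nat (n + 2) / 2 - a / 2 - 1/4 = (N / 2 - a / 2 - 1/4) + 1" by (simp add: N_def field_simps)
  have r: "rGamma (a / 2 + 3/4 - of_nat (n + 2) / 2) = (a / 2 - 1/4 - N / 2) * rGamma (a / 2 + 3/4 - N / 2)"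
  proof -
    have "a / 2 + 3/4 - of_nat (n + 2) / 2 = a / 2 - 1/4 - N / 2" by (simp add: N_def field_simps)
    moreover have "(a / 2 - 1/4 - N / 2) + 1 = a / 2 + 3/4 - N / 2" by simp
    ultimately show ?thesis using rGamma_plus1[of "a / 2 - 1/4 - N / 2"] by (simp only:)
  qed
  define k where "k = a / 2 - 1/4 - N / 2"
  have "hco a (n + 2) = (-1) ^ n / ((N + 1) * (N + 2) * fact n) * of_real (sqrt pi) * (2 * 2 powr (N / 2 - a / 2 - 1/4)) * (k * rGamma (a / 2 + 3/4 - N / 2))"
    unfolding hco_def f e r two_powr_plus1 k_def by simp
  also have "\<dots> = 2 * k * hco a n / ((N + 1) * (N + 2))"
    unfolding hco_def N_def[symmetric] by (simp add: mult_ac)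
  finally have "(N + 1) * (N + 2) * hco a (n + 2) = 2 * k * hco a n"
    using nz by simp
  also have "2 * k = a - 1/2 - N" by (simp add: k_def)
  finally show ?thesis by (simp add: N_def)
qed

text \<open>The second factorisation of the same series. For exp(z^2/4) H Weber's equation becomes
  H'' = -z H' + (a - 1/2) H, and the first two coefficients agree.\<close>

lemma weber_fps_hco: "weber_fps a (pcf0 a) (pcf1 a) = gauss_fps (1/4) * Abs_fps (hco a)"
proof (rule fps_weber_ode_unique[OF weber_fps_ode])
  show "weber_ode a (gauss_fps (1/4) * Abs_fps (hco a))"
  proof (rule gauss_mult_weber)
    show "fps_deriv (fps_deriv (Abs_fps (hco a))) = - fps_const (4 * (1/4)) * fps_X * fps_deriv (Abs_fps (hco a)) + fps_const (a - 2 * (1/4)) * Abs_fps (hco a)"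
    proof (rule fps_ext)
      fix n
      have "fps_nth (fps_deriv (fps_deriv (Abs_fps (hco a)))) n = (of_nat n + 1) * (of_nat n + 2) * hco a (n + 2)"
        by (simp add: algebra_simps)
      also have "\<dots> = (a - 1/2 - of_nat n) * hco a n" by (rule hco_rec)
      also have "\<dots> = fps_nth (- fps_const (4 * (1/4)) * fps_X * fps_deriv (Abs_fps (hco a)) + fps_const (a - 2 * (1/4)) * Abs_fps (hco a)) n"
        by (cases n) (auto simp: algebra_simps)
      finally show "fps_nth (fps_deriv (fps_deriv (Abs_fps (hco a)))) n = \<dots>" .
    qed
  qed (simp add: power2_eq_square)
  have g: "fps_nth (gauss_fps c * H) 0 = fps_nth H 0" "fps_nth (gauss_fps c * H) 1 = fps_nth H 1" for c H
    unfolding gauss_fps_mult_nth by simp_all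
  have h: "hco a 0 = pcf0 a" "hco a 1 = pcf1 a"
  proof -
    show "hco a 0 = pcf0 a" by (simp add: hco_def pcf0_def)
    have "of_nat 1 / 2 - a / 2 - 1/4 = - a / 2 + 1/4" "a / 2 + 3/4 - of_nat 1 / 2 = a / 2 + 1/4" by (simp_all add: field_simps)
    then show "hco a 1 = pcf1 a" unfolding hco_def pcf1_def by (simp only:) simp
  qed
  show "fps_nth (weber_fps a (pcf0 a) (pcf1 a)) 0 = fps_nth (gauss_fps (1/4) * Abs_fps (hco a)) 0"
    "fps_nth (weber_fps a (pcf0 a) (pcf1 a)) 1 = fps_nth (gauss_fps (1/4) * Abs_fps (hco a)) 1"
    unfolding weber_fps_def g using h by (simp_all add: wfps_nth)
qed

text \<open>By the duplication formula the product is (-R)_{2s} / 4^s, which is a falling factorial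
  and vanishes for 2 s > R. This is why the hypergeometric series terminates.\<close>

lemma pochhammer_half_mult:
  "pochhammer (1/2 - of_nat R / 2) s * pochhammer (- of_nat R / 2) s =
     (if 2 * s \<le> R then fact R / (fact (R - 2 * s) * 4 ^ s) else (0 :: complex))"
proof -
  have e: "2 * (- of_nat R / 2) = - (of_nat R :: complex)" "- of_nat R / 2 + 1/2 = 1/2 - of_nat R / (2 :: complex)" by simp_all
  have f4: "of_nat (2 ^ (2 * s)) = (4 :: complex) ^ s"
    using power_mult[of "2::complex" 2 s] by simp
  have "(4 :: complex) ^ s * pochhammer (- of_nat R / 2) s * pochhammer (1/2 - of_nat R / 2) s = pochhammer (- (of_nat R :: complex)) (2 * s)"
    using pochhammer_double[of "- of_nat R / (2 :: complex)" s] unfolding e f4 by simp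
  also have "\<dots> = fact (2 * s) * of_nat (R choose (2 * s))"
    using gbinomial_pochhammer[of "of_nat R :: complex" "2 * s"] by (simp add: binomial_gbinomial)
  also have "\<dots> = (if 2 * s \<le> R then fact R / fact (R - 2 * s) else (0 :: complex))"
    by (simp add: binomial_fact)
  finally have P: "(4 :: complex) ^ s * pochhammer (- of_nat R / 2) s * pochhammer (1/2 - of_nat R / 2) s = (if 2 * s \<le> R then fact R / fact (R - 2 * s) else 0)" .
  have "pochhammer (1/2 - of_nat R / 2) s * pochhammer (- of_nat R / 2) s = (4 :: complex) ^ s * pochhammer (- of_nat R / 2) s * pochhammer (1/2 - of_nat R / 2) s / 4 ^ s"
    by simp
  then show ?thesis unfolding P by simp
qed

lemma olver_F_half:
  "olver_F (1/2 - of_nat R / 2) (- of_nat R / 2) c x =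
     (\<Sum>s\<le>R div 2. fact R / (fact (R - 2 * s) * 4 ^ s) * x ^ s * rGamma (c + of_nat s) / fact s)"
proof -
  have "olver_F (1/2 - of_nat R / 2) (- of_nat R / 2) c x = (\<Sum>s\<le>R div 2. (if 2 * s \<le> R then fact R / (fact (R - 2 * s) * 4 ^ s) else 0) * x ^ s * rGamma (c + of_nat s) / fact s)"
    unfolding olver_F_def pochhammer_half_mult by (rule suminf_finite) auto
  also have "\<dots> = (\<Sum>s\<le>R div 2. fact R / (fact (R - 2 * s) * 4 ^ s) * x ^ s * rGamma (c + of_nat s) / fact s)"
    by (rule sum.cong[OF refl]) auto
  finally show ?thesis .
qed

abbreviation lam_term :: "nat \<Rightarrow> complex \<Rightarrow> nat \<Rightarrow> complex" where
  "lam_term R a s \<equiv> (- 1/4) ^ s / fact s * ((-1) ^ (R - 2 * s) / fact (R - 2 * s) *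
     2 powr ((a + of_nat (R - 2 * s)) / 2 - 3/4) * Gamma ((a + of_nat (R - 2 * s)) / 2 + 1/4))"

text \<open>\<open>\<Gamma>(a + 1/2)\<close> has been cancelled in \<open>lam_term\<close>, so that \<open>Lam R\<close> is continuous at the removable
  singularities of \<open>U02\<close> (where \<open>Gamma (a + 1/2)\<close> has the junk value 0).\<close>

definition Lam :: "nat \<Rightarrow> complex \<Rightarrow> complex" where
  "Lam R a = of_real (sqrt 2) * exp ((a / 2 - 3/4) * of_real pi * \<i>) * (- 2 * \<i>) ^ R * fact R *
     (\<Sum>s\<le>R div 2. lam_term R a s)"

text \<open>Uses the expansion with the decaying Gaussian: every coefficient \<open>pcc\<close>
  contains \<open>rGamma (a + 1/2)\<close>, which cancels the Gamma factor of
  \<open>lamM_closed\<close>.\<close>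

lemma Lam_eq_lamM:
  assumes p: "a + 1/2 \<notin> \<int>\<^sub>\<le>\<^sub>0"
  shows "Lam R a = lamM a R"
proof -
  have G: "Gamma (a + 1/2) * rGamma (a + 1/2) = 1" using p by (simp add: rGamma_inverse_Gamma Gamma_eq_zero_iff)
  have W: "fps_nth (weber_fps a (pcf0 a) (pcf1 a)) R = (\<Sum>s\<le>R div 2. (- 1/4) ^ s / fact s * pcc a (R - 2 * s))"
    unfolding weber_fps_def gauss_fps_mult_nth by (simp add: wfps_nth pcc_def)
  have S: "Gamma (a + 1/2) * fps_nth (weber_fps a (pcf0 a) (pcf1 a)) R = (\<Sum>s\<le>R div 2. lam_term R a s)"
    unfolding W sum_distrib_left
  proof (rule sum.cong[OF refl])
    fix s
    have "Gamma (a + 1/2) * ((- 1/4) ^ s / fact s * pcc a (R - 2 * s)) = (Gamma (a + 1/2) * rGamma (a + 1/2)) * (lam_term R a s)"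
      unfolding pcc_closed[OF p] by (simp only: mult_ac)
    then show "Gamma (a + 1/2) * ((- 1/4) ^ s / fact s * pcc a (R - 2 * s)) = lam_term R a s" unfolding G by simp
  qed
  show ?thesis unfolding lamM_closed[OF p] Lam_def S[symmetric] by simp
qed

lemma two_i_power: "(2 * \<i>) ^ R = 2 powr (of_nat R) * exp (of_nat R / 2 * of_real pi * \<i>)"
proof -
  have "exp (of_real pi / 2 * \<i>) = cis (pi / 2)" by (simp add: cis_conv_exp mult.commute)
  then have "\<i> = exp (of_real pi / 2 * \<i>)" by simp
  then have "\<i> ^ R = exp (of_nat R * (of_real pi / 2 * \<i>))" by (metis exp_of_nat_mult)
  also have "of_nat R * (of_real pi / 2 * \<i>) = of_nat R / 2 * of_real pi * \<i>" by simp
  finally show ?thesis by (simp add: power_mult_distrib powr_nat')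
qed

lemma minus_two_i_power: "(- 2 * \<i>) ^ R * (-1) ^ R = 2 powr (of_nat R) * exp (of_nat R / 2 * of_real pi * \<i>)"
proof -
  have "(- 2 * \<i>) ^ R * (-1) ^ R = (- 2 * \<i> * -1) ^ R" by (simp only: power_mult_distrib)
  also have "- 2 * \<i> * -1 = 2 * \<i>" by simp
  finally show ?thesis by (simp only: two_i_power)
qed

abbreviation olver_R :: "nat \<Rightarrow> complex \<Rightarrow> complex" where
  "olver_R R a \<equiv> olver_F (1/2 - of_nat R / 2) (- of_nat R / 2) (a / 2 - of_nat R / 2 + 3/4) (1/2)"

text \<open>Uses the expansion with the growing Gaussian. The arguments of \<open>rGamma\<close> in
  \<open>hco a (R - 2 * s)\<close> increase by 1 with s, as in Olver's function, and the powers of 2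
  supply its argument 1/2.\<close>

lemma Lam_eq_olver_F:
  assumes p: "a + 1/2 \<notin> \<int>\<^sub>\<le>\<^sub>0"
  shows "Lam R a = 2 powr (- a / 2 + 3/2 * of_nat R + 1/4) * of_real (sqrt pi)
         * exp ((a / 2 + of_nat R / 2 - 3/4) * of_real pi * \<i>) * Gamma (a + 1/2)
         * olver_R R a"
proof -
  define x where "x = - a / 2 + of_nat R / 2 - 1/4"
  have summand: "fact R * ((1/4) ^ s / fact s * hco a (R - 2 * s)) =
      (-1) ^ R * of_real (sqrt pi) * 2 powr x *
      (fact R / (fact (R - 2 * s) * 4 ^ s) * (1/2) ^ s * rGamma (a / 2 - of_nat R / 2 + 3/4 + of_nat s) / fact s)" if s: "s \<le> R div 2" for s
  proof -
    have s': "2 * s \<le> R" using s by simp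
    have o: "of_nat (R - 2 * s) = (of_nat R - 2 * of_nat s :: complex)" using s' by (simp add: of_nat_diff)
    have m: "(-1) ^ (R - 2 * s) = ((-1) ^ R :: complex)" using s' by (simp add: minus_one_power_iff)
    have e: "of_nat (R - 2 * s) / 2 - a / 2 - 1/4 = x - of_nat s" unfolding o x_def by (simp add: field_simps)
    have r: "a / 2 + 3/4 - of_nat (R - 2 * s) / 2 = a / 2 - of_nat R / 2 + 3/4 + of_nat s" unfolding o by (simp add: field_simps)
    have "2 powr (x - of_nat s) = 2 powr x * (1/2 :: complex) ^ s" by (simp add: powr_diff powr_nat' power_divide)
    then show ?thesis unfolding hco_def e r m by (simp add: power_divide mult_ac)
  qed
  have "Lam R a = of_real (sqrt 2) * exp ((a / 2 - 3/4) * of_real pi * \<i>) * Gamma (a + 1/2) * (- 2 * \<i>) ^ R * (\<Sum>s\<le>R div 2. fact R * ((1/4) ^ s / fact s * hco a (R - 2 * s)))"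
    unfolding Lam_eq_lamM[OF p] lamM_closed[OF p] weber_fps_hco gauss_fps_mult_nth sum_distrib_left[symmetric] by simp
  also have "(\<Sum>s\<le>R div 2. fact R * ((1/4) ^ s / fact s * hco a (R - 2 * s))) =
     (-1) ^ R * of_real (sqrt pi) * 2 powr x * olver_R R a"
    unfolding olver_F_half sum_distrib_left by (rule sum.cong[OF refl]) (rule summand, simp)
  also have "of_real (sqrt 2) * exp ((a / 2 - 3/4) * of_real pi * \<i>) * Gamma (a + 1/2) * (- 2 * \<i>) ^ R * ((-1) ^ R * of_real (sqrt pi) * 2 powr x * olver_R R a)
     = (of_real (sqrt 2) * 2 powr x * 2 powr (of_nat R)) * of_real (sqrt pi) * (exp ((a / 2 - 3/4) * of_real pi * \<i>) * exp (of_nat R / 2 * of_real pi * \<i>)) * Gamma (a + 1/2) * olver_R R a"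
  proof -
    have regroup: "m * n = P * e \<Longrightarrow> s * E * G * m * (n * q * X * F) = (s * X * P) * q * (E * e) * G * F"
      for m n P e s E G q X F :: complex
    proof -
      assume h: "m * n = P * e"
      have "s * E * G * m * (n * q * X * F) = (m * n) * (s * E * G * q * X * F)" by (simp add: mult_ac)
      then show ?thesis unfolding h by (simp add: mult_ac)
    qed
    show ?thesis by (rule regroup[OF minus_two_i_power])
  qed
  also have "of_real (sqrt 2) * 2 powr x * 2 powr (of_nat R) = 2 powr (- a / 2 + 3/2 * of_nat R + 1/4)"
    unfolding two_powr_half[symmetric] powr_add[symmetric] x_def by (rule arg_cong) (simp add: field_simps)
  also have "exp ((a / 2 - 3/4) * of_real pi * \<i>) * exp (of_nat R / 2 * of_real pi * \<i>) = exp ((a / 2 + of_nat R / 2 - 3/4) * of_real pi * \<i>)"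
    unfolding exp_add[symmetric] by (rule arg_cong) (simp add: field_simps)
  finally show ?thesis .
qed

section \<open>Tangent and secant combined; the phase factor at -a\<close>

definition pole_set :: "nat \<Rightarrow> complex set" where
  "pole_set R = {a. \<exists>N::int. a = of_int N + 1/2 \<and> even (N - int R)}"

text \<open>The half angle in tan x + sec x = tan(x/2 + pi/4) and tan x - sec x = tan(x/2 - pi/4),
  with x = pi a. A single tangent has no removable singularities left.\<close>

definition phi :: "nat \<Rightarrow> complex \<Rightarrow> complex" where
  "phi R a = of_real pi * a / 2 + (-1) ^ R * of_real pi / 4"

lemma cos_phi_nonzero:
  assumes "a \<notin> pole_set R"
  shows "cos (phi R a) \<noteq> 0"
proof
  assume "cos (phi R a) = 0"
  then obtain n :: int where "phi R a = of_real (of_int n * pi) + of_real pi / 2"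
    unfolding cos_eq_0 by auto
  then have "of_real pi * (a / 2 + (-1) ^ R / 4) = of_real pi * (of_int n + 1/2)"
    by (simp add: phi_def algebra_simps)
  then have "a / 2 + (-1) ^ R / 4 = of_int n + 1/2" by (simp only: mult_cancel_left of_real_eq_0_iff) simp
  moreover have "a = 2 * (a / 2 + (-1) ^ R / 4) - (-1) ^ R / 2" by (simp add: algebra_simps)
  ultimately have "a = 2 * (of_int n + 1/2) - (-1) ^ R / 2" by (simp only:)
  then have a: "a = 2 * of_int n + 1 - (-1) ^ R / 2" by (simp add: algebra_simps)
  show False
  proof (cases "even R")
    case True
    then have "a = of_int (2 * n) + 1/2" using a by simp
    moreover have "even (2 * n - int R)" using True by simp
    ultimately show False using assms unfolding pole_set_def by blast
  next
    case False
    then have "a = of_int (2 * n + 1) + 1/2" using a by simp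
    moreover have "even (2 * n + 1 - int R)" using False by simp
    ultimately show False using assms unfolding pole_set_def by blast
  qed
qed

lemma tan_phi:
  assumes c: "cos (phi R a) \<noteq> 0" and c2: "cos (of_real pi * a) \<noteq> 0"
  shows "tan (of_real pi * a) + (-1) ^ R * (1 / cos (of_real pi * a)) = tan (phi R a)"
proof -
  define \<epsilon> :: complex where "\<epsilon> = (-1) ^ R"
  define C where "C = cos (of_real pi * a)"
  define S where "S = sin (of_real pi * a)"
  have ee: "\<epsilon> * \<epsilon> = 1" by (simp add: \<epsilon>_def flip: power_mult_distrib)
  have d: "2 * phi R a = of_real pi * a + \<epsilon> * (of_real pi / 2)" by (simp add: phi_def \<epsilon>_def field_simps)
  have e: "\<epsilon> = 1 \<or> \<epsilon> = -1" by (cases "even R") (auto simp: \<epsilon>_def)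
  have s2: "2 * sin (phi R a) * cos (phi R a) = \<epsilon> * C"
    using sin_double[of "phi R a"] e unfolding d by (auto simp: sin_add sin_diff C_def)
  have c2': "2 * cos (phi R a) ^ 2 = 1 - \<epsilon> * S"
    using cos_double_cos[of "phi R a"] e unfolding d by (auto simp: cos_add cos_diff S_def algebra_simps)
  have SC: "C * C = 1 - S * S" using sin_cos_squared_add[of "of_real pi * a"] by (simp add: S_def C_def power2_eq_square algebra_simps eq_diff_eq)
  have "(S + \<epsilon>) * (2 * cos (phi R a) ^ 2) = (2 * sin (phi R a) * cos (phi R a)) * C"
  proof -
    have "(S + \<epsilon>) * (1 - \<epsilon> * S) = S - (\<epsilon> * \<epsilon>) * S + \<epsilon> * (1 - S * S)" by (simp add: algebra_simps)
    then show ?thesis unfolding s2 c2' ee SC[symmetric] by (simp add: mult.assoc)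
  qed
  then have "(S + \<epsilon>) * cos (phi R a) = sin (phi R a) * C" using c by (simp add: power2_eq_square)
  then have "(S + \<epsilon>) / C = sin (phi R a) / cos (phi R a)" using c c2 by (simp add: field_simps C_def)
  then show ?thesis by (simp add: tan_def S_def C_def \<epsilon>_def add_divide_distrib)
qed

lemma cos_pi_eq_0D:
  fixes a :: complex
  assumes "cos (of_real pi * a) = 0"
  shows "\<exists>N::int. a = of_int N + 1/2"
proof -
  from assms obtain n :: int where "of_real pi * a = of_real (of_int n * pi) + of_real pi / 2"
    unfolding cos_eq_0 by auto
  then have "of_real pi * a = of_real pi * (of_int n + 1/2)" by (simp add: algebra_simps)
  then have "a = of_int n + 1/2" by (simp only: mult_cancel_left of_real_eq_0_iff) simp
  then show ?thesis ..
qed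

lemma half_int_isolated:
  fixes a :: complex
  assumes "a = of_int N + 1/2"
  shows "eventually (\<lambda>b. \<nexists>M::int. b = of_int M + 1/2) (at a)"
  unfolding eventually_at
proof (intro exI[of _ 1] conjI ballI impI notI)
  fix b assume b: "b \<noteq> a \<and> dist b a < 1" and "\<exists>M::int. b = of_int M + 1/2"
  then obtain M :: int where M: "b = of_int M + 1/2" by blast
  have "dist b a = norm (of_int (M - N) :: complex)" by (simp add: M assms dist_norm)
  also have "\<dots> = \<bar>of_int (M - N)\<bar>" by (rule norm_of_int)
  finally have "\<bar>M - N\<bar> < 1" using b by linarith
  then show False using b M assms by simp
qed simp

text \<open>Near a removable singularity the defining expression equals the tangent of
  \<open>phi\<close>, which is continuous there, so the limit is its value.\<close>

lemma tan_sec_eq: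
  assumes a: "a \<notin> pole_set R"
  shows "tan_sec R a = tan (phi R a)"
proof (cases "\<exists>N::int. a = of_int N + 1/2")
  case True
  then obtain N :: int where N: "a = of_int N + 1/2" by blast
  have "odd (N - int R)" using a N unfolding pole_set_def by blast
  then have "a \<in> {a. \<exists>N::int. a = of_int N + 1/2 \<and> odd (N - int R)}" using N by blast
  then have t: "tan_sec R a = Lim (at a) (\<lambda>a. tan (of_real pi * a) + (-1) ^ R * (1 / cos (of_real pi * a)))"
    unfolding tan_sec_def limits_on_def by simp
  have "((\<lambda>b. tan (phi R b)) \<longlongrightarrow> tan (phi R a)) (at a)"
    unfolding tan_def phi_def using cos_phi_nonzero[OF a]
    by (intro tendsto_intros) (auto simp: phi_def)
  moreover have "eventually (\<lambda>b. tan (phi R b) = tan (of_real pi * b) + (-1) ^ R * (1 / cos (of_real pi * b))) (at a)"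
    using half_int_isolated[OF N]
  proof eventually_elim
    case (elim b)
    have "b \<notin> pole_set R" using elim unfolding pole_set_def by blast
    moreover have "cos (of_real pi * b) \<noteq> 0" using elim cos_pi_eq_0D by blast
    ultimately show ?case using tan_phi[OF cos_phi_nonzero] by simp
  qed
  ultimately have "((\<lambda>b. tan (of_real pi * b) + (-1) ^ R * (1 / cos (of_real pi * b))) \<longlongrightarrow> tan (phi R a)) (at a)"
    by (rule Lim_transform_eventually)
  then show ?thesis unfolding t by (intro tendsto_Lim) auto
next
  case False
  have "tan_sec R a = tan (of_real pi * a) + (-1) ^ R * (1 / cos (of_real pi * a))"
    unfolding tan_sec_def limits_on_def using False by auto
  also have "\<dots> = tan (phi R a)"
    using False cos_pi_eq_0D by (intro tan_phi cos_phi_nonzero[OF a]) blast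
  finally show ?thesis .
qed

lemma sin_cos_nat_pi:
  "sin (of_nat k * of_real pi :: complex) = 0" "cos (of_nat k * of_real pi :: complex) = (-1) ^ k"
proof -
  have e: "of_nat k * of_real pi = complex_of_real (real k * pi)" by simp
  show "sin (of_nat k * of_real pi :: complex) = 0" unfolding e sin_of_real by simp
  show "cos (of_nat k * of_real pi :: complex) = (-1) ^ k" unfolding e cos_of_real by simp
qed

text \<open>Rests on (tan phi + i) cos phi = i exp(-i phi). The angle inside the sine differs from
  pi/2 - phi by a multiple of pi, so the sine is cos phi up to sign; the sign and the residual phase
  depend on \<open>R div 2\<close> alike for both parities.\<close>

lemma phase_identity:
  assumes c: "cos (phi R a) \<noteq> 0"
  shows "exp ((- a / 2 + of_nat R / 2 - 3/4) * of_real pi * \<i>) = - (tan (phi R a) + \<i>) * sin (of_real pi * ((of_nat R - a) / 2 + 1/4))"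
    and "sin (of_real pi * ((of_nat R - a) / 2 + 1/4)) \<noteq> 0"
proof -
  define k where "k = R div 2"
  define W where "W = of_real pi * ((of_nat R - a) / 2 + 1/4)"
  have t: "(tan (phi R a) + \<i>) * cos (phi R a) = \<i> * exp (- (\<i> * phi R a))"
  proof -
    have "exp (- (\<i> * phi R a)) = cos (phi R a) - \<i> * sin (phi R a)"
      using exp_Euler[of "- phi R a"] by (simp add: mult.commute)
    then show ?thesis using c by (simp add: tan_def distrib_right) (simp add: algebra_simps)
  qed
  have ek: "exp (of_nat k * of_real pi * \<i>) = (-1) ^ k"
  proof -
    have "exp (of_nat k * (of_real pi * \<i>)) = exp (of_real pi * \<i>) ^ k" by (rule exp_of_nat_mult)
    then show ?thesis by (simp add: mult.assoc exp_pi_i)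
  qed
  have shift: "sin (of_nat k * of_real pi + z) = (-1) ^ k * sin z" for z :: complex
    by (simp add: sin_add sin_cos_nat_pi)
  have sW: "sin W = (-1) ^ k * cos (phi R a)"
  proof (cases "even R")
    case True
    then have R: "of_nat R = (2 * of_nat k :: complex)" by (auto simp: k_def elim!: evenE)
    have "W = of_nat k * of_real pi + (of_real pi / 2 - phi R a)"
      using True by (simp add: W_def R phi_def field_simps)
    then have "sin W = (-1) ^ k * sin (of_real pi / 2 - phi R a)" by (simp only: shift)
    then show ?thesis by (simp add: sin_diff)
  next
    case False
    then have R: "of_nat R = (2 * of_nat k + 1 :: complex)" by (auto simp: k_def elim!: oddE)
    have "W = of_nat k * of_real pi + (of_real pi / 2 - phi R a)"
      using False by (simp add: W_def R phi_def field_simps)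
    then have "sin W = (-1) ^ k * sin (of_real pi / 2 - phi R a)" by (simp only: shift)
    then show ?thesis by (simp add: sin_diff)
  qed
  show "sin (of_real pi * ((of_nat R - a) / 2 + 1/4)) \<noteq> 0" using sW c unfolding W_def by simp
  have "exp ((- a / 2 + of_nat R / 2 - 3/4) * of_real pi * \<i>) = - \<i> * exp (- (\<i> * phi R a)) * (-1) ^ k"
  proof -
    have i: "- \<i> = exp (- (of_real pi / 2 * \<i>))" using exp_Euler[of "- (of_real pi / 2)"] by (simp add: mult.commute flip: cos_of_real sin_of_real)
    have "(- a / 2 + of_nat R / 2 - 3/4) * of_real pi * \<i> = - (of_real pi / 2 * \<i>) + - (\<i> * phi R a) + of_nat k * of_real pi * \<i>"
    proof (cases "even R")
      case True
      then have R: "of_nat R = (2 * of_nat k :: complex)" by (auto simp: k_def elim!: evenE)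
      show ?thesis using True by (simp add: R phi_def field_simps)
    next
      case False
      then have R: "of_nat R = (2 * of_nat k + 1 :: complex)" by (auto simp: k_def elim!: oddE)
      show ?thesis using False by (simp add: R phi_def field_simps)
    qed
    then have "exp ((- a / 2 + of_nat R / 2 - 3/4) * of_real pi * \<i>) = exp (- (of_real pi / 2 * \<i>)) * exp (- (\<i> * phi R a)) * exp (of_nat k * of_real pi * \<i>)"
      by (simp only: exp_add)
    then show ?thesis unfolding ek i[symmetric] .
  qed
  also have "\<dots> = - ((tan (phi R a) + \<i>) * cos (phi R a)) * (-1) ^ k" unfolding t by simp
  also have "\<dots> = - (tan (phi R a) + \<i>) * sin W" unfolding sW by (simp add: algebra_simps)
  finally show "exp ((- a / 2 + of_nat R / 2 - 3/4) * of_real pi * \<i>) = - (tan (phi R a) + \<i>) * sin (of_real pi * ((of_nat R - a) / 2 + 1/4))"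
    unfolding W_def .
qed

text \<open>Starts from the sum defining \<open>Lam\<close> and reflects each Gamma value. The sines
  that appear differ only by (-1)^s, which combines with (-1/4)^s to 4^(-s); the common sine joins
  the exponential in \<open>phase_identity\<close>. Working with \<open>Lam\<close> directly also
  covers points where \<open>Gamma (1/2 - a)\<close> has a pole but \<open>\<Lambda>(-a)\<close> is
  regular.\<close>

lemma Lam_minus_eq_olver_F:
  assumes a: "a \<notin> pole_set R"
  shows "Lam R (- a) = - (tan_sec R a + \<i>) * 2 powr (- a / 2 + 3/2 * of_nat R - 1/4) * of_real pi
         * olver_R R a"
proof -
  define x where "x = (of_nat R - a) / 2 - 3/4"
  define S where "S = sin (of_real pi * ((of_nat R - a) / 2 + 1/4))"
  note ph = phase_identity[OF cos_phi_nonzero[OF a], folded S_def]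
  have summand: "fact R * (lam_term R (- a) s) =
      (-1) ^ R * of_real pi / S * 2 powr x *
      (fact R / (fact (R - 2 * s) * 4 ^ s) * (1/2) ^ s * rGamma (a / 2 - of_nat R / 2 + 3/4 + of_nat s) / fact s)" if s: "s \<le> R div 2" for s
  proof -
    have s': "2 * s \<le> R" using s by simp
    define w where "w = (- a + of_nat (R - 2 * s)) / 2 + 1/4"
    have o: "of_nat (R - 2 * s) = (of_nat R - 2 * of_nat s :: complex)" using s' by (simp add: of_nat_diff)
    have m: "(-1) ^ (R - 2 * s) = ((-1) ^ R :: complex)" using s' by (simp add: minus_one_power_iff)
    have e: "(- a + of_nat (R - 2 * s)) / 2 - 3/4 = x - of_nat s" unfolding o x_def by (simp add: field_simps)
    have w1: "1 - w = a / 2 - of_nat R / 2 + 3/4 + of_nat s" unfolding w_def o by (simp add: field_simps)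
    have "of_real pi * ((of_nat R - a) / 2 + 1/4) = of_real pi * w + of_nat s * of_real pi" unfolding w_def o by (simp add: field_simps)
    then have Sw: "S = sin (of_real pi * w) * (-1) ^ s" unfolding S_def by (simp add: sin_add sin_cos_nat_pi)
    have refl: "rGamma w * rGamma (1 - w) = sin (of_real pi * w) / of_real pi" by (rule rGamma_reflection_complex)
    have sw: "sin (of_real pi * w) \<noteq> 0" using ph(2) Sw by auto
    then have rw: "rGamma w \<noteq> 0" using refl by auto
    have "Gamma w = of_real pi * rGamma (1 - w) / sin (of_real pi * w)"
      using refl sw rw by (simp add: Gamma_def field_simps)
    also have "\<dots> = of_real pi / S * (-1) ^ s * rGamma (1 - w)"
      unfolding Sw using sw by (simp add: field_simps flip: power_mult_distrib)
    finally have G: "Gamma w = of_real pi / S * (-1) ^ s * rGamma (a / 2 - of_nat R / 2 + 3/4 + of_nat s)" unfolding w1 .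
    have p: "2 powr (x - of_nat s) = 2 powr x * (1/2 :: complex) ^ s" by (simp add: powr_diff powr_nat' power_divide)
    have q: "(- 1/4) ^ s * (-1) ^ s = (1 / 4 ^ s :: complex)" by (simp flip: power_mult_distrib) (simp add: power_divide)
    have "fact R * ((- 1/4) ^ s / fact s * ((-1) ^ (R - 2 * s) / fact (R - 2 * s) * 2 powr ((- a + of_nat (R - 2 * s)) / 2 - 3/4) * Gamma w)) =
      (-1) ^ R * of_real pi / S * 2 powr x * (fact R / fact (R - 2 * s) * ((- 1/4) ^ s * (-1) ^ s) * (1/2) ^ s * rGamma (a / 2 - of_nat R / 2 + 3/4 + of_nat s) / fact s)"
      unfolding e m p G by (simp add: mult_ac)
    then show ?thesis unfolding q w_def by simp
  qed
  have "Lam R (- a) = of_real (sqrt 2) * exp ((- a / 2 - 3/4) * of_real pi * \<i>) * (- 2 * \<i>) ^ R *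
     (\<Sum>s\<le>R div 2. fact R * (lam_term R (- a) s))"
    unfolding Lam_def sum_distrib_left[symmetric] by simp
  also have "(\<Sum>s\<le>R div 2. fact R * (lam_term R (- a) s)) =
     (-1) ^ R * of_real pi / S * 2 powr x * olver_R R a"
    unfolding olver_F_half sum_distrib_left by (rule sum.cong[OF refl]) (rule summand, simp)
  also have "of_real (sqrt 2) * exp ((- a / 2 - 3/4) * of_real pi * \<i>) * (- 2 * \<i>) ^ R * ((-1) ^ R * of_real pi / S * 2 powr x * olver_R R a)
     = (exp ((- a / 2 - 3/4) * of_real pi * \<i>) * exp (of_nat R / 2 * of_real pi * \<i>)) / S * (of_real (sqrt 2) * 2 powr x * 2 powr (of_nat R)) * of_real pi * olver_R R a"
  proof -
    have regroup: "m * n = P * e \<Longrightarrow> s * E * m * (n * q / S * X * F) = (E * e) / S * (s * X * P) * q * F"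
      for m n P e s E q X F :: complex
    proof -
      assume h: "m * n = P * e"
      have "s * E * m * (n * q / S * X * F) = (m * n) * (s * E * q * X * F) / S" by (simp add: mult_ac)
      then show ?thesis unfolding h by (simp add: mult_ac)
    qed
    show ?thesis by (rule regroup[OF minus_two_i_power])
  qed
  also have "of_real (sqrt 2) * 2 powr x * 2 powr (of_nat R) = 2 powr (- a / 2 + 3/2 * of_nat R - 1/4)"
    unfolding two_powr_half[symmetric] powr_add[symmetric] x_def by (rule arg_cong) (simp add: field_simps)
  also have "exp ((- a / 2 - 3/4) * of_real pi * \<i>) * exp (of_nat R / 2 * of_real pi * \<i>) = exp ((- a / 2 + of_nat R / 2 - 3/4) * of_real pi * \<i>)"
    unfolding exp_add[symmetric] by (rule arg_cong) (simp add: field_simps)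
  also have "exp ((- a / 2 + of_nat R / 2 - 3/4) * of_real pi * \<i>) / S = - (tan_sec R a + \<i>)"
    unfolding ph(1) tan_sec_eq[OF a] using ph(2) by simp
  finally show ?thesis .
qed

section \<open>Evaluation of the particular solutions\<close>

lemma integral_inf_eq:
  assumes G: "\<And>z. (G has_field_derivative f z) (at z)" and lim: "((\<lambda>X. G (of_real X * d)) \<longlongrightarrow> l) at_top"
  shows "integral_from_inf d z f = G z - l" "integral_to_inf z d f = l - G z"
proof -
  have c: "contour_integral (linepath u v) f = G v - G u" for u v
    using contour_integral_primitive[of UNIV G f "linepath u v"] G
    by (auto intro: contour_integral_unique)
  have "((\<lambda>X::real. contour_integral (linepath (of_real X * d) z) f) \<longlongrightarrow> G z - l) at_top"
    unfolding c by (intro tendsto_intros lim)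
  then show "integral_from_inf d z f = G z - l"
    unfolding integral_from_inf_def by (intro tendsto_Lim) auto
  have "((\<lambda>X::real. contour_integral (linepath z (of_real X * d)) f) \<longlongrightarrow> l - G z) at_top"
    unfolding c by (intro tendsto_intros lim)
  then show "integral_to_inf z d f = l - G z"
    unfolding integral_to_inf_def by (intro tendsto_Lim) auto
qed

text \<open>A primitive normalised at 0. Taking it as an integral over a fixed segment makes its
  continuity in the parameter visible (\<open>isCont_pcF\<close>).\<close>

definition pcF :: "nat \<Rightarrow> complex \<Rightarrow> complex \<Rightarrow> complex" where
  "pcF R a z = contour_integral (linepath 0 z) (\<lambda>t. t ^ R * pcU a t)"

lemma pcF_deriv: "(pcF R a has_field_derivative z ^ R * pcU a z) (at z)"
proof -
  have "(\<lambda>t. t ^ R * pcU a t) holomorphic_on UNIV" by (intro holomorphic_intros)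
  then obtain G where G: "\<And>z. (G has_field_derivative z ^ R * pcU a z) (at z)"
    using holomorphic_convex_primitive'[of UNIV "\<lambda>t. t ^ R * pcU a t"] by auto
  have "pcF R a = (\<lambda>z. G z - G 0)"
    unfolding pcF_def using contour_integral_primitive[of UNIV G "\<lambda>t. t ^ R * pcU a t"] G
    by (intro ext contour_integral_unique) fastforce
  then show ?thesis using G by (auto intro!: derivative_eq_intros)
qed

lemma pcF_0 [simp]: "pcF R a 0 = 0"
  by (simp add: pcF_def)

lemma pcF_tendsto: "((\<lambda>X. pcF R a (of_real X)) \<longlongrightarrow> pcM a R) at_top"
proof -
  have "((\<lambda>t. pcF R a (of_real t)) has_vector_derivative of_real t ^ R * pcU a (of_real t)) (at t)" for t
    by (rule has_vector_derivative_real_field[OF pcF_deriv])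
  from half_line_FTC[OF this integrable_power_pcU] show ?thesis by (simp add: pcM_def)
qed

lemma isCont_pcF: "isCont (\<lambda>a. pcF R (g a) z) a" if "continuous_on UNIV g" for g :: "complex \<Rightarrow> complex"
proof -
  have cont: "continuous_on (UNIV \<times> cbox 0 1) (\<lambda>(b, x). linepath 0 z x ^ R * pcU (g b) (linepath 0 z x) * (z - 0))"
    unfolding case_prod_beta linepath_def
    by (intro continuous_intros continuous_on_compose2[OF that]) auto
  have "pcF R (g b) z = integral (cbox 0 1) (\<lambda>x. linepath 0 z x ^ R * pcU (g b) (linepath 0 z x) * (z - 0))" for b
  proof -
    have "((\<lambda>t. t ^ R * pcU (g b) t) has_contour_integral pcF R (g b) z) (linepath 0 z)"
      unfolding pcF_def
      by (intro has_contour_integral_integral contour_integrable_continuous_linepath continuous_intros)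
    then show ?thesis
      unfolding has_contour_integral_linepath by (simp add: integral_unique cbox_interval)
  qed
  moreover have "continuous_on UNIV (\<lambda>b. integral (cbox 0 1) (\<lambda>x. linepath 0 z x ^ R * pcU (g b) (linepath 0 z x) * (z - 0)))"
    by (rule integral_continuous_on_param[OF cont])
  ultimately have "continuous_on UNIV (\<lambda>b. pcF R (g b) z)" by simp
  then show ?thesis by (simp add: continuous_on_eq_continuous_at)
qed

text \<open>The expression whose limit in the parameter defines \<open>U02\<close>, with its
  integrals evaluated as moments minus primitives. The parameter comes last so that
  \<open>rawU02 R z\<close> is the function under the limit.\<close>

definition rawU02 :: "nat \<Rightarrow> complex \<Rightarrow> complex \<Rightarrow> complex" where
  "rawU02 R z a = - pcA a *
     (pcU a z * ((-1) ^ R * (pcM a R - pcF R a (- z))) + pcU a (- z) * (pcM a R - pcF R a z))"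

lemma U02_eq: "U02 R a z = limits_on {a. \<exists>N::nat. a = - of_nat N - 1/2 \<and> odd (int N - int R)} (rawU02 R z) a"
proof -
  have 1: "integral_from_inf (-1) z (\<lambda>t. t ^ R * pcU a (- t)) = (-1) ^ R * (pcM a R - pcF R a (- z))" for a
  proof -
    define G where "G = (\<lambda>z. (-1) ^ (R + 1) * pcF R a (-1 * z))"
    have "(G has_field_derivative z ^ R * pcU a (- z)) (at z)" for z
    proof -
      have "((\<lambda>z. -1 * z) has_field_derivative -1) (at z)" by (auto intro!: derivative_eq_intros)
      from DERIV_cmult[OF DERIV_chain2[OF pcF_deriv this], of "(-1) ^ (R + 1)"]
      have "(G has_field_derivative (-1) ^ (R + 1) * ((-1 * z) ^ R * pcU a (-1 * z) * -1)) (at z)" unfolding G_def .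
      also have "(-1) ^ (R + 1) * ((-1 * z) ^ R * pcU a (-1 * z) * -1) = ((-1) ^ R * (-1) ^ R) * z ^ R * pcU a (- z)"
        unfolding power_mult_distrib[of "-1" z] by simp
      also have "(-1) ^ R * (-1) ^ R = (1 :: complex)" by (simp flip: power_mult_distrib)
      finally show ?thesis by simp
    qed
    moreover have "((\<lambda>X. G (of_real X * -1)) \<longlongrightarrow> (-1) ^ (R + 1) * pcM a R) at_top"
      using tendsto_mult[OF tendsto_const pcF_tendsto, of "(-1) ^ (R + 1)"] by (simp add: G_def)
    ultimately show ?thesis by (subst integral_inf_eq(1)) (auto simp: G_def algebra_simps)
  qed
  have 2: "integral_to_inf z 1 (\<lambda>t. t ^ R * pcU a t) = pcM a R - pcF R a z" for a
    by (rule integral_inf_eq(2)[OF pcF_deriv]) (simp add: pcF_tendsto)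
  show ?thesis unfolding U02_def parcyl_U_eq 1 2 rawU02_def pcA_def by simp
qed

lemma U01_eq:
  "U01 R a z = pce a * (\<i> ^ (R + 1) * pcU a z * (pcM (- a) R - pcF R (- a) (- \<i> * z)) - pcU (- a) (- \<i> * z) * (pcM a R - pcF R a z))"
proof -
  have 1: "integral_from_inf 1 z (\<lambda>t. t ^ R * pcU a t) = pcF R a z - pcM a R"
    by (rule integral_inf_eq(1)[OF pcF_deriv]) (simp add: pcF_tendsto)
  have 2: "integral_from_inf \<i> z (\<lambda>t. t ^ R * pcU (- a) (- \<i> * t)) = \<i> ^ (R + 1) * (pcF R (- a) (- \<i> * z) - pcM (- a) R)"
  proof -
    define G where "G = (\<lambda>z. \<i> ^ (R + 1) * pcF R (- a) (- \<i> * z))"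
    have "(G has_field_derivative z ^ R * pcU (- a) (- \<i> * z)) (at z)" for z
    proof -
      have "((\<lambda>z. - \<i> * z) has_field_derivative - \<i>) (at z)" by (auto intro!: derivative_eq_intros)
      from DERIV_cmult[OF DERIV_chain2[OF pcF_deriv this], of "\<i> ^ (R + 1)"]
      have "(G has_field_derivative \<i> ^ (R + 1) * ((- \<i> * z) ^ R * pcU (- a) (- \<i> * z) * - \<i>)) (at z)" unfolding G_def .
      also have "\<i> ^ (R + 1) * ((- \<i> * z) ^ R * pcU (- a) (- \<i> * z) * - \<i>) = (\<i> ^ (R + 1) * (- \<i>) ^ (R + 1)) * z ^ R * pcU (- a) (- \<i> * z)"
        unfolding power_mult_distrib[of "- \<i>" z] by simp
      also have "\<i> ^ (R + 1) * (- \<i>) ^ (R + 1) = 1" by (simp only: power_mult_distrib[symmetric]) simp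
      finally show ?thesis by simp
    qed
    moreover have "((\<lambda>X. G (of_real X * \<i>)) \<longlongrightarrow> \<i> ^ (R + 1) * pcM (- a) R) at_top"
    proof -
      have "G (of_real X * \<i>) = \<i> ^ (R + 1) * pcF R (- a) (of_real X)" for X
      proof -
        have "- \<i> * (of_real X * \<i>) = complex_of_real X" by (simp add: complex_eq_iff)
        then show ?thesis unfolding G_def by (simp only:)
      qed
      then show ?thesis using tendsto_mult[OF tendsto_const pcF_tendsto, of "\<i> ^ (R + 1)"] by simp
    qed
    ultimately show ?thesis by (subst integral_inf_eq(1)) (auto simp: G_def algebra_simps)
  qed
  show ?thesis unfolding U01_def parcyl_U_eq 1 2 pce_def by (simp add: algebra_simps)
qed

text \<open>The connection formula enters twice: it removes the terms with U(a,-z) from the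
  difference, and it shows that the remaining coefficient of U(a,z) has derivative 0.\<close>

lemma rawU02_eq:
  assumes p: "a + 1/2 \<notin> \<int>\<^sub>\<le>\<^sub>0"
  shows "rawU02 R z a = U01 R a z + Lam R a * pcU a z"
proof -
  define A where "A = pcA a"
  define e where "e = pce a"
  have conn: "e * pcU (- a) (- \<i> * z) = A * (pcU a (- z) + e\<^sup>2 * pcU a z)" for z
    unfolding e_def A_def by (rule pcU_connection[OF p])
  \<comment> \<open>The coefficient of U(a,z) in \<open>rawU02 R z a - U01 R a z\<close> after
    eliminating U(-a,-iz). At z = 0 the primitives vanish and \<open>lamM a R\<close> is
    left.\<close>
  define C where "C = (\<lambda>z. - A * ((-1) ^ R * (pcM a R - pcF R a (-1 * z)) - e\<^sup>2 * (pcM a R - pcF R a z)) - e * \<i> ^ (R + 1) * (pcM (- a) R - pcF R (- a) (- \<i> * z)))"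
  have dC: "(C has_field_derivative 0) (at z)" for z
  proof -
    have m: "((\<lambda>z. -1 * z) has_field_derivative -1) (at z)" "((\<lambda>z. - \<i> * z) has_field_derivative - \<i>) (at z)"
      by (auto intro!: derivative_eq_intros)
    have s: "(-1) ^ R * (-1 * z) ^ R = z ^ R" "\<i> ^ (R + 1) * ((- \<i> * z) ^ R * - \<i>) = z ^ R"
    proof -
      show "(-1) ^ R * (-1 * z) ^ R = z ^ R" by (simp only: power_mult_distrib[symmetric]) simp
      have "\<i> ^ (R + 1) * ((- \<i> * z) ^ R * - \<i>) = \<i> ^ (R + 1) * (- \<i>) ^ (R + 1) * z ^ R"
        unfolding power_mult_distrib[of "- \<i>" z] by simp
      also have "\<i> ^ (R + 1) * (- \<i>) ^ (R + 1) = 1" by (simp only: power_mult_distrib[symmetric]) simp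
      finally show "\<i> ^ (R + 1) * ((- \<i> * z) ^ R * - \<i>) = z ^ R" by simp
    qed
    have "(C has_field_derivative - A * ((-1) ^ R * (0 - (-1 * z) ^ R * pcU a (-1 * z) * -1) - e\<^sup>2 * (0 - z ^ R * pcU a z))
        - e * \<i> ^ (R + 1) * (0 - (- \<i> * z) ^ R * pcU (- a) (- \<i> * z) * - \<i>)) (at z)"
      unfolding C_def by (intro DERIV_diff DERIV_cmult DERIV_const pcF_deriv DERIV_chain2[OF pcF_deriv m(1)] DERIV_chain2[OF pcF_deriv m(2)])
    also have "- A * ((-1) ^ R * (0 - (-1 * z) ^ R * pcU a (-1 * z) * -1) - e\<^sup>2 * (0 - z ^ R * pcU a z))
        - e * \<i> ^ (R + 1) * (0 - (- \<i> * z) ^ R * pcU (- a) (- \<i> * z) * - \<i>)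
      = - A * (((-1) ^ R * (-1 * z) ^ R) * pcU a (- z) + e\<^sup>2 * z ^ R * pcU a z) + (\<i> ^ (R + 1) * ((- \<i> * z) ^ R * - \<i>)) * (e * pcU (- a) (- \<i> * z))"
      by (simp add: algebra_simps)
    also have "\<dots> = 0" unfolding s conn by (simp add: algebra_simps)
    finally show ?thesis .
  qed
  obtain c where c: "\<And>z. C z = c"
    using has_field_derivative_zero_constant[of UNIV C] dC by auto
  have "C z = C 0" by (simp add: c)
  also have "\<dots> = lamM a R" unfolding C_def lamM_def A_def[symmetric] e_def[symmetric] by (simp add: algebra_simps)
  finally have Cz: "C z = Lam R a" using Lam_eq_lamM[OF p] by simp
  have "U01 R a z = e * \<i> ^ (R + 1) * pcU a z * (pcM (- a) R - pcF R (- a) (- \<i> * z)) - (e * pcU (- a) (- \<i> * z)) * (pcM a R - pcF R a z)"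
    unfolding U01_eq e_def[symmetric] by (simp add: algebra_simps)
  then have "U01 R a z + C z * pcU a z = rawU02 R z a"
    unfolding conn C_def rawU02_def A_def[symmetric] by (simp add: algebra_simps)
  then show ?thesis unfolding Cz by simp
qed

section \<open>Passage to the limit at the removable singularities\<close>

lemma isCont_Lam:
  assumes "\<And>k. k \<le> R div 2 \<Longrightarrow> (a + of_nat (R - 2 * k)) / 2 + 1/4 \<notin> \<int>\<^sub>\<le>\<^sub>0"
  shows "isCont (Lam R) a"
proof -
  have "isCont (\<lambda>b. Gamma ((b + of_nat (R - 2 * k)) / 2 + 1/4)) a" if "k \<le> R div 2" for k
    using assms[OF that] by (intro isCont_Gamma continuous_intros) auto
  moreover have "isCont (\<lambda>b. 2 powr ((b + of_nat (R - 2 * k)) / 2 - 3/4)) a" for k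
    unfolding powr_def by (auto intro!: continuous_intros)
  ultimately have "isCont (\<lambda>b. lam_term R b s) a" if "s \<le> R div 2" for s
    using that by (intro isCont_mult continuous_const)
  then have "isCont (\<lambda>b. \<Sum>s\<le>R div 2. lam_term R b s) a"
    by (intro continuous_sum) simp
  moreover have "isCont (\<lambda>b. of_real (sqrt 2) * exp ((b / 2 - 3/4) * of_real pi * \<i>) * (- 2 * \<i>) ^ R * fact R) a"
    by (intro continuous_intros) auto
  ultimately show ?thesis unfolding Lam_def by (rule isCont_mult[rotated])
qed

lemma isCont_pcU_param: "continuous_on UNIV g \<Longrightarrow> isCont (\<lambda>a. pcU (g a) z) a"
  using continuous_on_pcU[of UNIV g "\<lambda>_. z"] by (simp add: continuous_on_eq_continuous_at)

lemma isCont_U01: "isCont (\<lambda>a. U01 R a z) a"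
proof -
  have n: "continuous_on UNIV (\<lambda>a::complex. - a)" "continuous_on UNIV (\<lambda>a::complex. a)" by (intro continuous_intros)+
  have "isCont (\<lambda>a. pcM (- a) R) a"
    by (rule isCont_o2[OF _ isCont_pcM]) (intro continuous_intros)
  then show ?thesis unfolding U01_eq pce_def
    by (intro continuous_intros isCont_pcM isCont_pcF isCont_pcU_param n) auto
qed

text \<open>Away from the poles of \<open>Gamma (a + 1/2)\<close> this is \<open>rawU02_eq\<close>.
  At a removable singularity that identity holds in a punctured neighbourhood and its right side is
  continuous, which gives the limit in \<open>U02\<close>.\<close>

lemma U02_formula:
  assumes a: "\<not> (\<exists>N::nat. a = - of_nat N - 1/2 \<and> even (int N - int R))"
  shows "U02 R a z = U01 R a z + Lam R a * pcU a z"
proof (cases "a + 1/2 \<in> \<int>\<^sub>\<le>\<^sub>0")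
  case False
  have S: "a \<notin> {a. \<exists>N::nat. a = - of_nat N - 1/2 \<and> odd (int N - int R)}"
  proof
    assume "a \<in> {a. \<exists>N::nat. a = - of_nat N - 1/2 \<and> odd (int N - int R)}"
    then obtain N :: nat where "a + 1/2 = - of_nat N" by auto
    then show False using False by (metis minus_of_nat_in_nonpos_Ints)
  qed
  show ?thesis unfolding U02_eq limits_on_def if_not_P[OF S] by (rule rawU02_eq[OF False])
next
  case True
  then obtain N where N: "a + 1/2 = - of_nat N" by (rule nonpos_Ints_cases')
  then have aN: "a = - of_nat N - 1/2" by (simp add: eq_diff_eq)
  have odd: "odd (int N - int R)" using a aN by blast
  have S: "a \<in> {a. \<exists>N::nat. a = - of_nat N - 1/2 \<and> odd (int N - int R)}" using aN odd by blast
  \<comment> \<open>With a = -N - 1/2 the Gamma arguments are (R - 2 k - N)/2, which is not an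
    integer when N - R is odd.\<close>
  have "(a + of_nat (R - 2 * k)) / 2 + 1/4 \<notin> \<int>\<^sub>\<le>\<^sub>0" if k: "k \<le> R div 2" for k
  proof
    assume "(a + of_nat (R - 2 * k)) / 2 + 1/4 \<in> \<int>\<^sub>\<le>\<^sub>0"
    then obtain m where m: "(a + of_nat (R - 2 * k)) / 2 + 1/4 = - of_nat m" by (rule nonpos_Ints_cases')
    have "(a + 1/2) + of_nat (R - 2 * k) = 2 * ((a + of_nat (R - 2 * k)) / 2 + 1/4)" by (simp add: field_simps)
    also have "\<dots> = - of_nat (2 * m)" unfolding m by simp
    finally have e: "- of_nat N + of_nat (R - 2 * k) = (- of_nat (2 * m) :: complex)" unfolding N .
    have "of_nat (R - 2 * k) + of_nat (2 * m) = of_nat N + (- of_nat N + of_nat (R - 2 * k)) + (of_nat (2 * m) :: complex)" by simp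
    also have "\<dots> = of_nat N" unfolding e by simp
    finally have "of_nat (R - 2 * k) + of_nat (2 * m) = (of_nat N :: complex)" .
    then have "of_nat (R - 2 * k + 2 * m) = (of_nat N :: complex)" by simp
    then have RN: "R - 2 * k + 2 * m = N" by (simp only: of_nat_eq_iff)
    have "int N - int R = 2 * (int m - int k)" using RN k by presburger
    then have "even (int N - int R)" by (rule dvdI)
    then show False using odd by blast
  qed
  then have LC: "isCont (Lam R) a" by (rule isCont_Lam)
  have "a = of_int (- int N - 1) + 1/2" using aN by simp
  from half_int_isolated[OF this]
  have ev: "eventually (\<lambda>b. U01 R b z + Lam R b * pcU b z = rawU02 R z b) (at a)"
  proof eventually_elim
    case (elim b)
    have "b + 1/2 \<notin> \<int>\<^sub>\<le>\<^sub>0"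
    proof
      assume "b + 1/2 \<in> \<int>\<^sub>\<le>\<^sub>0"
      then obtain m where "b + 1/2 = - of_nat m" by (rule nonpos_Ints_cases')
      then have "b = of_int (- int m - 1) + 1/2" by (simp add: eq_diff_eq algebra_simps)
      then show False using elim by blast
    qed
    then show ?case by (rule rawU02_eq[symmetric])
  qed
  have "((\<lambda>b. U01 R b z + Lam R b * pcU b z) \<longlongrightarrow> U01 R a z + Lam R a * pcU a z) (at a)"
    using isCont_U01 LC isCont_pcU_param[of "\<lambda>a. a" a z] unfolding isCont_def by (intro tendsto_intros) auto
  then have "(rawU02 R z \<longlongrightarrow> U01 R a z + Lam R a * pcU a z) (at a)"
    by (rule Lim_transform_eventually[OF _ ev])
  then have "Lim (at a) (rawU02 R z) = U01 R a z + Lam R a * pcU a z"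
    by (intro tendsto_Lim) auto
  then show ?thesis unfolding U02_eq limits_on_def if_P[OF S] .
qed

theorem theorem2p1:
  fixes R :: nat
  shows "\<exists>\<Lambda> :: complex \<Rightarrow> complex.
    (\<forall>a z. \<not> (\<exists>N::nat. a = - of_nat N - 1/2 \<and> even (int N - int R)) \<longrightarrow>
       U02 R a z = U01 R a z + \<Lambda> a * parcyl_U a z) \<and>
    (\<forall>a. (\<forall>n::nat. a + 1/2 \<noteq> - of_nat n) \<longrightarrow>
       \<Lambda> a =
         2 powr (- a / 2 + 3/2 * of_nat R + 1/4) * of_real (sqrt pi)
         * exp ((a / 2 + of_nat R / 2 - 3/4) * of_real pi * \<i>) * Gamma (a + 1/2)
         * olver_F (1/2 - of_nat R / 2) (- of_nat R / 2) (a / 2 - of_nat R / 2 + 3/4) (1/2)) \<and>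
    (\<forall>a. \<not> (\<exists>N::int. a = of_int N + 1/2 \<and> even (N - int R)) \<longrightarrow>
       \<Lambda> (- a) =
         - (tan_sec R a + \<i>)
         * 2 powr (- a / 2 + 3/2 * of_nat R - 1/4) * of_real pi
         * olver_F (1/2 - of_nat R / 2) (- of_nat R / 2) (a / 2 - of_nat R / 2 + 3/4) (1/2))"
\<comment> \<open>The witness is \<open>Lam\<close> and not \<open>lamM\<close>, since at the
  removable singularities the default value 0 of Gamma in \<open>pcA\<close> would make
  \<open>lamM\<close> wrong.\<close>
proof (intro exI[of _ "Lam R"] conjI allI impI)
  fix a z :: complex assume "\<not> (\<exists>N::nat. a = - of_nat N - 1/2 \<and> even (int N - int R))"
  then show "U02 R a z = U01 R a z + Lam R a * parcyl_U a z"
    unfolding parcyl_U_eq by (rule U02_formula)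
next
  fix a :: complex assume "\<forall>n::nat. a + 1/2 \<noteq> - of_nat n"
  then have "a + 1/2 \<notin> \<int>\<^sub>\<le>\<^sub>0" by (metis nonpos_Ints_cases')
  then show "Lam R a =
         2 powr (- a / 2 + 3/2 * of_nat R + 1/4) * of_real (sqrt pi)
         * exp ((a / 2 + of_nat R / 2 - 3/4) * of_real pi * \<i>) * Gamma (a + 1/2)
         * olver_F (1/2 - of_nat R / 2) (- of_nat R / 2) (a / 2 - of_nat R / 2 + 3/4) (1/2)"
    by (rule Lam_eq_olver_F)
next
  fix a :: complex assume "\<not> (\<exists>N::int. a = of_int N + 1/2 \<and> even (N - int R))"
  then have "a \<notin> pole_set R" unfolding pole_set_def by blast
  then show "Lam R (- a) =
         - (tan_sec R a + \<i>)
         * 2 powr (- a / 2 + 3/2 * of_nat R - 1/4) * of_real pi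
         * olver_F (1/2 - of_nat R / 2) (- of_nat R / 2) (a / 2 - of_nat R / 2 + 3/4) (1/2)"
    by (rule Lam_minus_eq_olver_F)
qed

end
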